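(* Let $n\in\mathbb{N}$, $\alpha\in(0,1)$, $p\in[1,+\infty]$ and $f\in BV^{\alpha,p}(\mathbb{R}^n)$. Then: (i) if $p\in\left[1,\frac{n}{1-\alpha}\right)$, then $|D^\alpha f|\ll\mathcal{H}^{n-1}$; (ii) if $p\in\left[\frac{n}{1-\alpha},+\infty\right]$, then $|D^\alpha f|\ll\mathcal{H}^{n-\alpha-\frac np}$ (with $\frac np=0$ if $p=+\infty$).
   Context: $\mathcal{H}^s$ denotes the $s$-dimensional Hausdorff measure on $\mathbb{R}^n$. For $\alpha\in(0,1)$ let $\mu_{n,\alpha}=2^{\alpha}\pi^{-n/2}\Gamma\left(\frac{n+\alpha+1}{2}\right)/\Gamma\left(\frac{1-\alpha}{2}\right)$ and, for $\varphi\in C^\infty_c(\mathbb{R}^n;\mathbb{R}^n)$, define the fractional divergence $\operatorname{div}^\alpha\varphi(x)=\mu_{n,\alpha}\int_{\mathbb{R}^n}\frac{(y-x)\cdot(\varphi(y)-\varphi(x))}{|y-x|^{n+\alpha+1}}\,dy$. For $p\in[1,+\infty]$, $BV^{\alpha,p}(\mathbb{R}^n)$ is the set of $f\in L^p(\mathbb{R}^n)$ with $|D^\alpha f|(\mathbb{R}^n):=\sup\{\int_{\mathbb{R}^n} f\operatorname{div}^\alpha\varphi\,dx:\varphi\in C^\infty_c(\mathbb{R}^n;\mathbb{R}^n),\ \|\varphi\|_{L^\infty}\le1\}<+\infty$. For such $f$ there is a unique finite $\mathbb{R}^n$-valued Radon measure $D^\alpha f$ on $\mathbb{R}^n$ with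 $\int f\operatorname{div}^\alpha\varphi\,dx=-\int\varphi\cdot dD^\alpha f$ for all $\varphi\in C^\infty_c(\mathbb{R}^n;\mathbb{R}^n)$; $|D^\alpha f|$ is its total variation measure. *)

theory Defs
  imports "HOL-Analysis.Analysis"
begin

text \<open>C-infinity: differentiable everywhere, and every directional derivative
  (x maps to D x v) is again C-infinity (greatest fixed point, i.e. derivatives of
  all finite orders exist).\<close>
coinductive smooth_fun :: "('a::real_normed_vector \<Rightarrow> 'b::real_normed_vector) \<Rightarrow> bool" where
  "(\<forall>x. (f has_derivative D x) (at x)) \<Longrightarrow> (\<forall>v. smooth_fun (\<lambda>x. D x v)) \<Longrightarrow> smooth_fun f"

definition test_field :: "('a::euclidean_space \<Rightarrow> 'a) \<Rightarrow> bool" where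
  "test_field \<phi> \<longleftrightarrow> smooth_fun \<phi> \<and> compact (closure {x. \<phi> x \<noteq> 0})"

definition frac_const :: "nat \<Rightarrow> real \<Rightarrow> real" where
  "frac_const n \<alpha> = 2 powr \<alpha> * pi powr (- real n / 2) * Gamma ((real n + \<alpha> + 1) / 2)
                     / Gamma ((1 - \<alpha>) / 2)"

definition frac_div :: "real \<Rightarrow> ('a::euclidean_space \<Rightarrow> 'a) \<Rightarrow> 'a \<Rightarrow> real" where
  "frac_div \<alpha> \<phi> x = frac_const DIM('a) \<alpha> *
     (LINT y|lebesgue. ((y - x) \<bullet> (\<phi> y - \<phi> x)) / norm (y - x) powr (real DIM('a) + \<alpha> + 1))"

definition Lp :: "ennreal \<Rightarrow> ('a::euclidean_space \<Rightarrow> real) \<Rightarrow> bool" where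
  "Lp p f \<longleftrightarrow> f \<in> borel_measurable lebesgue \<and>
     (if p = \<infinity> then (\<exists>C. AE x in lebesgue. \<bar>f x\<bar> \<le> C)
      else integrable lebesgue (\<lambda>x. \<bar>f x\<bar> powr enn2real p))"

definition frac_variation :: "real \<Rightarrow> ('a::euclidean_space \<Rightarrow> real) \<Rightarrow> ereal" where
  "frac_variation \<alpha> f = (SUP \<phi> \<in> {\<phi>. test_field \<phi> \<and> (\<forall>x. norm (\<phi> x) \<le> 1)}.
      ereal (LINT x|lebesgue. f x * frac_div \<alpha> \<phi> x))"

definition BV_frac :: "real \<Rightarrow> ennreal \<Rightarrow> ('a::euclidean_space \<Rightarrow> real) \<Rightarrow> bool" where
  "BV_frac \<alpha> p f \<longleftrightarrow> Lp p f \<and> frac_variation \<alpha> f < \<infinity>"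

definition haus_const :: "real \<Rightarrow> real" where
  "haus_const s = pi powr (s / 2) / Gamma (s / 2 + 1)"

text \<open>Contribution of one covering set; convention diam(empty)^s = 0 and d^0 = 1.\<close>
definition haus_term :: "real \<Rightarrow> 'a::metric_space set \<Rightarrow> real" where
  "haus_term s S = (if S = {} then 0 else if s = 0 then 1
                    else haus_const s * (diameter S / 2) powr s)"

definition hausdorff_pre :: "real \<Rightarrow> real \<Rightarrow> 'a::metric_space set \<Rightarrow> ennreal" where
  "hausdorff_pre s \<delta> A = (INF C \<in> {C :: nat \<Rightarrow> 'a set. A \<subseteq> (\<Union>i. C i) \<and>
        (\<forall>i. bounded (C i) \<and> diameter (C i) \<le> \<delta>)}. (\<Sum>i. ennreal (haus_term s (C i))))"

definition hausdorff :: "real \<Rightarrow> 'a::metric_space set \<Rightarrow> ennreal" where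
  "hausdorff s A = (SUP \<delta> \<in> {0<..}. hausdorff_pre s \<delta> A)"

definition abs_cont_hausdorff :: "'a::euclidean_space measure \<Rightarrow> real \<Rightarrow> bool" where
  "abs_cont_hausdorff \<mu> s \<longleftrightarrow> (\<forall>B \<in> sets borel. hausdorff s B = 0 \<longrightarrow> emeasure \<mu> B = 0)"

text \<open>(\<mu>, \<sigma>) is a polar decomposition of D^alpha f: D^alpha f = \<sigma> \<mu>,
  \<mu> = |D^alpha f| a finite (hence Radon) Borel measure, |\<sigma>| = 1.\<close>
definition frac_grad_polar :: "real \<Rightarrow> ('a::euclidean_space \<Rightarrow> real) \<Rightarrow> 'a measure \<Rightarrow> ('a \<Rightarrow> 'a) \<Rightarrow> bool" where
  "frac_grad_polar \<alpha> f \<mu> \<sigma> \<longleftrightarrow> sets \<mu> = sets borel \<and> finite_measure \<mu> \<and>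
     \<sigma> \<in> borel_measurable \<mu> \<and> (\<forall>x. norm (\<sigma> x) = 1) \<and>
     (\<forall>\<phi>. test_field \<phi> \<longrightarrow>
        (LINT x|lebesgue. f x * frac_div \<alpha> \<phi> x) = - (LINT x|\<mu>. \<phi> x \<bullet> \<sigma> x))"

end

theory Submission
  imports Defs
begin

text \<open>
  Cover a compact set \<open>K\<close> with \<open>H\<^sup>s(K) = 0\<close> by finitely many balls of radii \<open>r\<close> with small sum of \<open>r\<^sup>s\<close>.
  Inserting the balls by decreasing radius, the increments of the running maximum of their bumps
  form a partition of unity near \<open>K\<close> whose pieces have Lipschitz constant \<open>2/r\<close>, whatever the
  overlaps are. Hence an additive functional on test fields that is dominated by \<open>\<mu>\<close> and is \<open>O(r\<^sup>s)\<close>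
  on fields adapted to a ball of radius \<open>r\<close> is bounded by \<open>\<mu>(-K)\<close> on test fields of sup norm at most 1.
  If this applies to \<open>\<phi> \<mapsto> \<integral> \<phi> \<cdot> dD\<^sup>\<alpha>f\<close>, whose supremum over these fields is \<open>\<mu>(UNIV)\<close>,
  then \<open>\<mu>(K) = 0\<close>; inner regularity does the rest.

  For large \<open>p\<close> the required decay follows from scaling of the fractional divergence in the
  dual \<open>L\<^sup>p\<close> space. For small \<open>p\<close> one has \<open>D\<^sup>\<alpha>f = Du\<close> for the Riesz potential \<open>u\<close> of \<open>f\<close>, and the
  argument is applied to bounded smooth truncations \<open>T(u)\<close> with \<open>|T'| \<le> 1\<close>: their gradients are
  dominated by \<open>\<mu>\<close> (seen by mollifying \<open>u\<close>), and boundedness gives the decay of order \<open>n - 1\<close>.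
\<close>

section \<open>Smooth functions and bumps\<close>

text \<open>What is known at small scales concerns only signed pairings with Lipschitz fields, not
  the mass \<open>\<mu>\<close> of a ball, so the covering has to be tested by fields. The
  comparison of the total mass with \<open>\<mu> (-K)\<close> yields \<open>\<mu> K = 0\<close> only
  if the factor in front of \<open>\<mu> (-K)\<close> is exactly 1. Hence the remainder left by the
  partition must have sup norm at most 1, and truncations must not increase the variation at all.
  The constant in the decay \<open>O(r^s)\<close>, in contrast, is multiplied by arbitrarily small
  covering sums and disappears; it may depend on the field and on the truncation level. Duality
  gives the exponent n - \<alpha> - n/p. It equals n - 1 at p = n/(1 - \<alpha>) and is smaller for
  smaller p, so below this threshold duality alone is too weak. A bounded potential does better: a
  divergence of size 1/r on a volume r^n gives r^(n - 1). The Riesz potential is in general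
  unbounded, which forces the truncation; the limit in the truncation level is taken after the decay
  constants have disappeared.\<close>

text \<open>Finite-order approximations of the coinductive predicate, so that closure properties can be
  proved by induction on the order.\<close>

primrec Cdiff :: "nat \<Rightarrow> ('a::real_normed_vector \<Rightarrow> 'b::real_normed_vector) \<Rightarrow> bool" where
  "Cdiff 0 f \<longleftrightarrow> True"
| "Cdiff (Suc n) f \<longleftrightarrow> (\<exists>D. (\<forall>x. (f has_derivative D x) (at x)) \<and> (\<forall>v. Cdiff n (\<lambda>x. D x v)))"

lemma Cdiff_SucI:
  assumes "\<And>x. (f has_derivative D x) (at x)" "\<And>v. Cdiff n (\<lambda>x. D x v)"
  shows "Cdiff (Suc n) f"
  using assms by auto

lemma smooth_fun_if_Cdiff:
  assumes "\<And>n. Cdiff n f"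
  shows "smooth_fun f"
proof -
  have "\<forall>n. Cdiff n f" using assms by blast
  then show ?thesis
  proof (coinduction arbitrary: f)
    case (smooth_fun f)
    obtain D where D: "\<forall>x. (f has_derivative D x) (at x)"
      using smooth_fun[rule_format, of "Suc 0"] by auto
    have "Cdiff n (\<lambda>x. D x v)" for n v
    proof -
      obtain D' where D': "\<forall>x. (f has_derivative D' x) (at x)" "\<forall>v. Cdiff n (\<lambda>x. D' x v)"
        using smooth_fun[rule_format, of "Suc n"] by auto
      \<comment> \<open>Each order supplies its own derivative; uniqueness identifies them, so that
        the single witness \<open>D\<close> serves all orders, as the coinduction requires.\<close>
      have "D' x = D x" for x
        using D D'(1) has_derivative_unique by blast
      then show ?thesis using D'(2) by simp
    qed
    then show ?case using D by blast
  qed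
qed

lemma smooth_fun_derivative:
  "smooth_fun f \<Longrightarrow> \<exists>D. (\<forall>x. (f has_derivative D x) (at x)) \<and> (\<forall>v. smooth_fun (\<lambda>x. D x v))"
  by (cases rule: smooth_fun.cases) auto

lemma smooth_fun_Cdiff: "smooth_fun f \<Longrightarrow> Cdiff n f"
proof (induction n arbitrary: f)
  case (Suc n)
  obtain D where "\<And>x. (f has_derivative D x) (at x)" "\<And>v. smooth_fun (\<lambda>x. D x v)"
    using smooth_fun_derivative[OF Suc.prems] by auto
  then show ?case by (intro Cdiff_SucI Suc.IH)
qed simp

lemma Cdiff_Suc: "Cdiff (Suc n) f \<Longrightarrow> Cdiff n f"
proof (induction n arbitrary: f)
  case (Suc n)
  then obtain D where D: "\<And>x. (f has_derivative D x) (at x)" "\<And>v. Cdiff (Suc n) (\<lambda>x. D x v)"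
    by (auto simp del: Cdiff.simps simp: Cdiff.simps(2)[of "Suc n"])
  show ?case by (rule Cdiff_SucI[OF D(1)]) (rule Suc.IH[OF D(2)])
qed simp

lemma Cdiff_const: "Cdiff n (\<lambda>x. c)"
proof (induction n arbitrary: c)
  case (Suc n)
  show ?case by (rule Cdiff_SucI[where D="\<lambda>x v. 0"]) (auto intro: Suc.IH)
qed simp

lemma Cdiff_linear: "bounded_linear f \<Longrightarrow> Cdiff n f"
  by (cases n) (auto intro!: exI[of _ "\<lambda>_. f"] bounded_linear.has_derivative[OF _ has_derivative_ident]
    Cdiff_const)

lemma Cdiff_add: "Cdiff n f \<Longrightarrow> Cdiff n g \<Longrightarrow> Cdiff n (\<lambda>x. f x + g x)"
proof (induction n arbitrary: f g)
  case (Suc n)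
  obtain D where D: "\<And>x. (f has_derivative D x) (at x)" "\<And>v. Cdiff n (\<lambda>x. D x v)"
    using Suc.prems(1) by auto
  obtain E where E: "\<And>x. (g has_derivative E x) (at x)" "\<And>v. Cdiff n (\<lambda>x. E x v)"
    using Suc.prems(2) by auto
  show ?case
    by (rule Cdiff_SucI[where D="\<lambda>x v. D x v + E x v"])
       (auto intro: has_derivative_add D E Suc.IH)
qed simp

lemma Cdiff_mult:
  fixes f g :: "'a::real_normed_vector \<Rightarrow> real"
  shows "Cdiff n f \<Longrightarrow> Cdiff n g \<Longrightarrow> Cdiff n (\<lambda>x. f x * g x)"
proof (induction n arbitrary: f g)
  case (Suc n)
  obtain D where D: "\<And>x. (f has_derivative D x) (at x)" "\<And>v. Cdiff n (\<lambda>x. D x v)"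
    using Suc.prems(1) by auto
  obtain E where E: "\<And>x. (g has_derivative E x) (at x)" "\<And>v. Cdiff n (\<lambda>x. E x v)"
    using Suc.prems(2) by auto
  show ?case
    by (rule Cdiff_SucI[where D="\<lambda>x v. f x * E x v + D x v * g x"])
       (auto intro!: has_derivative_mult D E Suc.IH Cdiff_add Cdiff_Suc[OF Suc.prems(1)]
          Cdiff_Suc[OF Suc.prems(2)])
qed simp

text \<open>The classical flat function e^(-1/t) is \<open>flat_exp 1\<close>. Polynomial factors in
  1/t make the family stable under differentiation, so one computation of a first derivative serves
  all orders.\<close>

definition flat_exp :: "real poly \<Rightarrow> real \<Rightarrow> real" where
  "flat_exp P t = (if t > 0 then poly P (1/t) * exp (-(1/t)) else 0)"

text \<open>The polynomial comes from differentiating \<open>P(1/t) exp(-1/t)\<close>.\<close>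

definition flat_exp_step :: "real poly \<Rightarrow> real poly" where
  "flat_exp_step P = monom 1 2 * (P - pderiv P)"

lemma poly_exp_decay: "((\<lambda>s. poly P s * exp (-s)) \<longlongrightarrow> 0) at_top" for P :: "real poly"
proof -
  have "((\<lambda>s::real. \<Sum>i\<le>degree P. coeff P i * (s ^ i / exp s)) \<longlongrightarrow> (\<Sum>i\<le>degree P. coeff P i * 0)) at_top"
    by (intro tendsto_sum tendsto_mult tendsto_const tendsto_power_div_exp_0)
  moreover have "(\<lambda>s::real. \<Sum>i\<le>degree P. coeff P i * (s ^ i / exp s)) = (\<lambda>s. poly P s * exp (-s))"
    by (auto simp: poly_altdef sum_divide_distrib exp_minus field_simps)
  ultimately show ?thesis by simp
qed

lemma flat_exp_deriv: "(flat_exp P has_real_derivative flat_exp (flat_exp_step P) t) (at t)"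
proof -
  consider "t > 0" | "t < 0" | "t = 0" by linarith
  then show ?thesis
  proof cases
    case 1
    have "((\<lambda>t. poly P (1/t) * exp (-(1/t))) has_real_derivative flat_exp (flat_exp_step P) t) (at t)"
      using 1
      by (auto intro!: derivative_eq_intros DERIV_chain2[OF poly_DERIV] simp: flat_exp_def flat_exp_step_def poly_monom
          field_simps power2_eq_square)
    then show ?thesis
      by (rule has_field_derivative_transform_within_open[where S="{0<..}"]) (use 1 in \<open>auto simp: flat_exp_def\<close>)
  next
    case 2
    have "((\<lambda>t. 0) has_real_derivative flat_exp (flat_exp_step P) t) (at t)"
      using 2 by (auto simp: flat_exp_def)
    then show ?thesis
      by (rule has_field_derivative_transform_within_open[where S="{..<0}"]) (use 2 in \<open>auto simp: flat_exp_def\<close>)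
  next
    case 3
    \<comment> \<open>With s = 1/y the difference quotient at the origin is s P(s) e^(-s), which
      explains the extra factor \<open>monom 1 1\<close>.\<close>
    have R: "((\<lambda>y. flat_exp P y / y) \<longlongrightarrow> 0) (at_right 0)"
    proof -
      have "((\<lambda>s. poly (monom 1 1 * P) s * exp (-s)) \<longlongrightarrow> 0) at_top" by (rule poly_exp_decay)
      then have "((\<lambda>y. poly (monom 1 1 * P) (inverse y) * exp (-(inverse y))) \<longlongrightarrow> 0) (at_right 0)"
        by (rule filterlim_compose[OF _ filterlim_inverse_at_top_right])
      then show ?thesis
        by (rule Lim_transform_eventually)
          (auto simp: eventually_at_filter flat_exp_def poly_monom field_simps)
    qed
    have L: "((\<lambda>y. flat_exp P y / y) \<longlongrightarrow> 0) (at_left 0)"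
      by (rule Lim_transform_eventually[OF tendsto_const]) (auto simp: eventually_at_filter flat_exp_def)
    have "((\<lambda>y. flat_exp P y / y) \<longlongrightarrow> 0) (at 0)"
      using L R by (simp add: filterlim_split_at)
    moreover have "flat_exp P 0 = 0" "flat_exp (flat_exp_step P) 0 = 0" by (simp_all add: flat_exp_def)
    ultimately show ?thesis using 3 by (simp add: has_field_derivative_iff)
  qed
qed

text \<open>The induction varies \<open>P\<close>: each directional derivative is again a flat
  function of c - |x|^2, multiplied by a linear function of x.\<close>

lemma Cdiff_flat_exp_radial:
  "Cdiff n (\<lambda>x::'a::real_inner. flat_exp P (c - x \<bullet> x))"
proof (induction n arbitrary: P)
  case (Suc n)
  have "((\<lambda>x. flat_exp P (c - x \<bullet> x)) has_derivative
     (\<lambda>v. flat_exp (flat_exp_step P) (c - x \<bullet> x) * (-2 * (x \<bullet> v)))) (at x)" for x :: 'a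
  proof -
    have "((\<lambda>x. c - x \<bullet> x) has_derivative (\<lambda>v. -2 * (x \<bullet> v))) (at x)"
      by (auto intro!: derivative_eq_intros simp: inner_commute)
    from has_derivative_compose[OF this, of "flat_exp P", OF flat_exp_deriv[unfolded has_field_derivative_def]]
    show ?thesis by simp
  qed
  then show ?case
    by (rule Cdiff_SucI) (intro Cdiff_mult Suc.IH Cdiff_const Cdiff_linear bounded_linear_inner_left)
qed simp

text \<open>Evenness makes the derivative odd, which later turns the gradient of a convolution into
  a pairing with translates of the mollifier itself.\<close>

definition mollifier :: "real \<Rightarrow> ('a::euclidean_space \<Rightarrow> real) \<Rightarrow> bool" where
  "mollifier \<epsilon> \<rho> \<longleftrightarrow> smooth_fun \<rho> \<and> (\<forall>x. 0 \<le> \<rho> x) \<and> (\<forall>x. \<epsilon> < norm x \<longrightarrow> \<rho> x = 0) \<and>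
     integrable lborel \<rho> \<and> (LINT x|lborel. \<rho> x) = 1 \<and> (\<forall>x. \<rho> (- x) = \<rho> x)"

lemma integrable_continuous_compact_support:
  fixes f :: "'a::euclidean_space \<Rightarrow> 'b::euclidean_space"
  assumes "continuous_on UNIV f" "\<And>x. R < norm x \<Longrightarrow> f x = 0"
  shows "integrable lborel f"
proof -
  have "integrable lborel (\<lambda>x. indicator (cball 0 R) x *\<^sub>R f x)"
    by (rule borel_integrable_compact) (use assms(1) continuous_on_subset in auto)
  moreover have "(\<lambda>x. indicator (cball 0 R) x *\<^sub>R f x) = f"
    using assms(2) by (auto simp: indicator_def fun_eq_iff not_le)
  ultimately show ?thesis by simp
qed

lemma continuous_if_has_derivative:
  assumes "\<And>x. (f has_derivative D x) (at x)"
  shows "continuous_on UNIV f"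
  using assms has_derivative_continuous continuous_at_imp_continuous_on by blast

lemma smooth_fun_continuous: "smooth_fun f \<Longrightarrow> continuous_on UNIV f"
  using smooth_fun_derivative continuous_if_has_derivative by blast

lemma mollifier_exists:
  assumes "0 < \<epsilon>"
  obtains \<rho> :: "'a::euclidean_space \<Rightarrow> real" where "mollifier \<epsilon> \<rho>"
proof -
  define b where "b = (\<lambda>x::'a. flat_exp 1 (\<epsilon>\<^sup>2 - x \<bullet> x))"
  have sm: "smooth_fun b"
    unfolding b_def by (rule smooth_fun_if_Cdiff) (rule Cdiff_flat_exp_radial)
  have supp: "b x = 0" if "\<epsilon> < norm x" for x
    using that assms
    by (auto simp: b_def flat_exp_def dot_square_norm not_less less_imp_le intro!: power_mono)
  have nn: "0 \<le> b x" for x by (simp add: b_def flat_exp_def)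
  have cont: "continuous_on UNIV b" using sm by (rule smooth_fun_continuous)
  have int: "integrable lborel b"
    by (rule integrable_continuous_compact_support[OF cont supp])
  have pos: "0 < (LINT x|lborel. b x)"
  proof -
    have "(LINT x|lborel. b x) \<noteq> 0"
    proof
      assume "(LINT x|lborel. b x) = 0"
      then have "AE x in lborel. b x = 0"
        using integral_nonneg_eq_0_iff_AE[OF int] nn by auto
      then have "emeasure lborel {x. b x \<noteq> 0} = 0"
        using cont by (subst (asm) AE_iff_measurable[where N="{x. b x \<noteq> 0}"])
          (auto intro!: borel_open open_Collect_neq continuous_on_const)
      moreover have "ball 0 \<epsilon> \<subseteq> {x. b x \<noteq> 0}"
      proof
        fix x :: 'a assume "x \<in> ball 0 \<epsilon>"
        then have "(norm x)\<^sup>2 < \<epsilon>\<^sup>2" by (simp add: power_strict_mono)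
        then show "x \<in> {x. b x \<noteq> 0}"
          by (auto simp: b_def flat_exp_def dot_square_norm)
      qed
      ultimately have "emeasure lborel (ball (0::'a) \<epsilon>) = 0"
        using cont emeasure_mono[of "ball 0 \<epsilon>" "{x. b x \<noteq> 0}" lborel]
        by (auto simp: open_Collect_neq continuous_on_const)
      then show False using assms
        using unit_ball_vol_pos[of "real DIM('a)"] by (auto simp: emeasure_ball)
    qed
    then show ?thesis using nn by (metis Bochner_Integration.integral_nonneg less_eq_real_def)
  qed
  define I where "I = (LINT x|lborel. b x)"
  have "smooth_fun (\<lambda>x. inverse I * b x)"
    by (rule smooth_fun_if_Cdiff) (intro Cdiff_mult Cdiff_const smooth_fun_Cdiff[OF sm])
  moreover have "(LINT x|lborel. inverse I * b x) = 1" using pos by (simp add: I_def)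
  moreover have "b (-x) = b x" for x by (simp add: b_def)
  ultimately have "mollifier \<epsilon> (\<lambda>x. inverse I * b x)"
    using nn pos supp int by (auto simp: mollifier_def I_def)
  then show ?thesis using that by blast
qed

section \<open>Lebesgue integral: translations and integration by parts\<close>

lemma lborel_distr_reflect: "distr lborel borel (\<lambda>y. x - y) = (lborel :: 'a::euclidean_space measure)"
  by (subst (2) lborel_affine[of "-1" x]) (auto simp: density_1 one_ennreal_def[symmetric])

lemma lborel_distr_translate: "distr lborel borel (\<lambda>y. x + y) = (lborel :: 'a::euclidean_space measure)"
  by (subst (2) lborel_affine[of "1" x]) (auto simp: density_1 one_ennreal_def[symmetric])

lemma lborel_integrable_reflect:
  fixes f :: "'a::euclidean_space \<Rightarrow> 'b::{banach,second_countable_topology}"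
  shows "integrable lborel (\<lambda>y. f (x - y)) \<longleftrightarrow> integrable lborel f"
proof
  assume "integrable lborel f"
  then show "integrable lborel (\<lambda>y. f (x - y))"
    using integrable_distr[of "\<lambda>y. x - y" lborel borel f] by (simp add: lborel_distr_reflect)
next
  assume "integrable lborel (\<lambda>y. f (x - y))"
  then show "integrable lborel f"
    using integrable_distr[of "\<lambda>y. x - y" lborel borel "\<lambda>y. f (x - y)"] by (simp add: lborel_distr_reflect)
qed

lemma lborel_integral_reflect:
  fixes f :: "'a::euclidean_space \<Rightarrow> 'b::{banach,second_countable_topology}"
  shows "(LINT y|lborel. f (x - y)) = (LINT y|lborel. f y)"
proof (cases "f \<in> borel_measurable borel")
  case True
  then show ?thesis
    using integral_distr[of "\<lambda>y. x - y" lborel borel f] by (simp add: lborel_distr_reflect)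
next
  \<comment> \<open>For a non-measurable \<open>f\<close> both integrals have the default value 0:
    reflection is an involution, so measurability of the reflected function would pass back to
    \<open>f\<close>.\<close>
  case False
  have "(\<lambda>y. f (x - y)) \<notin> borel_measurable borel"
  proof
    assume "(\<lambda>y. f (x - y)) \<in> borel_measurable borel"
    then have "(\<lambda>y. f (x - (x - y))) \<in> borel_measurable borel"
      by (rule measurable_compose[rotated]) simp
    with False show False by simp
  qed
  then have "\<not> integrable lborel (\<lambda>y. f (x - y))" "\<not> integrable lborel f"
    using False borel_measurable_integrable by fastforce+
  then show ?thesis by (simp add: not_integrable_integral_eq)
qed

lemma lborel_integrable_translate:
  fixes f :: "'a::euclidean_space \<Rightarrow> 'b::{banach,second_countable_topology}"
  shows "integrable lborel f \<Longrightarrow> integrable lborel (\<lambda>y. f (x + y))"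
  using integrable_distr[of "\<lambda>y. x + y" lborel borel f] by (simp add: lborel_distr_translate)

lemma lborel_integral_translate:
  fixes f :: "'a::euclidean_space \<Rightarrow> 'b::{banach,second_countable_topology}"
  shows "f \<in> borel_measurable borel \<Longrightarrow> (LINT y|lborel. f (x + y)) = (LINT y|lborel. f y)"
  using integral_distr[of "\<lambda>y. x + y" lborel borel f] by (simp add: lborel_distr_translate)

lemma lborel_nn_integral_translate:
  fixes f :: "'a::euclidean_space \<Rightarrow> ennreal"
  shows "f \<in> borel_measurable borel \<Longrightarrow> (\<integral>\<^sup>+y. f (x + y) \<partial>lborel) = (\<integral>\<^sup>+y. f y \<partial>lborel)"
  using nn_integral_distr[of "\<lambda>y. x + y" lborel borel f] by (simp add: lborel_distr_translate)

section \<open>Derivatives of functions with compact support\<close>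

lemma deriv_zero_outside_support:
  fixes f :: "'a::real_normed_vector \<Rightarrow> 'b::real_normed_vector"
  assumes "(f has_derivative D) (at x)" "\<And>y. y \<notin> S \<Longrightarrow> f y = 0" "closed S" "x \<notin> S"
  shows "D v = 0"
proof -
  have "((\<lambda>y. 0) has_derivative D) (at x)"
    by (rule has_derivative_transform_within_open[OF assms(1), of "- S"]) (use assms in auto)
  then have "D = (\<lambda>h. 0)" using has_derivative_unique has_derivative_const by blast
  then show ?thesis by simp
qed

lemma continuous_compact_support_bounded:
  fixes f :: "'a::euclidean_space \<Rightarrow> 'b::real_normed_vector"
  assumes "continuous_on UNIV f" "\<And>x. R < norm x \<Longrightarrow> f x = 0"
  obtains B where "0 < B" "\<And>x. norm (f x) \<le> B"
proof -
  have "compact (f ` cball 0 R)"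
    by (rule compact_continuous_image) (use assms(1) continuous_on_subset in auto)
  then obtain B where B: "0 < B" "\<And>y. y \<in> f ` cball 0 R \<Longrightarrow> norm y \<le> B"
    using compact_imp_bounded bounded_pos by metis
  have "norm (f x) \<le> B" for x
    using B assms(2)[of x] by (cases "R < norm x") auto
  then show ?thesis using B(1) that by blast
qed

text \<open>Translation invariance makes the integral of every difference quotient vanish.\<close>

lemma integral_directional_derivative_zero:
  fixes F :: "'a::euclidean_space \<Rightarrow> real"
  assumes D: "\<And>x. (F has_derivative D x) (at x)" and supp: "\<And>x. R < norm x \<Longrightarrow> F x = 0"
    and cont: "continuous_on UNIV (\<lambda>x. D x v)"
  shows "(LINT x|lborel. D x v) = 0"
proof -
  have Dsupp: "D x v = 0" if "R < norm x" for x
    by (rule deriv_zero_outside_support[OF D, of "cball 0 R"]) (use supp that in auto)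
  obtain B where B: "0 < B" "\<And>x. norm (D x v) \<le> B"
    using continuous_compact_support_bounded[OF cont Dsupp] by blast
  have Fc: "continuous_on UNIV F" using D by (rule continuous_if_has_derivative)
  have Fi: "integrable lborel F" by (rule integrable_continuous_compact_support[OF Fc supp])
  have [measurable]: "F \<in> borel_measurable borel" using Fc by (rule borel_measurable_continuous_onI)
  have [measurable]: "(\<lambda>x. D x v) \<in> borel_measurable borel" using cont by (rule borel_measurable_continuous_onI)
  define t where "t k = 1 / real (Suc k)" for k
  have t0: "t \<longlonglongrightarrow> 0" unfolding t_def using LIMSEQ_inverse_real_of_nat by (simp add: inverse_eq_divide)
  have tpos: "0 < t k" "t k \<le> 1" for k by (auto simp: t_def)
  have line: "((\<lambda>s. F (x + s *\<^sub>R v)) has_real_derivative D (x + s *\<^sub>R v) v) (at s)" for x s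
  proof -
    have "((\<lambda>s. x + s *\<^sub>R v) has_derivative (\<lambda>h. h *\<^sub>R v)) (at s)"
      by (auto intro!: derivative_eq_intros)
    from has_derivative_compose[OF this D]
    have "((\<lambda>s. F (x + s *\<^sub>R v)) has_derivative (\<lambda>h. D (x + s *\<^sub>R v) (h *\<^sub>R v))) (at s)" .
    moreover have "D (x + s *\<^sub>R v) (h *\<^sub>R v) = D (x + s *\<^sub>R v) v * h" for h
      using linear_simps(5)[OF has_derivative_bounded_linear[OF D]] by simp
    ultimately show ?thesis by (simp add: has_field_derivative_def)
  qed
  define q where "q k x = (F (x + t k *\<^sub>R v) - F x) / t k" for k x
  have qb: "norm (q k x) \<le> B" for k x
  proof -
    have "norm (F (x + t k *\<^sub>R v) - F (x + 0 *\<^sub>R v)) \<le> B * norm (t k - 0)"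
      by (rule field_differentiable_bound[where S=UNIV]) (use line B in auto)
    then show ?thesis using tpos[of k] by (simp add: q_def divide_simps)
  qed
  \<comment> \<open>\<open>t k \<le> 1\<close> keeps all difference quotients supported in one fixed
    ball; with the mean value bound \<open>B\<close> this gives an integrable majorant.\<close>
  have qs: "q k x = 0" if "R + norm v < norm x" for k x
  proof -
    have "norm (t k *\<^sub>R v) \<le> norm v" using tpos[of k] by (simp add: mult_left_le_one_le)
    then have "R < norm (x + t k *\<^sub>R v)" using that norm_triangle_ineq4[of "x + t k *\<^sub>R v" "t k *\<^sub>R v"] by simp
    moreover have "R < norm x" using that norm_ge_zero[of v] by linarith
    ultimately show ?thesis by (simp add: q_def supp)
  qed
  have "(\<lambda>k. LINT x|lborel. q k x) \<longlonglongrightarrow> (LINT x|lborel. D x v)"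
  proof (rule integral_dominated_convergence[where w="\<lambda>x. B * indicator (cball 0 (R + norm v)) x"])
    show "integrable lborel (\<lambda>x. B * indicator (cball 0 (R + norm v)) (x::'a))"
      by (intro integrable_mult_right integrable_real_indicator) (use emeasure_lborel_cball_finite in auto)
    show "AE x in lborel. norm (q k x) \<le> B * indicator (cball 0 (R + norm v)) x" for k
      using qb qs by (intro always_eventually) (auto simp: indicator_def not_le)
    show "AE x in lborel. (\<lambda>k. q k x) \<longlonglongrightarrow> D x v"
    proof (intro always_eventually allI)
      fix x
      have "((\<lambda>h. (F (x + h *\<^sub>R v) - F x) / h) \<longlongrightarrow> D x v) (at 0)"
        using line[of x 0] by (simp add: has_field_derivative_iff)
      moreover have "filterlim t (at 0) sequentially"
        using t0 tpos(1) by (simp add: filterlim_at less_imp_neq[symmetric])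
      ultimately show "(\<lambda>k. q k x) \<longlonglongrightarrow> D x v" unfolding q_def
        by (rule filterlim_compose)
    qed
  qed (auto simp: q_def)
  moreover have "(LINT x|lborel. q k x) = 0" for k
  proof -
    have tr: "(LINT x|lborel. F (x + t k *\<^sub>R v)) = (LINT x|lborel. F x)"
      using lborel_integral_translate[of F "t k *\<^sub>R v"] by (simp add: add.commute)
    have ti: "integrable lborel (\<lambda>x. F (x + t k *\<^sub>R v))"
      using lborel_integrable_translate[OF Fi, of "t k *\<^sub>R v"] by (simp add: add.commute)
    show ?thesis unfolding q_def using Fi ti tr by simp
  qed
  ultimately show ?thesis by (simp add: LIMSEQ_const_iff)
qed

section \<open>Lipschitz bounds for smooth functions of compact support\<close>

lemma linear_bound_Basis:
  fixes D :: "'a::euclidean_space \<Rightarrow> 'b::real_normed_vector"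
  assumes "linear D" "\<And>b. b \<in> Basis \<Longrightarrow> norm (D b) \<le> B"
  shows "norm (D v) \<le> real DIM('a) * B * norm v"
proof -
  have "D v = (\<Sum>b\<in>Basis. (v \<bullet> b) *\<^sub>R D b)"
    using linear_sum[OF assms(1), of "\<lambda>b. (v \<bullet> b) *\<^sub>R b" Basis] linear_scale[OF assms(1)]
    by (simp add: euclidean_representation)
  also have "norm \<dots> \<le> (\<Sum>b\<in>(Basis::'a set). norm v * B)"
    by (rule sum_norm_le) (use assms(2) in \<open>auto intro!: mult_mono Basis_le_norm\<close>)
  finally show ?thesis by (simp add: mult_ac)
qed

text \<open>Smoothness speaks of one direction at a time, so compactness bounds \<open>D x b\<close>
  for each basis vector and linearity assembles the operator bound.\<close>

lemma smooth_compact_support_derivative_bound: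
  fixes f :: "'a::euclidean_space \<Rightarrow> 'b::real_normed_vector"
  assumes "smooth_fun f" "\<And>x. R < norm x \<Longrightarrow> f x = 0" "\<And>x. (f has_derivative D x) (at x)"
  obtains B where "0 < B" "\<And>x v. norm (D x v) \<le> B * norm v"
proof -
  obtain D' where D': "\<And>x. (f has_derivative D' x) (at x)" "\<And>v. smooth_fun (\<lambda>x. D' x v)"
    using smooth_fun_derivative[OF assms(1)] by auto
  have eq: "D' = D" using D'(1) assms(3) has_derivative_unique by blast
  have "\<exists>B>0. \<forall>x. norm (D x b) \<le> B" for b
  proof -
    have "D x b = 0" if "R < norm x" for x
      by (rule deriv_zero_outside_support[OF assms(3), of "cball 0 R"]) (use assms that in auto)
    then obtain B where "0 < B" "\<And>x. norm (D x b) \<le> B"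
      using continuous_compact_support_bounded[OF smooth_fun_continuous[OF D'(2)[of b, unfolded eq]], of R] by blast
    then show ?thesis by blast
  qed
  then obtain B where B: "\<And>b x. norm (D x b) \<le> B b" "\<And>b. 0 < B b" by metis
  have "norm (D x v) \<le> real DIM('a) * (\<Sum>b\<in>Basis. B b) * norm v" for x v
  proof (rule linear_bound_Basis)
    show "linear (D x)" using assms(3) has_derivative_bounded_linear bounded_linear.linear by blast
    fix b :: 'a assume "b \<in> Basis"
    then have "B b \<le> (\<Sum>b\<in>Basis. B b)" using B(2) by (intro member_le_sum) (auto simp: less_imp_le)
    with B(1) show "norm (D x b) \<le> (\<Sum>b\<in>Basis. B b)" by (rule order_trans)
  qed
  moreover have "0 < real DIM('a) * (\<Sum>b\<in>(Basis::'a set). B b)"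
    using B(2) by (intro mult_pos_pos sum_pos) auto
  ultimately show ?thesis using that by blast
qed

lemma smooth_compact_support_lipschitz:
  fixes f :: "'a::euclidean_space \<Rightarrow> 'b::real_normed_vector"
  assumes "smooth_fun f" "\<And>x. R < norm x \<Longrightarrow> f x = 0"
  obtains L where "0 < L" "\<And>x y. norm (f x - f y) \<le> L * norm (x - y)"
proof -
  obtain D where D: "\<And>x. (f has_derivative D x) (at x)" "\<And>v. smooth_fun (\<lambda>x. D x v)"
    using smooth_fun_derivative[OF assms(1)] by auto
  obtain L where L: "0 < L" "\<And>x v. norm (D x v) \<le> L * norm v"
    using smooth_compact_support_derivative_bound[OF assms D(1)] by blast
  have "norm (f x - f y) \<le> L * norm (x - y)" for x y
    by (rule differentiable_bound[where S=UNIV and f'=D]) (use D L in \<open>auto intro!: onorm_le\<close>)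
  then show ?thesis using L that by blast
qed

text \<open>Each \<open>D x b\<close> is itself smooth with compact support, hence Lipschitz in
  \<open>x\<close>. The resulting quadratic remainder is uniform in \<open>x\<close>, so the
  derivative of a convolution can be read off from the definition, without a limit under the
  integral.\<close>

lemma smooth_compact_support_remainder:
  fixes f :: "'a::euclidean_space \<Rightarrow> 'b::real_normed_vector"
  assumes f: "smooth_fun f" and supp: "\<And>x. R < norm x \<Longrightarrow> f x = 0" and D: "\<And>x. (f has_derivative D x) (at x)"
  obtains C where "0 < C" "\<And>x h. norm (f (x + h) - f x - D x h) \<le> C * norm h * norm h"
proof -
  obtain D' where D': "\<And>x. (f has_derivative D' x) (at x)" "\<And>v. smooth_fun (\<lambda>x. D' x v)"
    using smooth_fun_derivative[OF f] by auto
  have eq: "D' = D" using D'(1) D has_derivative_unique by blast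
  have "\<exists>L>0. \<forall>x y. norm (D x b - D y b) \<le> L * norm (x - y)" for b
  proof -
    have "D x b = 0" if "R < norm x" for x
      by (rule deriv_zero_outside_support[OF D, of "cball 0 R"]) (use supp that in auto)
    then obtain L where "0 < L" "\<And>x y. norm (D x b - D y b) \<le> L * norm (x - y)"
      using smooth_compact_support_lipschitz[OF D'(2)[of b, unfolded eq], of R] by blast
    then show ?thesis by blast
  qed
  then obtain L where L: "\<And>b x y. norm (D x b - D y b) \<le> L b * norm (x - y)" "\<And>b. 0 < L b" by metis
  define C where "C = real DIM('a) * (\<Sum>b\<in>(Basis::'a set). L b)"
  have C: "norm (D x v - D y v) \<le> C * norm (x - y) * norm v" for x y v
  proof -
    have "norm (D x v - D y v) \<le> real DIM('a) * ((\<Sum>b\<in>Basis. L b) * norm (x - y)) * norm v"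
    proof (rule linear_bound_Basis[where D="\<lambda>v. D x v - D y v"])
      show "linear (\<lambda>v. D x v - D y v)"
        using D has_derivative_bounded_linear bounded_linear.linear by (intro linear_compose_sub) blast+
      fix b :: 'a assume "b \<in> Basis"
      then have "L b \<le> (\<Sum>b\<in>Basis. L b)" using L(2) by (intro member_le_sum) (auto simp: less_imp_le)
      then show "norm (D x b - D y b) \<le> (\<Sum>b\<in>Basis. L b) * norm (x - y)"
        using L(1)[of x b y] by (meson mult_right_mono norm_ge_zero order_trans)
    qed
    then show ?thesis by (simp add: C_def mult.assoc)
  qed
  have "norm (f (x + h) - f x - D x h) \<le> C * norm h * norm h" for x h
  proof -
    have lin: "linear (D x)" using D has_derivative_bounded_linear bounded_linear.linear by blast
    \<comment> \<open>The mean value inequality is applied to \<open>f - D x\<close>, whose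
      derivative at a point \<open>y\<close> of the segment is \<open>D y - D x\<close>, of norm at
      most \<open>C * norm h\<close>.\<close>
    have "norm ((f (x + h) - D x (x + h)) - (f x - D x x)) \<le> (C * norm h) * norm (x + h - x)"
    proof (rule differentiable_bound[where S="closed_segment x (x+h)" and f'="\<lambda>y v. D y v - D x v"])
      fix y assume y: "y \<in> closed_segment x (x+h)"
      show "((\<lambda>y. f y - D x y) has_derivative (\<lambda>v. D y v - D x v)) (at y within closed_segment x (x+h))"
        by (intro has_derivative_diff has_derivative_at_withinI[OF D]
            bounded_linear_imp_has_derivative has_derivative_bounded_linear[OF D])
      have "norm (y - x) \<le> norm h"
        using y segment_bound1[of y x "x+h"] by simp
      moreover have "0 \<le> C" unfolding C_def using L(2) by (auto intro!: mult_nonneg_nonneg sum_nonneg simp: less_imp_le)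
      ultimately show "onorm (\<lambda>v. D y v - D x v) \<le> C * norm h"
        by (intro onorm_le order_trans[OF C]) (auto intro!: mult_right_mono mult_left_mono)
    qed auto
    moreover have "D x (x + h) = D x x + D x h" using lin linear_add by blast
    ultimately show ?thesis by (simp add: algebra_simps)
  qed
  moreover have "0 < C" unfolding C_def
    using L(2) by (intro mult_pos_pos sum_pos) auto
  ultimately show ?thesis using that by blast
qed

section \<open>Convolution\<close>

definition conv :: "('a::euclidean_space \<Rightarrow> real) \<Rightarrow> ('a \<Rightarrow> 'b::euclidean_space) \<Rightarrow> 'a \<Rightarrow> 'b" where
  "conv \<rho> g x = (LINT y|lborel. \<rho> (x - y) *\<^sub>R g y)"

lemma conv_reflect: "conv \<rho> g x = (LINT z|lborel. \<rho> z *\<^sub>R g (x - z))"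
  unfolding conv_def using lborel_integral_reflect[of "\<lambda>z. \<rho> z *\<^sub>R g (x - z)" x] by simp

lemma integrable_bounded_scaleR:
  fixes g :: "'a \<Rightarrow> 'b::{banach,second_countable_topology}" and h :: "'a \<Rightarrow> real"
  assumes "integrable M g" "h \<in> borel_measurable M" "\<And>x. \<bar>h x\<bar> \<le> B"
  shows "integrable M (\<lambda>x. h x *\<^sub>R g x)"
proof (rule Bochner_Integration.integrable_bound[where f="\<lambda>x. B *\<^sub>R g x"])
  show "AE x in M. norm (h x *\<^sub>R g x) \<le> norm (B *\<^sub>R g x)"
    using assms(3) by (intro always_eventually) (auto intro!: mult_right_mono order_trans[OF _ abs_ge_self])
qed (use assms in auto)

lemma conv_integrable:
  fixes g :: "'a::euclidean_space \<Rightarrow> 'b::euclidean_space"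
  assumes "continuous_on UNIV \<rho>" "\<And>x. R < norm x \<Longrightarrow> \<rho> x = (0::real)" "integrable lborel g"
  shows "integrable lborel (\<lambda>y. \<rho> (x - y) *\<^sub>R g y)"
proof -
  obtain B where B: "\<And>x. norm (\<rho> x) \<le> B"
    using continuous_compact_support_bounded[OF assms(1,2)] by blast
  have [measurable]: "\<rho> \<in> borel_measurable borel" using assms(1) by (rule borel_measurable_continuous_onI)
  show ?thesis using B by (intro integrable_bounded_scaleR[OF assms(3), where B=B]) auto
qed

text \<open>Differentiation falls on the smooth factor. The uniform quadratic remainder of
  \<open>\<rho>\<close> bounds the remainder of the convolution by
  \<open>C * G * norm h * norm h\<close>, where \<open>G\<close> is the L1 norm of
  \<open>g\<close>.\<close>

lemma conv_has_derivative:
  fixes g :: "'a::euclidean_space \<Rightarrow> 'b::euclidean_space"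
  assumes \<rho>: "smooth_fun \<rho>" and supp: "\<And>x. R < norm x \<Longrightarrow> \<rho> x = (0::real)"
    and D: "\<And>x. (\<rho> has_derivative D x) (at x)" and g: "integrable lborel g"
  shows "(conv \<rho> g has_derivative (\<lambda>v. conv (\<lambda>z. D z v) g x)) (at x)"
proof -
  obtain D' where D': "\<And>x. (\<rho> has_derivative D' x) (at x)" "\<And>v. smooth_fun (\<lambda>x. D' x v)"
    using smooth_fun_derivative[OF \<rho>] by auto
  have eq: "D' = D" using D'(1) D has_derivative_unique by blast
  have Dsupp: "D x v = 0" if "R < norm x" for x v
    by (rule deriv_zero_outside_support[OF D, of "cball 0 R"]) (use supp that in auto)
  have Dcont: "continuous_on UNIV (\<lambda>x. D x v)" for v
    using D'(2) smooth_fun_continuous unfolding eq by blast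
  note iD = conv_integrable[where R=R, OF Dcont Dsupp g]
  note i\<rho> = conv_integrable[where R=R, OF smooth_fun_continuous[OF \<rho>] supp g]
  have lin: "linear (D z)" for z using D has_derivative_bounded_linear bounded_linear.linear by blast
  obtain C where C: "0 < C" "\<And>x h. norm (\<rho> (x + h) - \<rho> x - D x h) \<le> C * norm h * norm h"
    using smooth_compact_support_remainder[OF \<rho> supp D] by blast
  obtain B where B: "0 < B" "\<And>x v. norm (D x v) \<le> B * norm v"
    using smooth_compact_support_derivative_bound[OF \<rho> supp D] by blast
  define G where "G = (LINT y|lborel. norm (g y))"
  have bl: "bounded_linear (\<lambda>v. conv (\<lambda>z. D z v) g x)"
  proof (rule bounded_linear_intro[where K="B * G"])
    fix v w show "conv (\<lambda>z. D z (v + w)) g x = conv (\<lambda>z. D z v) g x + conv (\<lambda>z. D z w) g x"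
      unfolding conv_def using iD by (simp add: linear_add[OF lin] scaleR_add_left)
  next
    fix r v show "conv (\<lambda>z. D z (r *\<^sub>R v)) g x = r *\<^sub>R conv (\<lambda>z. D z v) g x"
      unfolding conv_def by (simp add: linear_scale[OF lin] flip: scaleR_scaleR)
  next
    fix v
    have "norm (conv (\<lambda>z. D z v) g x) \<le> (LINT y|lborel. (B * norm v) * norm (g y))"
      unfolding conv_def
      by (rule Bochner_Integration.integral_norm_bound_integral[OF iD]) (use B(2) g in \<open>auto intro!: mult_right_mono\<close>)
    then show "norm (conv (\<lambda>z. D z v) g x) \<le> norm v * (B * G)" by (simp add: G_def mult_ac)
  qed
  have rem: "norm (conv \<rho> g (x + h) - conv \<rho> g x - conv (\<lambda>z. D z h) g x) / norm h \<le> C * G * norm h" for h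
  proof -
    have "conv \<rho> g (x + h) - conv \<rho> g x - conv (\<lambda>z. D z h) g x =
      (LINT y|lborel. (\<rho> ((x - y) + h) - \<rho> (x - y) - D (x - y) h) *\<^sub>R g y)"
      unfolding conv_def using iD[of x h] i\<rho>[of x] i\<rho>[of "x + h"]
      by (simp add: scaleR_diff_left algebra_simps flip: Bochner_Integration.integral_diff)
    also have "norm \<dots> \<le> (LINT y|lborel. (C * norm h * norm h) * norm (g y))"
    proof (rule Bochner_Integration.integral_norm_bound_integral)
      show "integrable lborel (\<lambda>y. (\<rho> ((x - y) + h) - \<rho> (x - y) - D (x - y) h) *\<^sub>R g y)"
        using iD[of x h] i\<rho>[of x] i\<rho>[of "x + h"] by (simp add: scaleR_diff_left algebra_simps)
    qed (use C(2) g in \<open>auto intro!: mult_right_mono\<close>)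
    finally show ?thesis by (cases "h = 0") (auto simp: G_def divide_simps mult_ac)
  qed
  show ?thesis
    unfolding has_derivative_at
  proof (intro conjI bl)
    have "((\<lambda>h. C * G * norm h) \<longlongrightarrow> 0) (at (0::'a))"
      by (intro tendsto_mult_right_zero tendsto_norm_zero tendsto_ident_at)
    then show "(\<lambda>h. norm (conv \<rho> g (x + h) - conv \<rho> g x - conv (\<lambda>z. D z h) g x) / norm h) \<midarrow>0\<rightarrow> 0"
      by (rule tendsto_sandwich[OF _ _ tendsto_const, rotated 2]) (use rem in auto)
  qed
qed

text \<open>All derivatives fall on \<open>\<rho>\<close>, whose directional derivatives vanish
  outside the same ball; so the induction on the order varies the kernel and keeps \<open>g\<close>
  fixed.\<close>

lemma smooth_conv:
  fixes g :: "'a::euclidean_space \<Rightarrow> 'b::euclidean_space"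
  assumes "smooth_fun \<rho>" "\<And>x. R < norm x \<Longrightarrow> \<rho> x = (0::real)" "integrable lborel g"
  shows "smooth_fun (conv \<rho> g)"
proof (rule smooth_fun_if_Cdiff)
  fix n show "Cdiff n (conv \<rho> g)"
    using assms(1,2)
  proof (induction n arbitrary: \<rho>)
    case (Suc n)
    obtain D where D: "\<And>x. (\<rho> has_derivative D x) (at x)" "\<And>v. smooth_fun (\<lambda>x. D x v)"
      using smooth_fun_derivative[OF Suc.prems(1)] by auto
    have "D x v = 0" if "R < norm x" for x v
      by (rule deriv_zero_outside_support[OF D(1), of "cball 0 R"]) (use Suc.prems that in auto)
    then have "Cdiff n (conv (\<lambda>x. D x v) g)" for v
      by (intro Suc.IH D(2)) auto
    then show ?case
      using conv_has_derivative[OF Suc.prems D(1) assms(3)] by (intro Cdiff_SucI)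
  qed simp
qed

section \<open>Averaging by a mollifier\<close>

lemma mollifierD:
  assumes "mollifier \<epsilon> \<rho>"
  shows "smooth_fun \<rho>" "\<And>x. 0 \<le> \<rho> x" "\<And>x. \<epsilon> < norm x \<Longrightarrow> \<rho> x = 0" "integrable lborel \<rho>"
    "(LINT x|lborel. \<rho> x) = 1" "\<And>x. \<rho> (- x) = \<rho> x" "continuous_on UNIV \<rho>" "\<rho> \<in> borel_measurable borel"
  using assms smooth_fun_continuous borel_measurable_continuous_onI unfolding mollifier_def by blast+

lemma mollifier_conv_integrable:
  fixes g :: "'a::euclidean_space \<Rightarrow> 'b::euclidean_space"
  assumes "mollifier \<epsilon> \<rho>" "integrable lborel g"
  shows "integrable lborel (\<lambda>y. \<rho> (x - y) *\<^sub>R g y)" "integrable lborel (\<lambda>z. \<rho> z *\<^sub>R g (x - z))"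
proof -
  show i: "integrable lborel (\<lambda>y. \<rho> (x - y) *\<^sub>R g y)"
    by (rule conv_integrable[OF mollifierD(7)[OF assms(1)] mollifierD(3)[OF assms(1)] assms(2)])
  show "integrable lborel (\<lambda>z. \<rho> z *\<^sub>R g (x - z))"
    using i lborel_integrable_reflect[of "\<lambda>z. \<rho> z *\<^sub>R g (x - z)" x] by simp
qed

text \<open>A weighted mean obeys every bound valid on the averaging ball. With \<open>B = 0\<close>
  this also shows that a convolution vanishes away from the support of \<open>g\<close>.\<close>

lemma mollifier_conv_norm_le:
  fixes g :: "'a::euclidean_space \<Rightarrow> 'b::euclidean_space"
  assumes "mollifier \<epsilon> \<rho>" "\<And>z. norm z \<le> \<epsilon> \<Longrightarrow> norm (g (x - z)) \<le> B" "0 \<le> B"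
  shows "norm (conv \<rho> g x) \<le> B"
proof -
  note m = mollifierD[OF assms(1)]
  have "norm (conv \<rho> g x) \<le> (LINT z|lborel. norm (\<rho> z *\<^sub>R g (x - z)))"
    unfolding conv_reflect by (rule integral_norm_bound)
  also have "\<dots> \<le> (LINT z|lborel. B * \<rho> z)"
  proof (rule integral_mono')
    fix z show "norm (\<rho> z *\<^sub>R g (x - z)) \<le> B * \<rho> z"
      using assms(2)[of z] m(2,3)[of z] by (cases "norm z \<le> \<epsilon>") (auto simp: mult_left_mono mult.commute[of B])
  qed (use m assms(3) in auto)
  finally show ?thesis using m by simp
qed

lemma mollifier_conv_diff:
  fixes g h :: "'a::euclidean_space \<Rightarrow> 'b::euclidean_space"
  assumes "mollifier \<epsilon> \<rho>" "integrable lborel g" "integrable lborel h"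
  shows "conv \<rho> (\<lambda>x. g x - h x) x = conv \<rho> g x - conv \<rho> h x"
  unfolding conv_def scaleR_diff_right
  by (intro Bochner_Integration.integral_diff mollifier_conv_integrable(1)[OF assms(1)] assms)

lemma mollifier_conv_sum:
  fixes g :: "'i \<Rightarrow> 'a::euclidean_space \<Rightarrow> 'b::euclidean_space"
  assumes "mollifier \<epsilon> \<rho>" "\<And>i. i \<in> I \<Longrightarrow> integrable lborel (g i)"
  shows "conv \<rho> (\<lambda>x. \<Sum>i\<in>I. g i x) x = (\<Sum>i\<in>I. conv \<rho> (g i) x)"
  unfolding conv_def scaleR_sum_right
  by (intro Bochner_Integration.integral_sum mollifier_conv_integrable(1)[OF assms(1)] assms)

lemma mollifier_conv_near:
  fixes g :: "'a::euclidean_space \<Rightarrow> 'b::euclidean_space"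
  assumes "mollifier \<epsilon> \<rho>" "integrable lborel g" "\<And>z. norm z \<le> \<epsilon> \<Longrightarrow> norm (g (x - z) - c) \<le> B" "0 \<le> B"
  shows "norm (conv \<rho> g x - c) \<le> B"
proof -
  note m = mollifierD[OF assms(1)]
  have "c = (LINT z|lborel. \<rho> z *\<^sub>R c)" using m by simp
  then have "conv \<rho> g x - c = (LINT z|lborel. \<rho> z *\<^sub>R (g (x - z) - c))"
    unfolding conv_reflect scaleR_diff_right
    using mollifier_conv_integrable(2)[OF assms(1,2)] m
    by (subst Bochner_Integration.integral_diff) auto
  also have "\<dots> = conv \<rho> (\<lambda>y. g y - c) x" by (simp add: conv_reflect)
  also have "norm \<dots> \<le> B" by (rule mollifier_conv_norm_le[OF assms(1)]) (use assms in auto)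
  finally show ?thesis .
qed

text \<open>The increment of a convolution is the convolution of the increment of \<open>g\<close>,
  so averaging keeps the Lipschitz constant exactly. The constants of the partition pieces therefore
  survive smoothing.\<close>

lemma mollifier_conv_lipschitz:
  fixes g :: "'a::euclidean_space \<Rightarrow> 'b::euclidean_space"
  assumes "mollifier \<epsilon> \<rho>" "integrable lborel g" "\<And>x y. norm (g x - g y) \<le> L * norm (x - y)"
  shows "norm (conv \<rho> g x - conv \<rho> g y) \<le> L * norm (x - y)"
proof -
  have "conv \<rho> g x - conv \<rho> g y = conv \<rho> (\<lambda>w. g (w + (x - y)) - g w) y"
    unfolding conv_reflect scaleR_diff_right
    using mollifier_conv_integrable(2)[OF assms(1,2)]
    by (subst Bochner_Integration.integral_diff) (auto simp: algebra_simps)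
  also have "norm \<dots> \<le> L * norm (x - y)"
  proof (rule mollifier_conv_norm_le[OF assms(1)])
    show "norm (g (y - z + (x - y)) - g (y - z)) \<le> L * norm (x - y)" for z
      using assms(3)[of "y - z + (x - y)" "y - z"] by simp
    show "0 \<le> L * norm (x - y)" using assms(3)[of x y] norm_ge_zero order_trans by blast
  qed
  finally show ?thesis .
qed

text \<open>Projections and partitions of unity only produce Lipschitz fields; this is how they
  become admissible test fields.\<close>

lemma test_field_conv:
  fixes g :: "'a::euclidean_space \<Rightarrow> 'a"
  assumes "mollifier \<epsilon> \<rho>" "integrable lborel g" "\<And>x. R < norm x \<Longrightarrow> g x = 0"
  shows "test_field (conv \<rho> g)"
proof -
  note m = mollifierD[OF assms(1)]
  have "smooth_fun (conv \<rho> g)"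
    by (rule smooth_conv[OF m(1) m(3) assms(2)])
  moreover have "{x. conv \<rho> g x \<noteq> 0} \<subseteq> cball 0 (R + \<epsilon>)"
  proof (rule ccontr)
    assume "\<not> ?thesis"
    then obtain x where x: "conv \<rho> g x \<noteq> 0" "R + \<epsilon> < norm x" by (metis (mono_tags, lifting) mem_Collect_eq mem_cball_0 not_le subsetI)
    have "norm (conv \<rho> g x) \<le> 0"
    proof (rule mollifier_conv_norm_le[OF assms(1)])
      fix z :: 'a assume "norm z \<le> \<epsilon>"
      then have "R < norm (x - z)" using x(2) norm_triangle_ineq2[of x z] by simp
      then show "norm (g (x - z)) \<le> 0" using assms(3) by simp
    qed simp
    with x(1) show False by simp
  qed
  then have "compact (closure {x. conv \<rho> g x \<noteq> 0})"
    using bounded_subset[OF bounded_cball] compact_closure by blast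
  ultimately show ?thesis by (simp add: test_field_def)
qed

section \<open>Density of Lipschitz functions in \<open>L\<^sup>1\<close>\<close>

definition lip_compact :: "('a::euclidean_space \<Rightarrow> 'b::euclidean_space) \<Rightarrow> bool" where
  "lip_compact h \<longleftrightarrow> (\<exists>L. 0 \<le> L \<and> (\<forall>x y. norm (h x - h y) \<le> L * norm (x - y))) \<and> (\<exists>R. \<forall>x. R < norm x \<longrightarrow> h x = 0)"

lemma lipschitz_continuous:
  assumes "0 \<le> L" "\<And>x y. norm (h x - h y) \<le> L * norm (x - y)"
  shows "continuous_on UNIV (h :: 'a::real_normed_vector \<Rightarrow> 'b::real_normed_vector)"
  by (rule lipschitz_on_continuous_on[of L]) (use assms in \<open>auto simp: lipschitz_on_def dist_norm\<close>)

lemma lip_compact_continuous: "lip_compact h \<Longrightarrow> continuous_on UNIV h"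
  unfolding lip_compact_def using lipschitz_continuous by blast

lemma lip_compact_integrable:
  fixes h :: "'a::euclidean_space \<Rightarrow> 'b::euclidean_space"
  assumes "lip_compact h" "sets M = sets borel" "\<And>K. compact K \<Longrightarrow> emeasure M K < \<infinity>"
  shows "integrable M h"
proof -
  obtain R where R: "\<And>x. R < norm x \<Longrightarrow> h x = 0" using assms(1) by (auto simp: lip_compact_def)
  note c = lip_compact_continuous[OF assms(1)]
  obtain B where B: "\<And>x. norm (h x) \<le> B"
    using continuous_compact_support_bounded[OF c R] by blast
  have hm: "h \<in> borel_measurable M"
    using borel_measurable_continuous_onI[OF c] assms(2) measurable_cong_sets by blast
  show ?thesis
  proof (rule Bochner_Integration.integrable_bound[OF _ hm])
    show "integrable M (\<lambda>x. B * indicator (cball 0 R) x :: real)"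
      using assms(2) assms(3)[OF compact_cball] by (intro integrable_mult_right integrable_real_indicator) auto
    show "AE x in M. norm (h x) \<le> norm (B * indicator (cball 0 R) x :: real)"
      using B R by (intro always_eventually) (auto simp: indicator_def not_le intro: order_trans[OF _ abs_ge_self])
  qed
qed

lemma lip_compact_add: "lip_compact f \<Longrightarrow> lip_compact g \<Longrightarrow> lip_compact (\<lambda>x. f x + g x)"
proof -
  assume f: "lip_compact f" and g: "lip_compact g"
  obtain L R where 1: "0 \<le> L" "\<And>x y. norm (f x - f y) \<le> L * norm (x - y)" "\<And>x. R < norm x \<Longrightarrow> f x = 0"
    using f by (auto simp: lip_compact_def)
  obtain L' R' where 2: "0 \<le> L'" "\<And>x y. norm (g x - g y) \<le> L' * norm (x - y)" "\<And>x. R' < norm x \<Longrightarrow> g x = 0"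
    using g by (auto simp: lip_compact_def)
  have "norm (f x + g x - (f y + g y)) \<le> (L + L') * norm (x - y)" for x y
    using norm_triangle_mono[OF 1(2)[of x y] 2(2)[of x y]] by (simp add: algebra_simps)
  moreover have "f x + g x = 0" if "max R R' < norm x" for x using that 1(3) 2(3) by simp
  ultimately show ?thesis unfolding lip_compact_def using 1(1) 2(1) add_nonneg_nonneg by blast
qed

lemma lip_compact_plateau:
  fixes K :: "'a::euclidean_space set"
  assumes "compact K" "open U" "K \<subseteq> U"
  obtains h :: "'a \<Rightarrow> real" where "lip_compact h" "\<And>x. 0 \<le> h x" "\<And>x. h x \<le> 1"
    "\<And>x. x \<in> K \<Longrightarrow> h x = 1" "\<And>x. x \<notin> U \<Longrightarrow> h x = 0"
proof (cases "K = {}")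
  case True
  show ?thesis by (rule that[of "\<lambda>_. 0"]) (use True in \<open>auto simp: lip_compact_def\<close>)
next
  case False
  obtain d where d: "0 < d" "(\<Union>x\<in>K. ball x d) \<subseteq> U"
    using compact_subset_open_imp_ball_epsilon_subset[OF assms] by blast
  define h where "h x = max 0 (1 - infdist x K / d)" for x
  have far: "h x = 0" if "\<And>y. y \<in> K \<Longrightarrow> d \<le> dist x y" for x
  proof -
    have "d \<le> infdist x K"
      using that False by (metis assms(1) compact_imp_closed infdist_attains_inf)
    then show ?thesis using d(1) by (simp add: h_def)
  qed
  obtain R where R: "\<And>y. y \<in> K \<Longrightarrow> norm y \<le> R"
    using compact_imp_bounded[OF assms(1)] bounded_iff by metis
  have "lip_compact h" unfolding lip_compact_def
  proof (intro conjI exI allI impI)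
    show "0 \<le> 1/d" using d by simp
    show "norm (h x - h y) \<le> 1/d * norm (x - y)" for x y
    proof -
      have "\<bar>infdist x K - infdist y K\<bar> \<le> norm (x - y)"
        using infdist_triangle[of x K y] infdist_triangle[of y K x] by (simp add: dist_norm norm_minus_commute)
      then have "\<bar>infdist x K / d - infdist y K / d\<bar> \<le> 1/d * norm (x - y)"
        using d(1) by (simp add: diff_divide_distrib[symmetric] divide_right_mono)
      then show ?thesis unfolding h_def real_norm_def by linarith
    qed
    show "h x = 0" if "R + d < norm x" for x
    proof (rule far)
      fix y assume "y \<in> K"
      then show "d \<le> dist x y" using R[of y] that norm_triangle_ineq2[of x y] by (simp add: dist_norm)
    qed
  qed
  moreover have "0 \<le> h x" "h x \<le> 1" for x using d(1) infdist_nonneg[of x K] by (auto simp: h_def)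
  moreover have "h x = 1" if "x \<in> K" for x using that by (simp add: h_def)
  moreover have "h x = 0" if "x \<notin> U" for x
    by (rule far) (use that d(2) in \<open>force simp: subset_iff dist_commute not_less[symmetric]\<close>)
  ultimately show ?thesis using that by blast
qed

text \<open>Regularity enters as a hypothesis so that one proof serves finite Borel measures and
  Lebesgue measure. For an indicator, a plateau function between \<open>K\<close> and
  \<open>U\<close> errs only on \<open>U - K\<close>; sums and dominated limits are the remaining
  cases of the induction over integrable functions.\<close>

lemma lip_compact_dense_L1:
  fixes M :: "'a::euclidean_space measure" and g :: "'a \<Rightarrow> 'b::euclidean_space"
  assumes sM: "sets M = sets borel" and cf: "\<And>K. compact K \<Longrightarrow> emeasure M K < \<infinity>"
    and reg: "\<And>A e. A \<in> sets borel \<Longrightarrow> emeasure M A < \<infinity> \<Longrightarrow> 0 < e \<Longrightarrow>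
      \<exists>K U. compact K \<and> open U \<and> K \<subseteq> A \<and> A \<subseteq> U \<and> emeasure M (U - K) < ennreal e"
    and g: "integrable M g"
  shows "\<forall>e>0. \<exists>h. lip_compact h \<and> (LINT x|M. norm (g x - h x)) < e"
  using g
proof (induction rule: integrable_induct)
  case (base A c)
  show ?case
  proof (intro allI impI)
    fix e :: real assume e: "0 < e"
    \<comment> \<open>The denominator \<open>norm c + 1\<close> covers \<open>c = 0\<close> and
      gives the strict inequality below.\<close>
    obtain K U where KU: "compact K" "open U" "K \<subseteq> A" "A \<subseteq> U" "emeasure M (U - K) < ennreal (e / (norm c + 1))"
      using reg[of A "e / (norm c + 1)"] base sM e by (auto simp: add_nonneg_pos)
    obtain h where h: "lip_compact h" "\<And>x. 0 \<le> h x" "\<And>x. h x \<le> (1::real)"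
      "\<And>x. x \<in> K \<Longrightarrow> h x = 1" "\<And>x. x \<notin> U \<Longrightarrow> h x = 0"
      using lip_compact_plateau[OF KU(1,2)] KU(3,4) by (metis subset_trans)
    obtain L R where LR: "0 \<le> L" "\<And>x y. norm (h x - h y) \<le> L * norm (x - y)" "\<And>x. R < norm x \<Longrightarrow> h x = 0"
      using h(1) by (auto simp: lip_compact_def)
    have "lip_compact (\<lambda>x. h x *\<^sub>R c)"
      unfolding lip_compact_def
    proof (intro conjI exI allI impI)
      show "0 \<le> L * norm c" using LR by simp
      show "norm (h x *\<^sub>R c - h y *\<^sub>R c) \<le> L * norm c * norm (x - y)" for x y
        using mult_right_mono[OF LR(2)[of x y] norm_ge_zero[of c]]
        by (simp add: scaleR_diff_left[symmetric] mult_ac)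
      show "h x *\<^sub>R c = 0" if "R < norm x" for x using LR(3)[OF that] by simp
    qed
    moreover have "(LINT x|M. norm (indicator A x *\<^sub>R c - h x *\<^sub>R c)) < e"
    proof -
      have fin: "emeasure M (U - K) < \<infinity>" using KU(5) by (simp add: less_trans[OF _ ennreal_less_top])
      have ms: "U - K \<in> sets M" using KU sM by (auto simp: borel_compact)
      have m: "measure M (U - K) < e / (norm c + 1)"
        using KU(5) fin e by (simp add: emeasure_eq_ennreal_measure ennreal_less_iff)
      have "(LINT x|M. norm (indicator A x *\<^sub>R c - h x *\<^sub>R c)) \<le> (LINT x|M. norm c * indicator (U - K) x)"
      proof (rule integral_mono')
        show "integrable M (\<lambda>x. norm c * indicator (U - K) x)"
          using ms fin by (intro integrable_mult_right integrable_real_indicator) auto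
        fix x
        have "\<bar>indicator A x - h x\<bar> \<le> indicator (U - K) x"
          using h(2-5)[of x] KU(3,4) by (auto simp: indicator_def)
        then show "norm (indicator A x *\<^sub>R c - h x *\<^sub>R c) \<le> norm c * indicator (U - K) x"
          by (simp add: scaleR_diff_left[symmetric] mult.commute mult_left_mono)
      qed auto
      also have "\<dots> = norm c * measure M (U - K)" using ms by simp
      also have "\<dots> \<le> norm c * (e / (norm c + 1))" using m by (intro mult_left_mono) auto
      also have "\<dots> < e" 
      proof -
        have "0 < norm c + 1" by (simp add: add_nonneg_pos)
        then show ?thesis using e by (simp add: field_simps)
      qed
      finally show ?thesis .
    qed
    ultimately show "\<exists>h. lip_compact h \<and> (LINT x|M. norm (indicator A x *\<^sub>R c - h x)) < e" by blast
  qed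
next
  case (add f g)
  show ?case
  proof (intro allI impI)
    fix e :: real assume e: "0 < e"
    obtain h where h: "lip_compact h" "(LINT x|M. norm (f x - h x)) < e/2" using add.IH(1) e half_gt_zero by blast
    obtain k where k: "lip_compact k" "(LINT x|M. norm (g x - k x)) < e/2" using add.IH(2) e half_gt_zero by blast
    note hi = lip_compact_integrable[OF h(1) sM cf] and ki = lip_compact_integrable[OF k(1) sM cf]
    have "(LINT x|M. norm (f x + g x - (h x + k x))) \<le> (LINT x|M. norm (f x - h x) + norm (g x - k x))"
    proof (rule integral_mono)
      fix x show "norm (f x + g x - (h x + k x)) \<le> norm (f x - h x) + norm (g x - k x)"
        using norm_triangle_ineq[of "f x - h x" "g x - k x"] by (simp add: algebra_simps)
    qed (use add.hyps hi ki in auto)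
    also have "\<dots> = (LINT x|M. norm (f x - h x)) + (LINT x|M. norm (g x - k x))"
      using add.hyps hi ki by simp
    finally show "\<exists>h. lip_compact h \<and> (LINT x|M. norm (f x + g x - h x)) < e"
      using h k by (intro exI[of _ "\<lambda>x. h x + k x"]) (auto intro: lip_compact_add)
  qed
next
  case (lim f s)
  show ?case
  proof (intro allI impI)
    fix e :: real assume e: "0 < e"
    \<comment> \<open>The approximants satisfy \<open>norm (s i x) \<le> 2 * norm (f x)\<close>,
      whence the factor 3 in the majorant.\<close>
    have "(\<lambda>i. LINT x|M. norm (f x - s i x)) \<longlonglongrightarrow> (LINT x|M. 0)"
    proof (rule integral_dominated_convergence[where w="\<lambda>x. 3 * norm (f x)"])
      show "AE x in M. (\<lambda>i. norm (f x - s i x)) \<longlonglongrightarrow> 0"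
      proof (rule AE_I2)
        fix x assume "x \<in> space M"
        then have "(\<lambda>i. norm (f x - s i x)) \<longlonglongrightarrow> norm (f x - f x)" by (intro tendsto_intros lim)
        then show "(\<lambda>i. norm (f x - s i x)) \<longlonglongrightarrow> 0" by simp
      qed
      show "AE x in M. norm (norm (f x - s i x)) \<le> 3 * norm (f x)" for i
      proof (rule AE_I2)
        fix x assume "x \<in> space M"
        then show "norm (norm (f x - s i x)) \<le> 3 * norm (f x)"
          using lim.hyps(3)[of x i] norm_triangle_ineq4[of "f x" "s i x"] by simp
      qed
    qed (use lim in auto)
    then have "(\<lambda>i. LINT x|M. norm (f x - s i x)) \<longlonglongrightarrow> 0" by simp
    then have "\<forall>\<^sub>F i in sequentially. (LINT x|M. norm (f x - s i x)) < e/2"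
      using e by (intro order_tendstoD(2)[where a="e/2"]) auto
    then obtain i where i: "(LINT x|M. norm (f x - s i x)) < e/2"
      by (auto simp: eventually_sequentially)
    obtain h where h: "lip_compact h" "(LINT x|M. norm (s i x - h x)) < e/2" using lim.IH e half_gt_zero by blast
    note hi = lip_compact_integrable[OF h(1) sM cf]
    have "(LINT x|M. norm (f x - h x)) \<le> (LINT x|M. norm (f x - s i x) + norm (s i x - h x))"
    proof (rule integral_mono)
      fix x show "norm (f x - h x) \<le> norm (f x - s i x) + norm (s i x - h x)"
        using norm_triangle_ineq[of "f x - s i x" "s i x - h x"] by simp
    qed (use lim.hyps hi in auto)
    also have "\<dots> = (LINT x|M. norm (f x - s i x)) + (LINT x|M. norm (s i x - h x))"
      using lim.hyps hi by simp
    finally show "\<exists>h. lip_compact h \<and> (LINT x|M. norm (f x - h x)) < e"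
      using h i by (intro exI[of _ h]) auto
  qed
qed

section \<open>Regularity of finite Borel measures and of Lebesgue measure\<close>

lemma finite_borel_regular:
  fixes M :: "'a::euclidean_space measure"
  assumes "sets M = sets borel" "finite_measure M" "A \<in> sets borel" "0 < e"
  shows "\<exists>K U. compact K \<and> open U \<and> K \<subseteq> A \<and> A \<subseteq> U \<and> emeasure M (U - K) < ennreal e"
proof -
  interpret finite_measure M by fact
  have fin: "emeasure M (space M) \<noteq> \<infinity>" by simp
  have "\<exists>K. K \<subseteq> A \<and> compact K \<and> measure M A - e/2 < measure M K"
  proof (rule ccontr)
    assume "\<not> ?thesis"
    then have *: "measure M K \<le> measure M A - e/2" if "K \<subseteq> A" "compact K" for K using that by force
    have "0 \<le> measure M A - e/2" using *[of "{}"] by simp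
    moreover have "emeasure M A \<le> ennreal (measure M A - e/2)"
      unfolding inner_regular[OF assms(1) fin assms(3)]
      by (rule SUP_least) (use * in \<open>auto simp: emeasure_eq_measure intro!: ennreal_leI\<close>)
    ultimately show False using assms(4) by (simp add: emeasure_eq_measure)
  qed
  then obtain K where K: "K \<subseteq> A" "compact K" "measure M A - e/2 < measure M K" by blast
  have "\<exists>U. A \<subseteq> U \<and> open U \<and> measure M U < measure M A + e/2"
  proof (rule ccontr)
    assume "\<not> ?thesis"
    then have *: "measure M A + e/2 \<le> measure M U" if "A \<subseteq> U" "open U" for U using that by force
    have "ennreal (measure M A + e/2) \<le> emeasure M A"
      unfolding outer_regular[OF assms(1) fin assms(3)]
      by (rule INF_greatest) (use * in \<open>auto simp: emeasure_eq_measure intro!: ennreal_leI\<close>)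
    then show False using assms(4) by (simp add: emeasure_eq_measure)
  qed
  then obtain U where U: "A \<subseteq> U" "open U" "measure M U < measure M A + e/2" by blast
  have "measure M (U - K) = measure M U - measure M K"
    using K U assms(1) by (intro finite_measure_Diff) (auto simp: borel_compact)
  then have "measure M (U - K) < e" using K U by simp
  then show ?thesis using K U assms(4)
    by (intro exI[of _ K] exI[of _ U]) (auto simp: emeasure_eq_measure ennreal_lessI)
qed

text \<open>Lebesgue measure is not finite, so the compact set is found for the finite measure
  \<open>N\<close>, its restriction to \<open>A\<close>; the open set comes from outer regularity of
  Lebesgue measurable sets.\<close>

lemma lborel_regular:
  fixes A :: "'a::euclidean_space set"
  assumes "A \<in> sets borel" "emeasure lborel A < \<infinity>" "0 < e"
  shows "\<exists>K U. compact K \<and> open U \<and> K \<subseteq> A \<and> A \<subseteq> U \<and> emeasure lborel (U - K) < ennreal e"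
proof -
  have "A \<in> sets lebesgue" using assms(1) by simp
  then obtain U where U: "open U" "A \<subseteq> U" "U - A \<in> lmeasurable" "emeasure lebesgue (U - A) < ennreal (e/2)"
    using sets_lebesgue_outer_open[of A "e/2"] assms(3) half_gt_zero by blast
  define N where "N = density lborel (indicator A)"
  have N: "emeasure N B = emeasure lborel (A \<inter> B)" if "B \<in> sets borel" for B
    unfolding N_def using that assms(1) by (subst emeasure_density) (auto simp flip: indicator_inter_arith)
  have "finite_measure N"
    by (rule finite_measureI) (use N[of UNIV] assms(2) in \<open>simp add: N_def\<close>)
  then obtain K V where K: "compact K" "K \<subseteq> A" "A \<subseteq> V" "open V" "emeasure N (V - K) < ennreal (e/2)"
    using finite_borel_regular[of N A "e/2"] assms half_gt_zero by (auto simp: N_def)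
  have KA: "emeasure lborel (A - K) < ennreal (e/2)"
  proof -
    have "A \<inter> (V - K) = A - K" using K(3) by auto
    then show ?thesis using K(5) N[of "V - K"] borel_open[OF K(4)] borel_compact[OF K(1)] by simp
  qed
  have bs: "U - A \<in> sets borel" "A - K \<in> sets borel" "U - K \<in> sets borel"
    using U K assms(1) by (auto simp: borel_compact)
  have "emeasure lborel (U - K) \<le> emeasure lborel ((U - A) \<union> (A - K))"
    by (rule emeasure_mono) (use bs in auto)
  also have "\<dots> \<le> emeasure lborel (U - A) + emeasure lborel (A - K)"
    by (rule emeasure_subadditive) (use bs in auto)
  also have "\<dots> < ennreal (e/2) + ennreal (e/2)"
    using U(4) KA bs by (intro add_strict_mono) auto
  also have "\<dots> = ennreal e" using assms(3) by (simp flip: ennreal_plus)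
  finally show ?thesis using U K by blast
qed

lemma lip_compact_dense_finite:
  fixes M :: "'a::euclidean_space measure" and g :: "'a \<Rightarrow> 'b::euclidean_space"
  assumes "sets M = sets borel" "finite_measure M" "integrable M g" "0 < e"
  obtains h where "lip_compact h" "(LINT x|M. norm (g x - h x)) < e"
proof -
  interpret finite_measure M by fact
  have "emeasure M K < \<infinity>" for K by (simp add: less_top[symmetric])
  then show ?thesis
    using lip_compact_dense_L1[OF assms(1) _ finite_borel_regular[OF assms(1,2)] assms(3)] that assms(4) by blast
qed

lemma lip_compact_dense_lborel:
  fixes g :: "'a::euclidean_space \<Rightarrow> 'b::euclidean_space"
  assumes "integrable lborel g" "0 < e"
  obtains h where "lip_compact h" "(LINT x|lborel. norm (g x - h x)) < e"
  using lip_compact_dense_L1[OF _ emeasure_compact_finite lborel_regular assms(1)] assms(2) that by force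

section \<open>Convergence of mollifications in L1\<close>

lemma mollifier_conv_L1:
  fixes g :: "'a::euclidean_space \<Rightarrow> 'b::euclidean_space"
  assumes m: "mollifier \<epsilon> \<rho>" and g: "integrable lborel g"
  shows "integrable lborel (conv \<rho> g)" "(LINT x|lborel. norm (conv \<rho> g x)) \<le> (LINT x|lborel. norm (g x))"
proof -
  note \<rho> = mollifierD[OF m]
  have [measurable]: "\<rho> \<in> borel_measurable borel" by (rule \<rho>)
  have [measurable]: "g \<in> borel_measurable borel" using borel_measurable_integrable[OF g] by simp
  have "continuous_on UNIV (conv \<rho> g)"
    by (rule smooth_fun_continuous[OF smooth_conv[OF \<rho>(1) \<rho>(3) g]])
  then have [measurable]: "conv \<rho> g \<in> borel_measurable borel" by (rule borel_measurable_continuous_onI)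
  have one: "(\<integral>\<^sup>+x. ennreal (\<rho> (x - y)) \<partial>lborel) = 1" for y
  proof -
    have "(\<integral>\<^sup>+x. ennreal (\<rho> (- y + x)) \<partial>lborel) = (\<integral>\<^sup>+x. ennreal (\<rho> x) \<partial>lborel)"
      by (rule lborel_nn_integral_translate) measurable
    also have "\<dots> = 1" using nn_integral_eq_integral[OF \<rho>(4)] \<rho>(2,5) by simp
    finally show ?thesis by simp
  qed
  have "(\<integral>\<^sup>+x. norm (conv \<rho> g x) \<partial>lborel) \<le> (\<integral>\<^sup>+x. \<integral>\<^sup>+y. ennreal (\<rho> (x - y)) * ennreal (norm (g y)) \<partial>lborel \<partial>lborel)"
    unfolding conv_def using integral_norm_bound_ennreal[OF mollifier_conv_integrable(1)[OF m g]] \<rho>(2)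
    by (intro nn_integral_mono) (simp add: ennreal_mult)
  also have "\<dots> = (\<integral>\<^sup>+y. \<integral>\<^sup>+x. ennreal (\<rho> (x - y)) * ennreal (norm (g y)) \<partial>lborel \<partial>lborel)"
    by (rule lborel_pair.Fubini'[symmetric]) measurable
  also have "\<dots> = (\<integral>\<^sup>+y. ennreal (norm (g y)) \<partial>lborel)"
    by (subst nn_integral_multc) (auto simp: one)
  also have "\<dots> = ennreal (LINT x|lborel. norm (g x))"
    using g by (intro nn_integral_eq_integral) auto
  finally have *: "(\<integral>\<^sup>+x. norm (conv \<rho> g x) \<partial>lborel) \<le> ennreal (LINT x|lborel. norm (g x))" .
  then show i: "integrable lborel (conv \<rho> g)"
    by (intro integrableI_bounded) (auto intro: le_less_trans)
  show "(LINT x|lborel. norm (conv \<rho> g x)) \<le> (LINT x|lborel. norm (g x))"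
    using * i by (subst (asm) nn_integral_eq_integral) (auto simp: ennreal_le_iff)
qed

text \<open>\<open>w\<close> is compared with a Lipschitz function \<open>h\<close>: convolution
  does not increase the L1 distance of \<open>w\<close> and \<open>h\<close>, and it moves
  \<open>h\<close> by at most \<open>L * \<epsilon>\<close> on a bounded set. One
  \<open>\<delta>\<close> serves all mollifiers of smaller radius.\<close>

lemma mollifier_L1_approx:
  fixes w :: "'a::euclidean_space \<Rightarrow> 'b::euclidean_space"
  assumes w: "integrable lborel w" and e: "0 < e"
  obtains \<delta> where "0 < \<delta>" "\<And>\<epsilon> \<rho>. 0 < \<epsilon> \<Longrightarrow> \<epsilon> \<le> \<delta> \<Longrightarrow> mollifier \<epsilon> \<rho> \<Longrightarrow> (LINT x|lborel. norm (conv \<rho> w x - w x)) < e"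
proof -
  obtain h :: "'a \<Rightarrow> 'b" where h: "lip_compact h" "(LINT x|lborel. norm (w x - h x)) < e/4"
    using lip_compact_dense_lborel[OF w, of "e/4"] e by auto
  obtain L R where L: "0 \<le> L" "\<And>x y. norm (h x - h y) \<le> L * norm (x - y)" and R: "\<And>x. R < norm x \<Longrightarrow> h x = 0"
    using h(1) by (auto simp: lip_compact_def)
  have hi: "integrable lborel h"
    by (rule integrable_continuous_compact_support[OF lip_compact_continuous[OF h(1)] R])
  define V where "V = measure lborel (cball (0::'a) (R + 1))"
  \<comment> \<open>The bound 1 confines the error of \<open>h\<close> to
    \<open>cball 0 (R + 1)\<close>, of volume \<open>V\<close>; the other term makes
    \<open>L * \<delta> * V\<close> at most e/4, the added 1 guarding against
    \<open>L * V = 0\<close>.\<close>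
  define \<delta> where "\<delta> = min 1 (e / (4 * (L * V + 1)))"
  have V: "0 \<le> V" "0 < L * V + 1" using L by (auto simp: V_def intro!: add_nonneg_pos)
  have \<delta>: "0 < \<delta>" using e V by (simp add: \<delta>_def)
  have "(LINT x|lborel. norm (conv \<rho> w x - w x)) < e" if \<epsilon>: "0 < \<epsilon>" "\<epsilon> \<le> \<delta>" and m: "mollifier \<epsilon> \<rho>" for \<epsilon> \<rho>
  proof -
    note ci = mollifier_conv_L1(1)[OF m]
    have wh: "integrable lborel (\<lambda>x. w x - h x)" using w hi by simp
    have i: "integrable lborel (\<lambda>x. norm (conv \<rho> (\<lambda>x. w x - h x) x))"
      "integrable lborel (\<lambda>x. norm (conv \<rho> h x - h x))" "integrable lborel (\<lambda>x. norm (w x - h x))"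
      "integrable lborel (\<lambda>x. norm (conv \<rho> w x - w x))"
      by (intro integrable_norm Bochner_Integration.integrable_diff ci wh w hi)+
    have "(LINT x|lborel. norm (conv \<rho> w x - w x)) \<le>
      (LINT x|lborel. norm (conv \<rho> (\<lambda>x. w x - h x) x) + norm (conv \<rho> h x - h x) + norm (w x - h x))"
    proof (rule integral_mono)
      fix x show "norm (conv \<rho> w x - w x) \<le> norm (conv \<rho> (\<lambda>x. w x - h x) x) + norm (conv \<rho> h x - h x) + norm (w x - h x)"
        using norm_triangle_ineq4[of "conv \<rho> w x - conv \<rho> h x + (conv \<rho> h x - h x)" "w x - h x"]
          norm_triangle_ineq[of "conv \<rho> w x - conv \<rho> h x" "conv \<rho> h x - h x"]
        unfolding mollifier_conv_diff[OF m w hi] by simp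
    qed (intro i Bochner_Integration.integrable_add)+
    also have "\<dots> = (LINT x|lborel. norm (conv \<rho> (\<lambda>x. w x - h x) x)) + (LINT x|lborel. norm (conv \<rho> h x - h x)) + (LINT x|lborel. norm (w x - h x))"
      by (simp only: i Bochner_Integration.integral_add Bochner_Integration.integrable_add)
    also have "(LINT x|lborel. norm (conv \<rho> (\<lambda>x. w x - h x) x)) \<le> (LINT x|lborel. norm (w x - h x))"
      by (rule mollifier_conv_L1(2)[OF m wh])
    also have "(LINT x|lborel. norm (conv \<rho> h x - h x)) \<le> (LINT x|lborel. (L * \<epsilon>) * indicator (cball (0::'a) (R + 1)) x)"
    proof (rule integral_mono')
      show "integrable lborel (\<lambda>x::'a. (L * \<epsilon>) * indicator (cball 0 (R + 1)) x)"
        using emeasure_lborel_cball_finite by (intro integrable_mult_right integrable_real_indicator) auto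
      fix x
      show "norm (conv \<rho> h x - h x) \<le> L * \<epsilon> * indicator (cball 0 (R + 1)) x"
      proof (cases "norm x \<le> R + 1")
        case True
        have "norm (conv \<rho> h x - h x) \<le> L * \<epsilon>"
        proof (rule mollifier_conv_near[OF m hi])
          fix z :: 'a assume "norm z \<le> \<epsilon>"
          then have "L * norm z \<le> L * \<epsilon>" using L by (intro mult_left_mono)
          then show "norm (h (x - z) - h x) \<le> L * \<epsilon>" using L(2)[of "x - z" x] by simp
        qed (use L \<epsilon> in auto)
        then show ?thesis using True by simp
      next
        case False
        have "norm (conv \<rho> h x - h x) \<le> 0"
        proof (rule mollifier_conv_near[OF m hi])
          fix z :: 'a assume "norm z \<le> \<epsilon>"
          then have "norm z \<le> 1" using \<epsilon> by (simp add: \<delta>_def)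
          then have "R < norm (x - z)" using False norm_triangle_ineq2[of x z] by simp
          then show "norm (h (x - z) - h x) \<le> 0" using False R by simp
        qed simp
        then show ?thesis using L \<epsilon> by auto
      qed
    qed (use L \<epsilon> in auto)
    also have "\<dots> = L * \<epsilon> * V" using emeasure_lborel_cball_finite by (simp add: V_def)
    also have "L * \<epsilon> * V \<le> e/4"
    proof -
      have "\<epsilon> * (L * V + 1) \<le> e / (4 * (L * V + 1)) * (L * V + 1)"
        using \<epsilon> V by (intro mult_right_mono) (auto simp: \<delta>_def)
      also have "\<dots> = e/4" using V by (simp add: field_simps)
      finally show ?thesis using \<epsilon> by (simp add: algebra_simps)
    qed
    finally show ?thesis using h(2) e by simp
  qed
  then show ?thesis using \<delta> that by blast
qed

section \<open>Integrals of powers of the norm\<close>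

text \<open>A substitute for polar coordinates: a function bounded shell by shell is dominated by a
  sum of multiples of indicators of full balls, and their volumes are explicit. Each point has to be
  accounted for by a single index.\<close>

lemma integral_le_sum_over_balls:
  fixes f :: "'a::euclidean_space \<Rightarrow> real" and c r :: "nat \<Rightarrow> real"
  assumes [measurable]: "f \<in> borel_measurable borel" and nn: "\<And>z. 0 \<le> f z" and cr: "\<And>k. 0 \<le> c k" "\<And>k. 0 \<le> r k"
    and cover: "\<And>z. f z \<noteq> 0 \<Longrightarrow> \<exists>k. f z \<le> c k \<and> norm z \<le> r k"
    and sums: "(\<lambda>k. c k * (unit_ball_vol (real DIM('a)) * r k ^ DIM('a))) sums S"
  shows "integrable lborel f" "(LINT z|lborel. f z) \<le> S"
proof -
  have S: "0 \<le> S" using sums_le[OF _ sums_zero sums] cr by (auto simp: unit_ball_vol_nonneg)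
  have "(\<integral>\<^sup>+z. f z \<partial>lborel) \<le> (\<integral>\<^sup>+z. (\<Sum>k. ennreal (c k) * indicator (cball (0::'a) (r k)) z) \<partial>lborel)"
  proof (rule nn_integral_mono)
    fix z :: 'a
    show "ennreal (f z) \<le> (\<Sum>k. ennreal (c k) * indicator (cball 0 (r k)) z)"
    proof (cases "f z = 0")
      case False
      then obtain k where k: "f z \<le> c k" "norm z \<le> r k" using cover by blast
      have "ennreal (f z) \<le> (\<Sum>i\<in>{k}. ennreal (c i) * indicator (cball 0 (r i)) z)"
        using k by (subst sum.insert) (auto simp: ennreal_leI)
      also have "\<dots> \<le> (\<Sum>k. ennreal (c k) * indicator (cball 0 (r k)) z)" by (rule sum_le_suminf) auto
      finally show ?thesis .
    qed simp
  qed
  also have "\<dots> = (\<Sum>k. \<integral>\<^sup>+z. ennreal (c k) * indicator (cball (0::'a) (r k)) z \<partial>lborel)"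
    by (rule nn_integral_suminf) (auto intro!: borel_measurable_times_ennreal borel_measurable_indicator)
  also have "\<dots> = (\<Sum>k. ennreal (c k * (unit_ball_vol (real DIM('a)) * r k ^ DIM('a))))"
    using cr by (intro suminf_cong) (simp add: nn_integral_cmult_indicator emeasure_cball ennreal_mult unit_ball_vol_nonneg)
  also have "\<dots> = ennreal S"
    using sums cr by (intro suminf_ennreal_eq) (auto simp: unit_ball_vol_nonneg)
  finally have *: "(\<integral>\<^sup>+z. f z \<partial>lborel) \<le> ennreal S" .
  then show i: "integrable lborel f"
    using nn by (intro integrableI_bounded) (auto intro: le_less_trans)
  show "(LINT z|lborel. f z) \<le> S"
    using * S nn by (simp add: nn_integral_eq_integral[OF i] ennreal_le_iff)
qed

lemma powr_near_integral:
  assumes a: "0 \<le> a" "a < real DIM('a::euclidean_space)"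
  obtains C where "0 < C" "\<And>r. 0 < r \<Longrightarrow> integrable lborel (\<lambda>z::'a. indicator (ball 0 r) z * norm z powr (-a))"
    "\<And>r. 0 < r \<Longrightarrow> (LINT z|lborel. indicator (ball (0::'a) r) z * norm z powr (-a)) \<le> C * r powr (real DIM('a) - a)"
proof -
  let ?n = "real DIM('a)"
  \<comment> \<open>Passing to the next smaller dyadic shell multiplies bound times volume by 2^(a -
    n), so a < n is exactly the convergence of the geometric series.\<close>
  define q where "q = 2 powr (a - ?n)"
  have q: "0 < q" "q < 1" using a by (auto simp: q_def powr_less_one)
  define C where "C = unit_ball_vol ?n * 2 powr a * (1 / (1 - q))"
  have main: "integrable lborel (\<lambda>z::'a. indicator (ball 0 r) z * norm z powr (-a)) \<and>
    (LINT z|lborel. indicator (ball (0::'a) r) z * norm z powr (-a)) \<le> C * r powr (?n - a)" if r: "0 < r" for r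
  proof -
    define R where "R k = r * 2 powr (- real k)" for k :: nat
    define c where "c k = (R k / 2) powr (-a)" for k
    have Rpos: "0 < R k" for k using r by (simp add: R_def)
    have trm: "c k * (unit_ball_vol ?n * R k ^ DIM('a)) = (unit_ball_vol ?n * 2 powr a * r powr (?n - a)) * q ^ k" for k
    proof -
      have "c k * R k ^ DIM('a) = (R k / 2) powr (-a) * R k powr ?n" using Rpos[of k] by (simp add: c_def powr_realpow)
      also have "\<dots> = 2 powr a * R k powr (?n - a)"
        using Rpos[of k] by (simp add: powr_divide powr_minus powr_diff field_simps)
      also have "R k powr (?n - a) = r powr (?n - a) * q ^ k"
        using r by (simp add: R_def q_def powr_mult powr_powr powr_realpow[symmetric] algebra_simps)
      finally show ?thesis by (simp add: mult_ac)
    qed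
    have "(\<lambda>k. c k * (unit_ball_vol ?n * R k ^ DIM('a))) sums ((unit_ball_vol ?n * 2 powr a * r powr (?n - a)) * (1 / (1 - q)))"
      unfolding trm using q by (intro sums_mult geometric_sums) auto
    then have sums: "(\<lambda>k. c k * (unit_ball_vol ?n * R k ^ DIM('a))) sums (C * r powr (?n - a))"
      by (simp add: C_def mult_ac)
    have cover: "\<exists>k. indicator (ball 0 r) z * norm z powr (-a) \<le> c k \<and> norm z \<le> R k"
      if nz: "indicator (ball 0 r) z * norm z powr (-a) \<noteq> 0" for z :: 'a
    proof -
      \<comment> \<open>The origin drops out, because \<open>0 powr (-a)\<close> is 0 by
        convention.\<close>
      have z: "0 < norm z" "norm z < r" using nz by (auto simp: indicator_def split: if_splits)
      define k where "k = nat \<lfloor>log 2 (r / norm z)\<rfloor>"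
      have lpos: "0 \<le> log 2 (r / norm z)" by (subst zero_le_log_cancel_iff) (use z r in \<open>auto simp: field_simps\<close>)
      then have k: "real k \<le> log 2 (r / norm z)" "log 2 (r / norm z) < real k + 1"
        unfolding k_def by linarith+
      have 1: "2 powr real k \<le> r / norm z" "r / norm z < 2 powr (real k + 1)"
        using k z r le_log_iff[of 2 "r / norm z" "real k"] log_less_iff[of 2 "r / norm z" "real k + 1"] by simp_all
      have "norm z \<le> R k" using 1(1) z by (simp add: R_def powr_minus field_simps)
      moreover have "R k / 2 \<le> norm z" using 1(2) z by (simp add: R_def powr_minus powr_add field_simps)
      then have "norm z powr (-a) \<le> c k" unfolding c_def using Rpos[of k] a(1)
        by (intro powr_mono2') auto
      ultimately show ?thesis using z by (intro exI[of _ k]) (auto simp: indicator_def)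
    qed
    have "(\<lambda>z::'a. indicator (ball 0 r) z * norm z powr (-a) :: real) \<in> borel_measurable borel"
      by (intro borel_measurable_times borel_measurable_indicator) auto
    then show ?thesis
      by (intro conjI integral_le_sum_over_balls[OF _ _ _ _ cover sums])
        (auto simp: c_def less_imp_le[OF Rpos])
  qed
  have "0 < C" unfolding C_def using q unit_ball_vol_pos[of ?n] by simp
  then show ?thesis using that main by blast
qed

lemma powr_far_integral:
  assumes a: "real DIM('a::euclidean_space) < a"
  obtains C where "0 < C" "\<And>r. 0 < r \<Longrightarrow> integrable lborel (\<lambda>z::'a. indicator {z. r \<le> norm z} z * norm z powr (-a))"
    "\<And>r. 0 < r \<Longrightarrow> (LINT z|lborel. indicator {z::'a. r \<le> norm z} z * norm z powr (-a)) \<le> C * r powr (real DIM('a) - a)"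
proof -
  let ?n = "real DIM('a)"
  define q where "q = 2 powr (?n - a)"
  have q: "0 < q" "q < 1" using a by (auto simp: q_def powr_less_one)
  define C where "C = unit_ball_vol ?n * 2 powr ?n * (1 / (1 - q))"
  have main: "integrable lborel (\<lambda>z::'a. indicator {z. r \<le> norm z} z * norm z powr (-a)) \<and>
    (LINT z|lborel. indicator {z::'a. r \<le> norm z} z * norm z powr (-a)) \<le> C * r powr (?n - a)" if r: "0 < r" for r
  proof -
    define R where "R k = r * 2 powr (real k)" for k :: nat
    define c where "c k = R k powr (-a)" for k
    have Rpos: "0 < R k" for k using r by (simp add: R_def)
    have trm: "c k * (unit_ball_vol ?n * (2 * R k) ^ DIM('a)) = (unit_ball_vol ?n * 2 powr ?n * r powr (?n - a)) * q ^ k" for k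
    proof -
      have "c k * (2 * R k) ^ DIM('a) = R k powr (-a) * (2 * R k) powr ?n" using Rpos[of k] by (simp add: c_def powr_realpow)
      also have "\<dots> = 2 powr ?n * R k powr (?n - a)"
        using Rpos[of k] by (simp add: powr_mult powr_minus powr_diff field_simps)
      also have "R k powr (?n - a) = r powr (?n - a) * q ^ k"
        using r by (simp add: R_def q_def powr_mult powr_powr powr_realpow[symmetric] algebra_simps)
      finally show ?thesis by (simp add: mult_ac)
    qed
    have "(\<lambda>k. c k * (unit_ball_vol ?n * (2 * R k) ^ DIM('a))) sums ((unit_ball_vol ?n * 2 powr ?n * r powr (?n - a)) * (1 / (1 - q)))"
      unfolding trm using q by (intro sums_mult geometric_sums) auto
    then have sums: "(\<lambda>k. c k * (unit_ball_vol ?n * (2 * R k) ^ DIM('a))) sums (C * r powr (?n - a))"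
      by (simp add: C_def mult_ac)
    \<comment> \<open>\<open>R k\<close> is the inner radius of the dyadic shell, where the
      decreasing power is largest; the covering ball needs the outer radius
      \<open>2 * R k\<close>.\<close>
    have cover: "\<exists>k. indicator {z. r \<le> norm z} z * norm z powr (-a) \<le> c k \<and> norm z \<le> 2 * R k"
      if nz: "indicator {z. r \<le> norm z} z * norm z powr (-a) \<noteq> 0" for z :: 'a
    proof -
      have z: "0 < norm z" "r \<le> norm z" using nz by (auto simp: indicator_def split: if_splits)
      define k where "k = nat \<lfloor>log 2 (norm z / r)\<rfloor>"
      have lpos: "0 \<le> log 2 (norm z / r)" by (subst zero_le_log_cancel_iff) (use z r in \<open>auto simp: field_simps\<close>)
      then have k: "real k \<le> log 2 (norm z / r)" "log 2 (norm z / r) < real k + 1"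
        unfolding k_def by linarith+
      have 1: "2 powr real k \<le> norm z / r" "norm z / r < 2 powr (real k + 1)"
        using k z r le_log_iff[of 2 "norm z / r" "real k"] log_less_iff[of 2 "norm z / r" "real k + 1"] by simp_all
      have "R k \<le> norm z" using 1(1) r by (simp add: R_def field_simps)
      then have "norm z powr (-a) \<le> c k" unfolding c_def using Rpos[of k] a
        by (intro powr_mono2') auto
      moreover have "norm z \<le> 2 * R k" using 1(2) r by (simp add: R_def powr_add field_simps)
      ultimately show ?thesis using z by (intro exI[of _ k]) (auto simp: indicator_def)
    qed
    show ?thesis
      by (intro conjI integral_le_sum_over_balls[OF _ _ _ _ cover sums])
        (auto simp: c_def less_imp_le[OF Rpos])
  qed
  have "0 < C" unfolding C_def using q unit_ball_vol_pos[of ?n] by simp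
  then show ?thesis using that main by blast
qed

section \<open>Coverings of Hausdorff null sets\<close>

lemma hausdorff_zero_pre:
  assumes "hausdorff s A = 0" "0 < \<delta>"
  shows "hausdorff_pre s \<delta> A = 0"
proof -
  have "hausdorff_pre s \<delta> A \<le> hausdorff s A"
    unfolding hausdorff_def by (rule SUP_upper) (use assms(2) in auto)
  then show ?thesis using assms(1) by simp
qed

lemma hausdorff_mono: "A \<subseteq> B \<Longrightarrow> hausdorff s A \<le> hausdorff s B"
proof -
  assume AB: "A \<subseteq> B"
  have "hausdorff_pre s \<delta> A \<le> hausdorff_pre s \<delta> B" for \<delta>
    unfolding hausdorff_pre_def by (rule INF_superset_mono) (use AB in auto)
  then show ?thesis unfolding hausdorff_def by (rule SUP_mono')
qed

text \<open>In dimension 0 every nonempty covering set counts 1. This exponent is treated separately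
  because \<open>r powr 0\<close> carries no smallness for a covering to exploit.\<close>

lemma hausdorff_zero_dim_null:
  assumes "hausdorff 0 A = 0"
  shows "A = {}"
proof (rule ccontr)
  assume "A \<noteq> {}"
  then obtain a where a: "a \<in> A" by blast
  have "1 \<le> hausdorff_pre 0 1 A"
    unfolding hausdorff_pre_def
  proof (rule INF_greatest)
    fix C :: "nat \<Rightarrow> 'a set" assume "C \<in> {C. A \<subseteq> (\<Union>i. C i) \<and> (\<forall>i. bounded (C i) \<and> diameter (C i) \<le> 1)}"
    then obtain i where i: "a \<in> C i" using a by blast
    have "(1::ennreal) \<le> (\<Sum>j\<in>{i}. ennreal (haus_term 0 (C j)))" using i by (auto simp: haus_term_def)
    also have "\<dots> \<le> (\<Sum>j. ennreal (haus_term 0 (C j)))" by (rule sum_le_suminf) auto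
    finally show "1 \<le> (\<Sum>j. ennreal (haus_term 0 (C j)))" .
  qed
  then show False using hausdorff_zero_pre[OF assms, of 1] by simp
qed

text \<open>Covering sets may have diameter 0, while an open ball around one of their points should
  have radius larger than the diameter. Enlarging the s-th powers by summable amounts
  \<open>t i\<close> keeps the total small, and openness of the balls then gives a finite
  subcover.\<close>

lemma hausdorff_null_finite_cover:
  fixes K :: "'a::euclidean_space set"
  assumes K: "compact K" and s: "0 < s" and null: "hausdorff s K = 0" and \<kappa>: "0 < \<kappa>"
  obtains F :: "nat set" and x :: "nat \<Rightarrow> 'a" and r :: "nat \<Rightarrow> real"
  where "finite F" "\<And>i. 0 < r i" "\<And>i. r i \<le> 1" "K \<subseteq> (\<Union>i\<in>F. ball (x i) (r i))"
    "(\<Sum>i\<in>F. r i powr s) < \<kappa>"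
proof -
  define hc where "hc = haus_const s"
  have hc: "0 < hc" using s by (simp add: hc_def haus_const_def Gamma_real_pos)
  \<comment> \<open>\<open>hc / 2 powr s\<close> is the ratio of the normalised Hausdorff term to
    the plain power of the diameter.\<close>
  define \<kappa>' where "\<kappa>' = hc / 2 powr s * (\<kappa>/2)"
  have \<kappa>': "0 < \<kappa>'" using hc \<kappa> by (simp add: \<kappa>'_def)
  \<comment> \<open>Chosen so that \<open>\<delta> powr s = 1/2\<close>; together with
    \<open>t i \<le> 1/2\<close> this gives radii at most 1.\<close>
  define \<delta> where "\<delta> = (1/2::real) powr (1/s)"
  have \<delta>: "0 < \<delta>" by (simp add: \<delta>_def)
  have "hausdorff_pre s \<delta> K < ennreal \<kappa>'" using hausdorff_zero_pre[OF null \<delta>] \<kappa>' by simp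
  then obtain C :: "nat \<Rightarrow> 'a set" where C: "K \<subseteq> (\<Union>i. C i)" "\<And>i. bounded (C i)" "\<And>i. diameter (C i) \<le> \<delta>"
    "(\<Sum>i. ennreal (haus_term s (C i))) < ennreal \<kappa>'"
    unfolding hausdorff_pre_def INF_less_iff by auto
  define d where "d i = diameter (C i)" for i
  have d: "0 \<le> d i" for i using C(2) by (simp add: d_def diameter_ge_0)
  have ds: "d i powr s \<le> 1/2" for i
  proof -
    have "d i powr s \<le> \<delta> powr s" using C(3)[of i] d[of i] s by (intro powr_mono2) (auto simp: d_def)
    also have "\<dots> = 1/2" using s by (simp add: \<delta>_def powr_powr)
    finally show ?thesis .
  qed
  define c where "c = min (1/2) (\<kappa>/2)"
  have c: "0 < c" "c \<le> 1/2" "c \<le> \<kappa>/2" using \<kappa> by (auto simp: c_def)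
  \<comment> \<open>The powers \<open>(1/2) ^ Suc i\<close> sum to 1, so the enlargements sum to
    \<open>c \<le> \<kappa>/2\<close>.\<close>
  define t where "t i = c * (1/2) ^ Suc i" for i :: nat
  have t: "0 < t i" "t i \<le> 1/2" for i
  proof -
    show "0 < t i" using c by (simp add: t_def)
    have "t i \<le> c * 1" unfolding t_def using c by (intro mult_left_mono power_le_one) auto
    then show "t i \<le> 1/2" using c by simp
  qed
  define r where "r i = (d i powr s + t i) powr (1/s)" for i
  have rs: "r i powr s = d i powr s + t i" for i
    using s t(1)[of i] by (simp add: r_def powr_powr add_nonneg_pos less_imp_le)
  have rpos: "0 < r i" for i
  proof -
    have "0 < d i powr s + t i" using t(1)[of i] by (simp add: add_nonneg_pos)
    then show ?thesis by (simp add: r_def)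
  qed
  have r1: "r i \<le> 1" for i
  proof -
    have "r i \<le> 1 powr (1/s)" unfolding r_def
      using ds[of i] t[of i] s by (intro powr_mono2) (auto intro: add_nonneg_nonneg less_imp_le)
    then show ?thesis by simp
  qed
  have dr: "d i < r i" for i
  proof (rule ccontr)
    assume "\<not> d i < r i"
    then have "r i powr s \<le> d i powr s" using rpos[of i] s by (intro powr_mono2) auto
    then show False using rs[of i] t(1)[of i] by simp
  qed
  define x where "x i = (SOME y. y \<in> C i)" for i
  define J where "J = {i. C i \<noteq> {}}"
  have x: "x i \<in> C i" if "i \<in> J" for i using that some_in_eq by (auto simp: J_def x_def)
  have "K \<subseteq> (\<Union>i\<in>J. ball (x i) (r i))"
  proof
    fix y assume "y \<in> K"
    then obtain i where i: "y \<in> C i" using C(1) by blast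
    then have "i \<in> J" by (auto simp: J_def)
    moreover have "dist (x i) y \<le> d i"
      unfolding d_def by (rule diameter_bounded_bound[OF C(2) x[OF \<open>i \<in> J\<close>] i])
    ultimately show "y \<in> (\<Union>i\<in>J. ball (x i) (r i))" using dr[of i] by (intro UN_I[of i]) auto
  qed
  then obtain F where F: "F \<subseteq> J" "finite F" "K \<subseteq> (\<Union>i\<in>F. ball (x i) (r i))"
    using compactE_image[OF K, of J "\<lambda>i. ball (x i) (r i)"] by auto
  have "(\<Sum>i\<in>F. d i powr s) < \<kappa>/2"
  proof -
    have ht: "haus_term s (C i) = hc / 2 powr s * d i powr s" if "i \<in> F" for i
      using that F(1) s d[of i] by (auto simp: haus_term_def J_def hc_def d_def powr_divide)
    have "ennreal (\<Sum>i\<in>F. haus_term s (C i)) = (\<Sum>i\<in>F. ennreal (haus_term s (C i)))"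
      using hc by (subst sum_ennreal) (auto simp: ht)
    also have "\<dots> \<le> (\<Sum>i. ennreal (haus_term s (C i)))" by (rule sum_le_suminf) (use F in auto)
    also note C(4)
    finally have "(\<Sum>i\<in>F. haus_term s (C i)) < \<kappa>'"
      by (subst (asm) ennreal_less_iff) (auto simp: ht hc less_imp_le intro!: sum_nonneg mult_nonneg_nonneg divide_nonneg_nonneg)
    then have "hc / 2 powr s * (\<Sum>i\<in>F. d i powr s) < hc / 2 powr s * (\<kappa>/2)"
      by (simp add: ht \<kappa>'_def sum_distrib_left)
    then show ?thesis by (rule mult_left_less_imp_less) (use hc in simp)
  qed
  moreover have "(\<Sum>i\<in>F. t i) \<le> \<kappa>/2"
  proof -
    have sums: "t sums c" unfolding t_def
      using sums_mult[OF power_half_series, of c] by simp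
    have "(\<Sum>i\<in>F. t i) \<le> suminf t"
      by (rule sum_le_suminf) (use sums F t in \<open>auto simp: sums_iff less_imp_le\<close>)
    then show ?thesis using sums c by (simp add: sums_iff)
  qed
  ultimately have "(\<Sum>i\<in>F. r i powr s) < \<kappa>" by (simp add: rs sum.distrib)
  then show ?thesis using that F rpos r1 by blast
qed

section \<open>Lipschitz partitions subordinate to balls\<close>

text \<open>The balls are inserted by decreasing radius. Then the maximum of the bumps inserted so far is
  no steeper than the new bump, hence so is each increment of the maximum, regardless of how the balls overlap.\<close>

lemma lipschitz_partition:
  fixes x :: "'i \<Rightarrow> 'a::euclidean_space"
  assumes "finite F" "\<And>i. 0 < r i"
  shows "\<exists>\<theta> :: 'i \<Rightarrow> 'a \<Rightarrow> real.
    (\<forall>i\<in>F. \<forall>y. 0 \<le> \<theta> i y \<and> \<theta> i y \<le> 1 \<and> (2 * r i < dist (x i) y \<longrightarrow> \<theta> i y = 0)) \<and>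
    (\<forall>i\<in>F. \<forall>y z. \<bar>\<theta> i y - \<theta> i z\<bar> \<le> 2 / r i * norm (y - z)) \<and>
    (\<forall>y. (\<Sum>i\<in>F. \<theta> i y) \<le> 1) \<and> (\<forall>i\<in>F. \<forall>y. dist (x i) y \<le> r i \<longrightarrow> (\<Sum>i\<in>F. \<theta> i y) = 1) \<and>
    (\<forall>c\<ge>0. (\<forall>i\<in>F. 1 / r i \<le> c) \<longrightarrow> (\<forall>y z. \<bar>(\<Sum>i\<in>F. \<theta> i y) - (\<Sum>i\<in>F. \<theta> i z)\<bar> \<le> c * norm (y - z)))"
  using assms(1)
proof (induction rule: finite_ranking_induct[where f="\<lambda>i. - r i"])
  case empty
  show ?case by simp
next
  case (insert k F)
  show ?case
  proof (cases "k \<in> F")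
    case True
    then show ?thesis using insert.IH by (simp add: insert_absorb)
  next
    case False
    obtain \<theta> :: "'i \<Rightarrow> 'a \<Rightarrow> real" where
      h1: "\<forall>i\<in>F. \<forall>y. 0 \<le> \<theta> i y \<and> \<theta> i y \<le> 1 \<and> (2 * r i < dist (x i) y \<longrightarrow> \<theta> i y = 0)"
      and h2: "\<forall>i\<in>F. \<forall>y z. \<bar>\<theta> i y - \<theta> i z\<bar> \<le> 2 / r i * norm (y - z)"
      and h3: "\<forall>y. (\<Sum>i\<in>F. \<theta> i y) \<le> 1"
      and h4: "\<forall>i\<in>F. \<forall>y. dist (x i) y \<le> r i \<longrightarrow> (\<Sum>i\<in>F. \<theta> i y) = 1"
      and h5: "\<forall>c\<ge>0. (\<forall>i\<in>F. 1 / r i \<le> c) \<longrightarrow> (\<forall>y z. \<bar>(\<Sum>i\<in>F. \<theta> i y) - (\<Sum>i\<in>F. \<theta> i z)\<bar> \<le> c * norm (y - z))"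
      using insert.IH by (elim exE conjE) (rule that)
    have \<theta>: "\<And>i y. i \<in> F \<Longrightarrow> 0 \<le> \<theta> i y" "\<And>i y. i \<in> F \<Longrightarrow> \<theta> i y \<le> 1" "\<And>i y. i \<in> F \<Longrightarrow> 2 * r i < dist (x i) y \<Longrightarrow> \<theta> i y = 0"
        "\<And>i y z. i \<in> F \<Longrightarrow> \<bar>\<theta> i y - \<theta> i z\<bar> \<le> 2 / r i * norm (y - z)"
      using h1 h2 by blast+
    have le1: "\<And>y. (\<Sum>i\<in>F. \<theta> i y) \<le> 1"
      and eq1: "\<And>i y. i \<in> F \<Longrightarrow> dist (x i) y \<le> r i \<Longrightarrow> (\<Sum>i\<in>F. \<theta> i y) = 1"
      using h3 h4 by blast+
    have lip: "\<And>c y z. 0 \<le> c \<Longrightarrow> \<forall>i\<in>F. 1 / r i \<le> c \<Longrightarrow> \<bar>(\<Sum>i\<in>F. \<theta> i y) - (\<Sum>i\<in>F. \<theta> i z)\<bar> \<le> c * norm (y - z)"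
      using h5 by blast
    define S where "S y = (\<Sum>i\<in>F. \<theta> i y)" for y
    have S: "0 \<le> S y" "S y \<le> 1" for y using \<theta>(1) le1 by (auto simp: S_def sum_nonneg)
    define \<eta> where "\<eta> y = max 0 (min 1 (2 - dist (x k) y / r k))" for y
    have rk: "0 < r k" by (rule assms)
    have \<eta>: "0 \<le> \<eta> y" "\<eta> y \<le> 1" "2 * r k < dist (x k) y \<Longrightarrow> \<eta> y = 0" "dist (x k) y \<le> r k \<Longrightarrow> \<eta> y = 1" for y
      using rk by (auto simp: \<eta>_def field_simps)
    have \<eta>lip: "\<bar>\<eta> y - \<eta> z\<bar> \<le> 1 / r k * norm (y - z)" for y z
    proof -
      have "\<bar>dist (x k) y - dist (x k) z\<bar> \<le> norm (y - z)"
        using abs_dist_diff_le[of y "x k" z] by (simp add: dist_commute dist_norm)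
      then have "\<bar>dist (x k) y / r k - dist (x k) z / r k\<bar> \<le> 1 / r k * norm (y - z)"
        using rk by (simp add: diff_divide_distrib[symmetric] divide_right_mono)
      then show ?thesis unfolding \<eta>_def by linarith
    qed
    \<comment> \<open>\<open>k\<close> has the smallest radius so far, so \<open>1 / r k\<close> is
      an admissible \<open>c\<close>. Quantifying over \<open>c\<close> in the induction avoids a
      minimum over the possibly empty \<open>F\<close>.\<close>
    have Slip: "\<bar>S y - S z\<bar> \<le> 1 / r k * norm (y - z)" for y z
      unfolding S_def
    proof (rule lip)
      show "\<forall>i\<in>F. 1 / r i \<le> 1 / r k" using insert.hyps(2) rk by (auto intro!: divide_left_mono mult_pos_pos assms(2))
    qed (use rk in auto)
    \<comment> \<open>\<open>max 0 (\<eta> y - S y)\<close> is the increment from \<open>S\<close>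
      to \<open>max \<eta> S\<close>. Both \<open>\<eta>\<close> and \<open>S\<close> have Lipschitz
      constant \<open>1 / r k\<close>, whence the 2 in the bound for a piece.\<close>
    define \<theta>' where "\<theta>' i = (if i = k then (\<lambda>y. max 0 (\<eta> y - S y)) else \<theta> i)" for i
    have sum': "(\<Sum>i\<in>insert k F. \<theta>' i y) = max (\<eta> y) (S y)" for y
    proof -
      have "(\<Sum>i\<in>F. \<theta>' i y) = S y" unfolding S_def \<theta>'_def by (rule sum.cong) (use False in auto)
      then show ?thesis using False insert.hyps(1) by (simp add: \<theta>'_def max_def)
    qed
    show ?thesis
    proof (intro exI[of _ \<theta>'] conjI ballI allI impI)
      fix i y assume i: "i \<in> insert k F"
      show "0 \<le> \<theta>' i y" using i \<theta>(1) by (auto simp: \<theta>'_def)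
      show "\<theta>' i y \<le> 1" using i \<theta>(2) \<eta>(2)[of y] S(1)[of y] by (auto simp: \<theta>'_def)
      show "\<theta>' i y = 0" if "2 * r i < dist (x i) y"
        using i \<theta>(3)[of i y] \<eta>(3)[of y] S(1)[of y] that by (auto simp: \<theta>'_def)
      show "(\<Sum>i\<in>insert k F. \<theta>' i y) = 1" if "dist (x i) y \<le> r i"
        unfolding sum' using i \<eta>(2,4)[of y] S(2)[of y] eq1[of i y, folded S_def] that by auto
    next
      fix i y z assume i: "i \<in> insert k F"
      have "\<bar>max 0 (\<eta> y - S y) - max 0 (\<eta> z - S z)\<bar> \<le> 1 / r k * norm (y - z) + 1 / r k * norm (y - z)"
        using \<eta>lip[of y z] Slip[of y z] by linarith
      then show "\<bar>\<theta>' i y - \<theta>' i z\<bar> \<le> 2 / r i * norm (y - z)"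
        using i \<theta>(4)[of i y z] by (cases "i = k") (auto simp: \<theta>'_def)
    next
      fix y show "(\<Sum>i\<in>insert k F. \<theta>' i y) \<le> 1" unfolding sum' using \<eta>(2)[of y] S(2)[of y] by simp
    next
      fix c :: real and y z assume c: "0 \<le> c" "\<forall>i\<in>insert k F. 1 / r i \<le> c"
      have "\<bar>S y - S z\<bar> \<le> c * norm (y - z)" unfolding S_def by (rule lip) (use c in auto)
      moreover have "\<bar>\<eta> y - \<eta> z\<bar> \<le> c * norm (y - z)"
        using \<eta>lip[of y z] mult_right_mono[of "1 / r k" c "norm (y - z)"] c by auto
      ultimately show "\<bar>(\<Sum>i\<in>insert k F. \<theta>' i y) - (\<Sum>i\<in>insert k F. \<theta>' i z)\<bar> \<le> c * norm (y - z)"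
        unfolding sum' by linarith
    qed
  qed
qed

section \<open>Test fields\<close>

lemma test_field_bounds:
  assumes "test_field (\<phi> :: 'a::euclidean_space \<Rightarrow> 'a)"
  shows "\<exists>R L. 0 < R \<and> 0 < L \<and> (\<forall>x. R < norm x \<longrightarrow> \<phi> x = 0) \<and> (\<forall>x y. norm (\<phi> x - \<phi> y) \<le> L * norm (x - y))"
proof -
  have "bounded {x. \<phi> x \<noteq> 0}"
    using assms compact_imp_bounded[THEN bounded_subset, OF _ closure_subset] unfolding test_field_def by simp
  then obtain R where R: "0 < R" "\<And>x. \<phi> x \<noteq> 0 \<Longrightarrow> norm x \<le> R" by (auto simp: bounded_pos)
  have supp: "\<phi> x = 0" if "R < norm x" for x using R(2)[of x] that by force
  have "smooth_fun \<phi>" using assms by (simp add: test_field_def)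
  from smooth_compact_support_lipschitz[OF this supp]
  obtain L where "0 < L" "\<And>x y. norm (\<phi> x - \<phi> y) \<le> L * norm (x - y)" by blast
  then show ?thesis using R(1) supp by blast
qed

lemma test_field_lip_compact:
  assumes "test_field \<phi>"
  shows "lip_compact \<phi>"
proof -
  obtain R L where "0 < R" "0 < L" "\<forall>x. R < norm x \<longrightarrow> \<phi> x = 0" "\<forall>x y. norm (\<phi> x - \<phi> y) \<le> L * norm (x - y)"
    using test_field_bounds[OF assms] by blast
  then show ?thesis unfolding lip_compact_def using less_imp_le[of 0 L] by blast
qed

lemma test_fieldI:
  assumes "smooth_fun \<phi>" "\<And>x. R < norm x \<Longrightarrow> \<phi> x = 0"
  shows "test_field (\<phi> :: 'a::euclidean_space \<Rightarrow> 'a)"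
proof -
  have "{x. \<phi> x \<noteq> 0} \<subseteq> cball 0 R" using assms(2) by (force simp: not_le[symmetric])
  then have "compact (closure {x. \<phi> x \<noteq> 0})"
    using bounded_subset[OF bounded_cball] compact_closure by blast
  then show ?thesis using assms(1) by (simp add: test_field_def)
qed

section \<open>Linear operations on test fields\<close>

lemma Cdiff_scaleR: "Cdiff n f \<Longrightarrow> Cdiff n (\<lambda>x. c *\<^sub>R f x)"
proof (induction n arbitrary: f)
  case (Suc n)
  obtain D where D: "\<And>x. (f has_derivative D x) (at x)" "\<And>v. Cdiff n (\<lambda>x. D x v)"
    using Suc.prems by auto
  show ?case
    by (rule Cdiff_SucI[where D="\<lambda>x v. c *\<^sub>R D x v"]) (auto intro: has_derivative_scaleR_right D Suc.IH)
qed simp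

lemma test_field_add:
  assumes "test_field \<phi>" "test_field \<psi>"
  shows "test_field (\<lambda>x. \<phi> x + \<psi> x)"
proof -
  obtain R where R: "\<And>x. R < norm x \<Longrightarrow> \<phi> x = 0" using test_field_bounds[OF assms(1)] by blast
  obtain R' where R': "\<And>x. R' < norm x \<Longrightarrow> \<psi> x = 0" using test_field_bounds[OF assms(2)] by blast
  have "smooth_fun (\<lambda>x. \<phi> x + \<psi> x)"
    by (rule smooth_fun_if_Cdiff, rule Cdiff_add) (use assms in \<open>auto simp: test_field_def smooth_fun_Cdiff\<close>)
  then show ?thesis
    by (rule test_fieldI[where R="max R R'"]) (use R R' in auto)
qed

lemma test_field_scaleR:
  assumes "test_field \<phi>"
  shows "test_field (\<lambda>x. c *\<^sub>R \<phi> x)"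
proof -
  obtain R where R: "\<And>x. R < norm x \<Longrightarrow> \<phi> x = 0" using test_field_bounds[OF assms(1)] by blast
  have "smooth_fun (\<lambda>x. c *\<^sub>R \<phi> x)"
    by (rule smooth_fun_if_Cdiff, rule Cdiff_scaleR) (use assms in \<open>auto simp: test_field_def smooth_fun_Cdiff\<close>)
  then show ?thesis
    by (rule test_fieldI[where R=R]) (use R in auto)
qed

lemma test_field_diff: "test_field \<phi> \<Longrightarrow> test_field \<psi> \<Longrightarrow> test_field (\<lambda>x. \<phi> x - \<psi> x)"
  using test_field_add[of \<phi> "\<lambda>x. (-1) *\<^sub>R \<psi> x"] test_field_scaleR[of \<psi> "-1"] by simp

lemma test_field_zero: "test_field (\<lambda>x. 0)"
  by (rule test_fieldI[where R=0]) (rule smooth_fun_if_Cdiff, rule Cdiff_const, simp)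

lemma test_field_sum: "finite I \<Longrightarrow> (\<And>i. i \<in> I \<Longrightarrow> test_field (\<phi> i)) \<Longrightarrow> test_field (\<lambda>x. \<Sum>i\<in>I. \<phi> i x)"
  by (induction rule: finite_induct) (auto intro: test_field_add test_field_zero)

lemma test_field_smooth: "test_field \<phi> \<Longrightarrow> smooth_fun \<phi>"
  by (simp add: test_field_def)

lemma test_field_continuous: "test_field \<phi> \<Longrightarrow> continuous_on UNIV \<phi>"
  by (simp add: test_field_def smooth_fun_continuous)

lemma test_field_integrable_finite:
  assumes "test_field \<phi>" "sets M = sets borel" "finite_measure M"
  shows "integrable M \<phi>"
proof -
  interpret finite_measure M by fact
  show ?thesis
    by (rule lip_compact_integrable[OF test_field_lip_compact[OF assms(1)] assms(2)]) (simp add: less_top[symmetric])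
qed

section \<open>Null sets of measures controlled by additive functionals\<close>

text \<open>The optimal field is \<open>\<sigma>\<close> itself, whose pairing with
  \<open>\<sigma>\<close> is the total mass. It is approximated in L1 of \<open>\<mu>\<close> by a
  Lipschitz field, which is projected to the unit ball and then mollified.\<close>

lemma test_field_total_mass:
  fixes \<mu> :: "'a::euclidean_space measure" and \<sigma> :: "'a \<Rightarrow> 'a"
  assumes \<mu>: "sets \<mu> = sets borel" "finite_measure \<mu>" and \<sigma>: "\<sigma> \<in> borel_measurable \<mu>" "\<And>x. norm (\<sigma> x) = 1" and e: "0 < e"
  obtains \<Psi> where "test_field \<Psi>" "\<And>x. norm (\<Psi> x) \<le> 1" "measure \<mu> UNIV - e \<le> (LINT x|\<mu>. \<Psi> x \<bullet> \<sigma> x)"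
proof -
  interpret finite_measure \<mu> by fact
  have sp: "space \<mu> = UNIV" using sets_eq_imp_space_eq[OF \<mu>(1)] by simp
  have \<sigma>i: "integrable \<mu> \<sigma>"
    by (rule integrable_const_bound[where B=1]) (use \<sigma> in auto)
  obtain h :: "'a \<Rightarrow> 'a" where h: "lip_compact h" "(LINT x|\<mu>. norm (\<sigma> x - h x)) < e/2"
    using lip_compact_dense_finite[OF \<mu> \<sigma>i, of "e/2"] e by auto
  obtain L R where L: "0 \<le> L" "\<And>x y. norm (h x - h y) \<le> L * norm (x - y)" and R: "\<And>x. R < norm x \<Longrightarrow> h x = 0"
    using h(1) by (auto simp: lip_compact_def)
  \<comment> \<open>The projection is 1-Lipschitz and fixes 0 and the values of
    \<open>\<sigma>\<close>. So it keeps the Lipschitz bound and the compact support, and it does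
    not increase the distance to \<open>\<sigma>\<close>.\<close>
  let ?P = "closest_point (cball (0::'a) 1)"
  define k where "k x = ?P (h x)" for x
  have Pl: "norm (?P x - ?P y) \<le> norm (x - y)" for x y
    using closest_point_lipschitz[of "cball (0::'a) 1" x y] by (simp add: dist_norm)
  have Ps: "?P x = x" if "norm x \<le> 1" for x
    using that by (intro closest_point_self) simp
  have k1: "norm (k x) \<le> 1" for x
    using closest_point_in_set[of "cball (0::'a) 1" "h x"] by (simp add: k_def)
  have kL: "norm (k x - k y) \<le> L * norm (x - y)" for x y
    unfolding k_def using order_trans[OF Pl L(2)] .
  have kR: "k x = 0" if "R < norm x" for x using R[OF that] Ps[of 0] by (simp add: k_def)
  have k\<sigma>: "norm (\<sigma> x - k x) \<le> norm (\<sigma> x - h x)" for x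
    unfolding k_def using Pl[of "\<sigma> x" "h x"] Ps[of "\<sigma> x"] \<sigma>(2)[of x] by simp
  have ki: "integrable lborel k"
    by (rule integrable_continuous_compact_support[OF lipschitz_continuous[OF L(1) kL] kR])
  define m where "m = measure \<mu> UNIV"
  have m: "0 \<le> m" by (simp add: m_def)
  \<comment> \<open>Mollification at this radius moves \<open>k\<close> by at most
    \<open>L * \<epsilon>\<close> everywhere, which integrates to at most e/2.\<close>
  define \<epsilon> where "\<epsilon> = e / (2 * (L * m + 1))"
  have Lm: "0 < L * m + 1" using L m by (simp add: add_nonneg_pos)
  have \<epsilon>: "0 < \<epsilon>" using e Lm by (simp add: \<epsilon>_def)
  have Lem: "L * \<epsilon> * m \<le> e/2"
  proof -
    have "\<epsilon> * (L * m + 1) = e/2" using Lm by (simp add: \<epsilon>_def field_simps)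
    then show ?thesis using \<epsilon> by (simp add: algebra_simps)
  qed
  obtain \<rho> :: "'a \<Rightarrow> real" where \<rho>: "mollifier \<epsilon> \<rho>" using mollifier_exists[OF \<epsilon>] by blast
  define \<Psi> where "\<Psi> = conv \<rho> k"
  have t: "test_field \<Psi>" unfolding \<Psi>_def by (rule test_field_conv[OF \<rho> ki kR])
  have n1: "norm (\<Psi> x) \<le> 1" for x unfolding \<Psi>_def by (rule mollifier_conv_norm_le[OF \<rho>]) (use k1 in auto)
  have near: "norm (\<Psi> x - k x) \<le> L * \<epsilon>" for x unfolding \<Psi>_def
  proof (rule mollifier_conv_near[OF \<rho> ki])
    fix z :: 'a assume "norm z \<le> \<epsilon>"
    then have "L * norm z \<le> L * \<epsilon>" using L by (intro mult_left_mono)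
    then show "norm (k (x - z) - k x) \<le> L * \<epsilon>" using kL[of "x - z" x] by simp
  qed (use L \<epsilon> in auto)
  have hi: "integrable \<mu> h" by (rule lip_compact_integrable[OF h(1) \<mu>(1)]) (simp add: less_top[symmetric])
  have \<Psi>i: "integrable \<mu> \<Psi>" by (rule test_field_integrable_finite[OF t \<mu>])
  have "m - e \<le> (LINT x|\<mu>. 1 - norm (\<sigma> x - h x) - L * \<epsilon>)"
  proof -
    have "(LINT x|\<mu>. 1 - norm (\<sigma> x - h x) - L * \<epsilon>) = m - (LINT x|\<mu>. norm (\<sigma> x - h x)) - L * \<epsilon> * m"
      using \<sigma>i hi by (simp add: m_def sp)
    then show ?thesis using h(2) Lem by simp
  qed
  also have "\<dots> \<le> (LINT x|\<mu>. \<Psi> x \<bullet> \<sigma> x)"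
  proof (rule integral_mono)
    show "integrable \<mu> (\<lambda>x. 1 - norm (\<sigma> x - h x) - L * \<epsilon>)" using \<sigma>i hi by simp
    show "integrable \<mu> (\<lambda>x. \<Psi> x \<bullet> \<sigma> x)"
    proof (rule Bochner_Integration.integrable_bound[OF \<Psi>i])
      show "(\<lambda>x. \<Psi> x \<bullet> \<sigma> x) \<in> borel_measurable \<mu>" using \<Psi>i \<sigma> by measurable
      show "AE x in \<mu>. norm (\<Psi> x \<bullet> \<sigma> x) \<le> norm (\<Psi> x)"
        using Cauchy_Schwarz_ineq2[of "\<Psi> x" "\<sigma> x" for x] by (intro always_eventually allI) (simp add: \<sigma>(2))
    qed
    fix x
    have "\<sigma> x \<bullet> \<sigma> x = 1" using \<sigma>(2)[of x] by (simp add: dot_square_norm)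
    then have "\<Psi> x \<bullet> \<sigma> x = 1 - (\<sigma> x - \<Psi> x) \<bullet> \<sigma> x" by (simp add: inner_diff_left)
    moreover have "(\<sigma> x - \<Psi> x) \<bullet> \<sigma> x \<le> norm (\<sigma> x - \<Psi> x)"
      using norm_cauchy_schwarz[of "\<sigma> x - \<Psi> x" "\<sigma> x"] \<sigma>(2)[of x] by simp
    moreover have "norm (\<sigma> x - \<Psi> x) \<le> norm (\<sigma> x - h x) + L * \<epsilon>"
      using norm_triangle_ineq4[of "\<sigma> x - k x" "\<Psi> x - k x"] k\<sigma>[of x] near[of x] by simp
    ultimately show "1 - norm (\<sigma> x - h x) - L * \<epsilon> \<le> \<Psi> x \<bullet> \<sigma> x" by simp
  qed
  finally show ?thesis using that t n1 by (simp add: m_def)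
qed

text \<open>A scale-invariant class, with one constant \<open>L\<close> for all centres and radii.
  The support radius 3 r consists of 2 r for the bumps of the partition and at most r for their
  mollification.\<close>

definition scaled_field :: "real \<Rightarrow> 'a::euclidean_space \<Rightarrow> real \<Rightarrow> ('a \<Rightarrow> 'a) \<Rightarrow> bool" where
  "scaled_field L x r \<phi> \<longleftrightarrow> test_field \<phi> \<and> (\<forall>y. norm (\<phi> y) \<le> 1) \<and>
     (\<forall>y z. norm (\<phi> y - \<phi> z) \<le> L / r * norm (y - z)) \<and> (\<forall>y. 3 * r < norm (y - x) \<longrightarrow> \<phi> y = 0)"

text \<open>\<open>\<Psi>\<close> is the sum of its mollification error, of the remainder of the
  mollified field after subtraction of the pieces, and of the pieces. The first is uniformly small.
  The second vanishes on \<open>K\<close> and has norm at most 1, so domination gives exactly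
  \<open>\<mu> (-K)\<close>. The third is at most a constant times the covering sum.\<close>

lemma functional_bound_off_null_set:
  fixes \<mu> :: "'a::euclidean_space measure" and \<Lambda> :: "('a \<Rightarrow> 'a) \<Rightarrow> real"
  assumes \<mu>: "sets \<mu> = sets borel" "finite_measure \<mu>" and s: "0 < s"
    and K: "compact K" "hausdorff s K = 0"
    and add: "\<And>\<phi> \<psi>. test_field \<phi> \<Longrightarrow> test_field \<psi> \<Longrightarrow> \<Lambda> (\<lambda>x. \<phi> x + \<psi> x) = \<Lambda> \<phi> + \<Lambda> \<psi>"
    and bound: "\<And>\<phi>. test_field \<phi> \<Longrightarrow> \<bar>\<Lambda> \<phi>\<bar> \<le> (LINT x|\<mu>. norm (\<phi> x))"
    and scale: "\<And>L. 0 < L \<Longrightarrow> \<exists>C. \<forall>\<phi> x r. 0 < r \<longrightarrow> r \<le> 1 \<longrightarrow> scaled_field L x r \<phi> \<longrightarrow> \<bar>\<Lambda> \<phi>\<bar> \<le> C * r powr s"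
    and \<Psi>: "test_field \<Psi>" "\<And>x. norm (\<Psi> x) \<le> 1"
  shows "\<bar>\<Lambda> \<Psi>\<bar> \<le> measure \<mu> (- K)"
proof (rule field_le_epsilon)
  fix e :: real assume e: "0 < e"
  interpret finite_measure \<mu> by fact
  have sp: "space \<mu> = UNIV" using sets_eq_imp_space_eq[OF \<mu>(1)] by simp
  obtain R L where R: "\<forall>x. R < norm x \<longrightarrow> \<Psi> x = 0" and L: "0 < L" "\<forall>x y. norm (\<Psi> x - \<Psi> y) \<le> L * norm (x - y)"
    using test_field_bounds[OF \<Psi>(1)] by blast
  have \<Psi>c: "continuous_on UNIV \<Psi>" by (rule test_field_continuous[OF \<Psi>(1)])
  have \<Psi>i: "integrable lborel \<Psi>"
    by (rule integrable_continuous_compact_support[OF \<Psi>c]) (use R in auto)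
  \<comment> \<open>A piece, \<open>\<theta> i\<close> times \<open>\<Psi>\<close>, has Lipschitz
    constant at most 2/r + L, hence at most (2 + L)/r since r \<le> 1. So \<open>C\<close> depends
    on \<open>\<Psi>\<close> only, and the covering can be chosen after it.\<close>
  obtain C where C: "\<forall>\<phi> x r. 0 < r \<longrightarrow> r \<le> 1 \<longrightarrow> scaled_field (2 + L) x r \<phi> \<longrightarrow> \<bar>\<Lambda> \<phi>\<bar> \<le> C * r powr s"
    using scale[of "2 + L"] L by auto
  define C' where "C' = max C 0 + 1"
  have C': "0 < C'" "C \<le> C'" by (auto simp: C'_def)
  define \<kappa> where "\<kappa> = e / (2 * C')"
  have \<kappa>: "0 < \<kappa>" using e C' by (simp add: \<kappa>_def)
  obtain F :: "nat set" and x :: "nat \<Rightarrow> 'a" and r :: "nat \<Rightarrow> real"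
    where F: "finite F" and r: "\<And>i. 0 < r i" "\<And>i. r i \<le> 1" and cov: "K \<subseteq> (\<Union>i\<in>F. ball (x i) (r i))"
    and sum: "(\<Sum>i\<in>F. r i powr s) < \<kappa>"
    by (rule hausdorff_null_finite_cover[OF K(1) s K(2) \<kappa>]) (rule that)
  obtain \<theta> :: "nat \<Rightarrow> 'a \<Rightarrow> real" where
    \<theta>1: "\<forall>i\<in>F. \<forall>y. 0 \<le> \<theta> i y \<and> \<theta> i y \<le> 1 \<and> (2 * r i < dist (x i) y \<longrightarrow> \<theta> i y = 0)" and
    \<theta>2: "\<forall>i\<in>F. \<forall>y z. \<bar>\<theta> i y - \<theta> i z\<bar> \<le> 2 / r i * norm (y - z)" and
    \<theta>3: "\<forall>y. (\<Sum>i\<in>F. \<theta> i y) \<le> 1" and \<theta>4: "\<forall>i\<in>F. \<forall>y. dist (x i) y \<le> r i \<longrightarrow> (\<Sum>i\<in>F. \<theta> i y) = 1"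
    using lipschitz_partition[of F r x, OF F r(1)] by (elim exE conjE) (rule that)
  define S where "S y = (\<Sum>i\<in>F. \<theta> i y)" for y
  have S: "0 \<le> S y" "S y \<le> 1" for y using \<theta>1 \<theta>3 by (auto simp: S_def intro: sum_nonneg)
  have "open (\<Union>i\<in>F. ball (x i) (r i))" by auto
  then obtain d where d: "0 < d" "(\<Union>y\<in>K. ball y d) \<subseteq> (\<Union>i\<in>F. ball (x i) (r i))"
    using compact_subset_open_imp_ball_epsilon_subset[OF K(1) _ cov] by blast
  define m where "m = measure \<mu> UNIV"
  have m: "0 \<le> m" by (simp add: m_def)
  have Lm: "0 < L * m + 1" using L m by (simp add: add_nonneg_pos)
  \<comment> \<open>Three demands: averages around points of \<open>K\<close> stay in the union of
    the balls, the mollification error costs at most e/2, and supports of radius 2 r grow to at most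
    3 r.\<close>
  define \<epsilon> where "\<epsilon> = Min ({d / 2, e / (2 * (L * m + 1))} \<union> r ` F)"
  have \<epsilon>: "0 < \<epsilon>" unfolding \<epsilon>_def using F d e Lm r(1) by (subst Min_gr_iff) auto
  have \<epsilon>d: "\<epsilon> \<le> d/2" and \<epsilon>e: "\<epsilon> \<le> e / (2 * (L * m + 1))" and \<epsilon>r: "\<And>i. i \<in> F \<Longrightarrow> \<epsilon> \<le> r i"
    unfolding \<epsilon>_def by (rule Min_le; use F in blast)+
  have Lem: "L * \<epsilon> * m \<le> e/2"
  proof -
    have "\<epsilon> * (L * m + 1) \<le> e / (2 * (L * m + 1)) * (L * m + 1)" using \<epsilon>e Lm by (intro mult_right_mono) auto
    also have "\<dots> = e/2" using Lm by (simp add: field_simps)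
    finally show ?thesis using \<epsilon> by (simp add: algebra_simps)
  qed
  obtain \<rho> :: "'a \<Rightarrow> real" where \<rho>: "mollifier \<epsilon> \<rho>" using mollifier_exists[OF \<epsilon>] by blast
  define g where "g i y = \<theta> i y *\<^sub>R \<Psi> y" for i y
  have glip: "norm (g i y - g i z) \<le> (2 + L) / r i * norm (y - z)" if i: "i \<in> F" for i y z
  proof -
    have "g i y - g i z = (\<theta> i y - \<theta> i z) *\<^sub>R \<Psi> y + \<theta> i z *\<^sub>R (\<Psi> y - \<Psi> z)" by (simp add: g_def algebra_simps)
    also have "norm \<dots> \<le> \<bar>\<theta> i y - \<theta> i z\<bar> * norm (\<Psi> y) + \<bar>\<theta> i z\<bar> * norm (\<Psi> y - \<Psi> z)"
      using norm_triangle_ineq by (metis norm_scaleR)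
    also have "\<dots> \<le> (2 / r i * norm (y - z)) * 1 + 1 * (L * norm (y - z))"
      using i \<theta>1 \<theta>2 L \<Psi>(2) r(1)[of i] by (intro add_mono mult_mono) auto
    also have "\<dots> \<le> (2 / r i * norm (y - z)) + (L / r i * norm (y - z))"
    proof -
      have "L \<le> L / r i" using mult_left_le[of "r i" L] r[of i] L(1) by (simp add: pos_le_divide_eq)
      then have "L * norm (y - z) \<le> L / r i * norm (y - z)" by (rule mult_right_mono) simp
      then show ?thesis by simp
    qed
    also have "\<dots> = (2 + L) / r i * norm (y - z)" by (simp add: add_divide_distrib distrib_right)
    finally show ?thesis .
  qed
  have gR: "g i y = 0" if "R < norm y" for i y using R that by (simp add: g_def)
  have gi: "integrable lborel (g i)" if i: "i \<in> F" for i
    by (rule integrable_continuous_compact_support[OF lipschitz_continuous[OF _ glip[OF i]] gR])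
      (use L r(1)[of i] in auto)
  define \<phi> where "\<phi> i = conv \<rho> (g i)" for i
  have \<phi>t: "test_field (\<phi> i)" if "i \<in> F" for i
    unfolding \<phi>_def by (rule test_field_conv[OF \<rho> gi[OF that] gR])
  have \<phi>s: "scaled_field (2 + L) (x i) (r i) (\<phi> i)" if i: "i \<in> F" for i
    unfolding scaled_field_def
  proof (intro conjI allI impI)
    show "test_field (\<phi> i)" by (rule \<phi>t[OF i])
    have "norm (g i y) \<le> 1" for y
      using i \<theta>1 mult_mono[of "\<bar>\<theta> i y\<bar>" 1 "norm (\<Psi> y)" 1] \<Psi>(2)[of y] by (simp add: g_def)
    then show "norm (\<phi> i y) \<le> 1" for y
      unfolding \<phi>_def by (intro mollifier_conv_norm_le[OF \<rho>]) auto
    show "norm (\<phi> i y - \<phi> i z) \<le> (2 + L) / r i * norm (y - z)" for y z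
      unfolding \<phi>_def by (rule mollifier_conv_lipschitz[OF \<rho> gi[OF i] glip[OF i]])
    fix y assume y: "3 * r i < norm (y - x i)"
    have "norm (\<phi> i y) \<le> 0" unfolding \<phi>_def
    proof (rule mollifier_conv_norm_le[OF \<rho>])
      fix z :: 'a assume "norm z \<le> \<epsilon>"
      then have "2 * r i < norm ((y - x i) - z)" using y \<epsilon>r[OF i] norm_triangle_ineq2[of "y - x i" z] by simp
      then have "2 * r i < dist (x i) (y - z)" by (simp add: dist_norm norm_minus_commute algebra_simps)
      then show "norm (g i (y - z)) \<le> 0" using \<theta>1 i by (simp add: g_def)
    qed simp
    then show "\<phi> i y = 0" by simp
  qed
  \<comment> \<open>\<open>\<Psi>\<close> and the pieces share one mollifier, so the remainder is
    the mollification of \<open>(1 - S) \<Psi>\<close>. The latter is zero on a neighbourhood of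
    \<open>K\<close> wider than \<open>\<epsilon>\<close>, so the remainder vanishes on
    \<open>K\<close>.\<close>
  define \<Psi>' where "\<Psi>' = conv \<rho> \<Psi>"
  have \<Psi>'t: "test_field \<Psi>'" unfolding \<Psi>'_def by (rule test_field_conv[OF \<rho> \<Psi>i]) (use R in auto)
  have sumt: "test_field (\<lambda>y. \<Sum>i\<in>F. \<phi> i y)" by (rule test_field_sum[OF F \<phi>t])
  have \<Lambda>0: "\<Lambda> (\<lambda>_. 0) = 0" using add[OF test_field_zero test_field_zero] by simp
  \<comment> \<open>Differences come from additivity alone, applied to
    \<open>\<alpha> - \<beta>\<close> and \<open>\<beta>\<close>.\<close>
  have \<Lambda>diff: "\<Lambda> (\<lambda>x. \<alpha> x - \<beta> x) = \<Lambda> \<alpha> - \<Lambda> \<beta>" if "test_field \<alpha>" "test_field \<beta>" for \<alpha> \<beta>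
    using add[OF test_field_diff[OF that] that(2)] by simp
  have \<Lambda>sum: "\<Lambda> (\<lambda>y. \<Sum>i\<in>I. \<phi> i y) = (\<Sum>i\<in>I. \<Lambda> (\<phi> i))" if "finite I" "I \<subseteq> F" for I
    using that
  proof (induction rule: finite_induct)
    case (insert j I)
    then show ?case using add[of "\<phi> j" "\<lambda>y. \<Sum>i\<in>I. \<phi> i y"] \<phi>t test_field_sum[of I \<phi>] by (auto simp: subset_iff)
  qed (simp add: \<Lambda>0)
  have 1: "\<bar>\<Lambda> (\<lambda>y. \<Psi> y - \<Psi>' y)\<bar> \<le> e/2"
  proof -
    have near: "norm (\<Psi> y - \<Psi>' y) \<le> L * \<epsilon>" for y
    proof -
      have "norm (\<Psi>' y - \<Psi> y) \<le> L * \<epsilon>" unfolding \<Psi>'_def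
      proof (rule mollifier_conv_near[OF \<rho> \<Psi>i])
        fix z :: 'a assume "norm z \<le> \<epsilon>"
        then have "L * norm z \<le> L * \<epsilon>" using L by (intro mult_left_mono) auto
        then show "norm (\<Psi> (y - z) - \<Psi> y) \<le> L * \<epsilon>" using L(2)[rule_format, of "y - z" y] by simp
      qed (use L \<epsilon> in auto)
      then show ?thesis by (simp add: norm_minus_commute)
    qed
    have "\<bar>\<Lambda> (\<lambda>y. \<Psi> y - \<Psi>' y)\<bar> \<le> (LINT y|\<mu>. norm (\<Psi> y - \<Psi>' y))"
      by (rule bound[OF test_field_diff[OF \<Psi>(1) \<Psi>'t]])
    also have "\<dots> \<le> (LINT y|\<mu>. L * \<epsilon>)"
      by (rule integral_mono') (use near L \<epsilon> in auto)
    also have "\<dots> = L * \<epsilon> * m" by (simp add: m_def sp)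
    finally show ?thesis using Lem by simp
  qed
  have 2: "\<bar>\<Lambda> (\<lambda>y. \<Psi>' y - (\<Sum>i\<in>F. \<phi> i y))\<bar> \<le> measure \<mu> (- K)"
  proof -
    have gsi: "integrable lborel (\<lambda>y. \<Sum>i\<in>F. g i y)" using gi by (intro Bochner_Integration.integrable_sum) auto
    have eq: "\<Psi>' y - (\<Sum>i\<in>F. \<phi> i y) = conv \<rho> (\<lambda>y. (1 - S y) *\<^sub>R \<Psi> y) y" for y
    proof -
      have "\<Psi>' y - (\<Sum>i\<in>F. \<phi> i y) = conv \<rho> (\<lambda>y. \<Psi> y - (\<Sum>i\<in>F. g i y)) y"
        unfolding \<Psi>'_def \<phi>_def mollifier_conv_diff[OF \<rho> \<Psi>i gsi] by (simp add: mollifier_conv_sum[OF \<rho> gi])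
      also have "(\<lambda>y. \<Psi> y - (\<Sum>i\<in>F. g i y)) = (\<lambda>y. (1 - S y) *\<^sub>R \<Psi> y)"
        by (simp add: g_def S_def scaleR_diff_left scaleR_sum_left)
      finally show ?thesis .
    qed
    have le: "norm (\<Psi>' y - (\<Sum>i\<in>F. \<phi> i y)) \<le> indicator (- K) y" for y
    proof (cases "y \<in> K")
      case True
      have "norm (conv \<rho> (\<lambda>y. (1 - S y) *\<^sub>R \<Psi> y) y) \<le> 0"
      proof (rule mollifier_conv_norm_le[OF \<rho>])
        fix z :: 'a assume "norm z \<le> \<epsilon>"
        then have "y - z \<in> ball y d" using \<epsilon>d d(1) by (simp add: dist_norm)
        then have "y - z \<in> (\<Union>i\<in>F. ball (x i) (r i))" using d(2) True by blast
        then obtain i where "i \<in> F" "dist (x i) (y - z) \<le> r i" by (auto intro: less_imp_le)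
        then have "S (y - z) = 1" unfolding S_def using \<theta>4 by blast
        then show "norm ((1 - S (y - z)) *\<^sub>R \<Psi> (y - z)) \<le> 0" by simp
      qed simp
      then show ?thesis using True unfolding eq by simp
    next
      case False
      have "norm (conv \<rho> (\<lambda>y. (1 - S y) *\<^sub>R \<Psi> y) y) \<le> 1"
      proof (rule mollifier_conv_norm_le[OF \<rho>])
        fix z :: 'a
        show "norm ((1 - S (y - z)) *\<^sub>R \<Psi> (y - z)) \<le> 1"
          using S[of "y - z"] \<Psi>(2)[of "y - z"] mult_mono[of "\<bar>1 - S (y - z)\<bar>" 1 "norm (\<Psi> (y - z))" 1] by simp
      qed simp
      then show ?thesis using False unfolding eq by simp
    qed
    have Km: "- K \<in> sets \<mu>" using \<mu>(1) borel_compact[OF K(1)] by (simp add: borel_comp)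
    have "\<bar>\<Lambda> (\<lambda>y. \<Psi>' y - (\<Sum>i\<in>F. \<phi> i y))\<bar> \<le> (LINT y|\<mu>. norm (\<Psi>' y - (\<Sum>i\<in>F. \<phi> i y)))"
      by (rule bound[OF test_field_diff[OF \<Psi>'t sumt]])
    also have "\<dots> \<le> (LINT y|\<mu>. indicator (- K) y)"
      by (rule integral_mono') (use le Km in \<open>auto intro!: integrable_real_indicator simp: less_top[symmetric]\<close>)
    also have "\<dots> = measure \<mu> (- K)" using Km by simp
    finally show ?thesis .
  qed
  have 3: "\<bar>\<Lambda> (\<lambda>y. \<Sum>i\<in>F. \<phi> i y)\<bar> \<le> e/2"
  proof -
    have "\<bar>\<Lambda> (\<lambda>y. \<Sum>i\<in>F. \<phi> i y)\<bar> \<le> (\<Sum>i\<in>F. \<bar>\<Lambda> (\<phi> i)\<bar>)" unfolding \<Lambda>sum[OF F subset_refl] by (rule sum_abs)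
    also have "\<dots> \<le> (\<Sum>i\<in>F. C' * r i powr s)"
    proof (rule sum_mono)
      fix i assume i: "i \<in> F"
      have "\<bar>\<Lambda> (\<phi> i)\<bar> \<le> C * r i powr s" using C \<phi>s[OF i] r[of i] by blast
      also have "\<dots> \<le> C' * r i powr s" using C' by (intro mult_right_mono) auto
      finally show "\<bar>\<Lambda> (\<phi> i)\<bar> \<le> C' * r i powr s" .
    qed
    also have "\<dots> = C' * (\<Sum>i\<in>F. r i powr s)" by (simp add: sum_distrib_left)
    also have "\<dots> \<le> C' * \<kappa>" using sum C' by (intro mult_left_mono) auto
    also have "\<dots> = e/2" using C' by (simp add: \<kappa>_def)
    finally show ?thesis .
  qed
  have "\<Lambda> \<Psi> = \<Lambda> (\<lambda>y. \<Psi> y - \<Psi>' y) + \<Lambda> (\<lambda>y. \<Psi>' y - (\<Sum>i\<in>F. \<phi> i y)) + \<Lambda> (\<lambda>y. \<Sum>i\<in>F. \<phi> i y)"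
    unfolding \<Lambda>diff[OF \<Psi>(1) \<Psi>'t] \<Lambda>diff[OF \<Psi>'t sumt] by simp
  then show "\<bar>\<Lambda> \<Psi>\<bar> \<le> measure \<mu> (- K) + e" using 1 2 3 by linarith
qed

text \<open>Fields that almost attain the total mass turn \<open>le\<close> into
  \<open>\<mu> UNIV \<le> \<mu> (-K)\<close>, that is, \<open>\<mu> K = 0\<close> for compact
  subsets of the null set. For s = 0 only the empty set is null, which settles that case.\<close>

lemma abs_cont_hausdorffI:
  fixes \<mu> :: "'a::euclidean_space measure" and \<sigma> :: "'a \<Rightarrow> 'a"
  assumes \<mu>: "sets \<mu> = sets borel" "finite_measure \<mu>" and \<sigma>: "\<sigma> \<in> borel_measurable \<mu>" "\<And>x. norm (\<sigma> x) = 1"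
    and s: "0 \<le> s"
    and le: "\<And>K \<Psi>. 0 < s \<Longrightarrow> compact K \<Longrightarrow> hausdorff s K = 0 \<Longrightarrow> test_field \<Psi> \<Longrightarrow> (\<And>x. norm (\<Psi> x) \<le> 1) \<Longrightarrow>
      (LINT x|\<mu>. \<Psi> x \<bullet> \<sigma> x) \<le> measure \<mu> (- K)"
  shows "abs_cont_hausdorff \<mu> s"
  unfolding abs_cont_hausdorff_def
proof (intro ballI impI)
  interpret finite_measure \<mu> by fact
  have sp: "space \<mu> = UNIV" using sets_eq_imp_space_eq[OF \<mu>(1)] by simp
  fix B :: "'a set" assume B: "B \<in> sets borel" "hausdorff s B = 0"
  show "emeasure \<mu> B = 0"
  proof (cases "s = 0")
    case True
    then show ?thesis using hausdorff_zero_dim_null[of B] B by simp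
  next
    case False
    have "emeasure \<mu> K = 0" if K: "K \<subseteq> B" "compact K" for K
    proof -
      have h: "hausdorff s K = 0" using hausdorff_mono[OF K(1), of s] B(2) by simp
      have Km: "K \<in> sets \<mu>" using \<mu>(1) borel_compact[OF K(2)] by simp
      have "measure \<mu> UNIV \<le> measure \<mu> (- K) + e" if e: "0 < e" for e
      proof -
        obtain \<Psi> where \<Psi>: "test_field \<Psi>" "\<And>x. norm (\<Psi> x) \<le> 1" "measure \<mu> UNIV - e \<le> (LINT x|\<mu>. \<Psi> x \<bullet> \<sigma> x)"
          using test_field_total_mass[OF \<mu> \<sigma> e] by blast
        have "(LINT x|\<mu>. \<Psi> x \<bullet> \<sigma> x) \<le> measure \<mu> (- K)"
          by (rule le[OF _ K(2) h \<Psi>(1,2)]) (use False s in auto)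
        then show ?thesis using \<Psi>(3) by simp
      qed
      then have "measure \<mu> UNIV \<le> measure \<mu> (- K)" by (rule field_le_epsilon)
      moreover have "measure \<mu> (- K) = measure \<mu> UNIV - measure \<mu> K"
        using finite_measure_compl[OF Km] by (simp add: sp Compl_eq_Diff_UNIV)
      ultimately show ?thesis by (simp add: emeasure_eq_measure measure_le_0_iff)
    qed
    then show ?thesis
      unfolding inner_regular[OF \<mu>(1) _ B(1), simplified] by (auto intro!: antisym SUP_least)
  qed
qed

section \<open>Decay of the fractional divergence\<close>

abbreviation frac_kernel :: "real \<Rightarrow> ('a::euclidean_space \<Rightarrow> 'a) \<Rightarrow> 'a \<Rightarrow> 'a \<Rightarrow> real" where
  "frac_kernel \<alpha> \<phi> x y \<equiv> ((y - x) \<bullet> (\<phi> y - \<phi> x)) / norm (y - x) powr (real DIM('a) + \<alpha> + 1)"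

lemma frac_div_lborel:
  fixes \<phi> :: "'a::euclidean_space \<Rightarrow> 'a"
  assumes "continuous_on UNIV \<phi>"
  shows "frac_div \<alpha> \<phi> x = frac_const DIM('a) \<alpha> * (LINT y|lborel. frac_kernel \<alpha> \<phi> x y)"
proof -
  have [measurable]: "\<phi> \<in> borel_measurable borel" using assms by (rule borel_measurable_continuous_onI)
  have "(\<lambda>y. frac_kernel \<alpha> \<phi> x y) \<in> borel_measurable lborel" by measurable
  then show ?thesis unfolding frac_div_def by (simp add: integral_completion)
qed

lemma frac_kernel_abs_le:
  fixes \<phi> :: "'a::euclidean_space \<Rightarrow> 'a"
  shows "\<bar>frac_kernel \<alpha> \<phi> x y\<bar> \<le> norm (\<phi> y - \<phi> x) * norm (y - x) powr (-(real DIM('a) + \<alpha>))"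
proof (cases "y = x")
  case False
  then have n: "0 < norm (y - x)" by simp
  have "\<bar>frac_kernel \<alpha> \<phi> x y\<bar> \<le> (norm (y - x) * norm (\<phi> y - \<phi> x)) / norm (y - x) powr (real DIM('a) + \<alpha> + 1)"
    using Cauchy_Schwarz_ineq2[of "y - x" "\<phi> y - \<phi> x"] by (simp add: abs_divide divide_right_mono)
  also have "\<dots> = norm (\<phi> y - \<phi> x) * norm (y - x) powr (-(real DIM('a) + \<alpha>))"
    using n by (simp add: powr_add powr_minus powr_diff field_simps)
  finally show ?thesis .
qed simp

text \<open>Inside radius \<open>r\<close> the Lipschitz bound \<open>A\<close> lowers the
  singularity by one order, which makes it integrable as \<alpha> < 1; outside, the bound
  \<open>B\<close> on the oscillation leaves a tail that is integrable as \<alpha> > 0.\<close>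

definition frac_majorant :: "real \<Rightarrow> real \<Rightarrow> real \<Rightarrow> real \<Rightarrow> 'a::euclidean_space \<Rightarrow> real" where
  "frac_majorant \<alpha> A B r z = A * (indicator (ball 0 r) z * norm z powr (-(real DIM('a) + \<alpha> - 1))) +
     B * (indicator {z. r \<le> norm z} z * norm z powr (-(real DIM('a) + \<alpha>)))"

lemma frac_kernel_le_majorant:
  fixes \<phi> :: "'a::euclidean_space \<Rightarrow> 'a"
  assumes "norm (\<phi> y - \<phi> x) \<le> A * norm (y - x)" "norm (\<phi> y - \<phi> x) \<le> B"
  shows "norm (\<phi> y - \<phi> x) * norm (y - x) powr (-(real DIM('a) + \<alpha>)) \<le> frac_majorant \<alpha> A B r (y - x)"
proof (cases "norm (y - x) < r")
  case True
  show ?thesis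
  proof (cases "y = x")
    case False
    then have n: "0 < norm (y - x)" by simp
    have "norm (\<phi> y - \<phi> x) * norm (y - x) powr (-(real DIM('a) + \<alpha>)) \<le> (A * norm (y - x)) * norm (y - x) powr (-(real DIM('a) + \<alpha>))"
      using assms(1) by (rule mult_right_mono) simp
    also have "\<dots> = A * norm (y - x) powr (-(real DIM('a) + \<alpha> - 1))"
      using powr_mult_base[of "norm (y - x)" "-(real DIM('a) + \<alpha>)"] n by (simp add: algebra_simps)
    finally show ?thesis using True by (simp add: frac_majorant_def)
  qed (simp add: frac_majorant_def)
next
  case False
  then show ?thesis using mult_right_mono[OF assms(2), of "norm (y - x) powr (-(real DIM('a) + \<alpha>))"]
    by (simp add: frac_majorant_def)
qed

text \<open>For \<open>A = L / r\<close> and constant \<open>B\<close> the bound is of order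
  \<open>r powr (-\<alpha>)\<close>, the scaling of a derivative of order \<alpha>.\<close>

lemma frac_majorant_integral:
  assumes \<alpha>: "0 < \<alpha>" "\<alpha> < 1"
  obtains C1 C2 where "0 < C1" "0 < C2"
    "\<And>A B r. 0 < r \<Longrightarrow> integrable lborel (frac_majorant \<alpha> A B r :: 'a::euclidean_space \<Rightarrow> real)"
    "\<And>A B r. 0 < r \<Longrightarrow> 0 \<le> A \<Longrightarrow> 0 \<le> B \<Longrightarrow>
      (LINT z|lborel. frac_majorant \<alpha> A B r (z::'a)) \<le> (A * r * C1 + B * C2) * r powr (-\<alpha>)"
proof -
  let ?n = "real DIM('a)"
  have n: "1 \<le> ?n" using DIM_positive[where 'a='a] by linarith
  obtain C1 where C1: "0 < C1" "\<And>r. 0 < r \<Longrightarrow> integrable lborel (\<lambda>z::'a. indicator (ball 0 r) z * norm z powr (-(?n + \<alpha> - 1)))"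
    "\<And>r. 0 < r \<Longrightarrow> (LINT z|lborel. indicator (ball (0::'a) r) z * norm z powr (-(?n + \<alpha> - 1))) \<le> C1 * r powr (?n - (?n + \<alpha> - 1))"
  proof (rule powr_near_integral[where 'a='a, of "?n + \<alpha> - 1"])
    show "0 \<le> ?n + \<alpha> - 1" "?n + \<alpha> - 1 < ?n" using \<alpha> n by linarith+
  qed (rule that)
  obtain C2 where C2: "0 < C2" "\<And>r. 0 < r \<Longrightarrow> integrable lborel (\<lambda>z::'a. indicator {z. r \<le> norm z} z * norm z powr (-(?n + \<alpha>)))"
    "\<And>r. 0 < r \<Longrightarrow> (LINT z|lborel. indicator {z::'a. r \<le> norm z} z * norm z powr (-(?n + \<alpha>))) \<le> C2 * r powr (?n - (?n + \<alpha>))"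
    by (rule powr_far_integral[where 'a='a, of "?n + \<alpha>"]) (use \<alpha> in simp, rule that)
  show ?thesis
  proof (rule that[OF C1(1) C2(1)])
    fix A B r :: real assume r: "0 < r"
    show "integrable lborel (frac_majorant \<alpha> A B r :: 'a \<Rightarrow> real)"
      unfolding frac_majorant_def
      by (intro Bochner_Integration.integrable_add integrable_mult_right C1(2)[OF r] C2(2)[OF r])
    assume AB: "0 \<le> A" "0 \<le> B"
    have "(LINT z|lborel. frac_majorant \<alpha> A B r (z::'a)) =
       A * (LINT z|lborel. indicator (ball (0::'a) r) z * norm z powr (-(?n + \<alpha> - 1))) +
       B * (LINT z|lborel. indicator {z::'a. r \<le> norm z} z * norm z powr (-(?n + \<alpha>)))"
      unfolding frac_majorant_def
      by (subst Bochner_Integration.integral_add) (intro integrable_mult_right C1(2)[OF r] C2(2)[OF r] | simp)+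
    also have "\<dots> \<le> A * (C1 * r powr (?n - (?n + \<alpha> - 1))) + B * (C2 * r powr (?n - (?n + \<alpha>)))"
      by (intro add_mono mult_left_mono C1(3)[OF r] C2(3)[OF r] AB)
    also have "\<dots> = (A * r * C1 + B * C2) * r powr (-\<alpha>)"
    proof -
      have "r powr (?n - (?n + \<alpha> - 1)) = r * r powr (-\<alpha>)" using r by (simp add: powr_diff powr_minus field_simps)
      then show ?thesis by (simp add: algebra_simps)
    qed
    finally show "(LINT z|lborel. frac_majorant \<alpha> A B r (z::'a)) \<le> (A * r * C1 + B * C2) * r powr (-\<alpha>)" .
  qed
qed

text \<open>Profile of the fractional divergence of a field living at scale \<open>r\<close>: being
  nonlocal, it keeps a tail outside the support. The radius 6 r is twice the support radius, so a
  point beyond it is at least half its distance to the centre away from the support.\<close>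

definition decay_weight :: "real \<Rightarrow> real \<Rightarrow> 'a::euclidean_space \<Rightarrow> real" where
  "decay_weight \<alpha> r z = (if norm z < 6 * r then 1 else (r / norm z) powr (real DIM('a) + \<alpha>))"

lemma decay_weight_nonneg: "0 \<le> decay_weight \<alpha> r z"
  by (simp add: decay_weight_def)

lemma decay_weight_measurable [measurable]: "decay_weight \<alpha> r \<in> borel_measurable borel"
  unfolding decay_weight_def by measurable

lemma frac_div_decay:
  assumes \<alpha>: "0 < \<alpha>" "\<alpha> < 1" and L: "0 < L"
  obtains C where "0 < C" "\<And>\<phi> x0 r (x::'a::euclidean_space). 0 < r \<Longrightarrow> scaled_field L x0 r \<phi> \<Longrightarrow>
    \<bar>frac_div \<alpha> \<phi> x\<bar> \<le> C * r powr (-\<alpha>) * decay_weight \<alpha> r (x - x0)"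
proof -
  let ?n = "real DIM('a)"
  define c where "c = \<bar>frac_const DIM('a) \<alpha>\<bar>"
  have c: "0 \<le> c" by (simp add: c_def)
  define V where "V = unit_ball_vol ?n"
  have V: "0 \<le> V" by (simp add: V_def unit_ball_vol_nonneg)
  obtain C1 C2 where C12: "0 < C1" "0 < C2"
    and mi: "\<And>A B r. 0 < r \<Longrightarrow> integrable lborel (frac_majorant \<alpha> A B r :: 'a \<Rightarrow> real)"
    and mb: "\<And>A B r. 0 < r \<Longrightarrow> 0 \<le> A \<Longrightarrow> 0 \<le> B \<Longrightarrow>
      (LINT z|lborel. frac_majorant \<alpha> A B r (z::'a)) \<le> (A * r * C1 + B * C2) * r powr (-\<alpha>)"
    by (rule frac_majorant_integral[OF \<alpha>, where 'a='a]) (rule that)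
  \<comment> \<open>The sum of the constants of the near and the far regime; the final 1 ensures
    positivity, \<open>c\<close> being known here only as nonnegative.\<close>
  define C where "C = c * (L * C1 + 2 * C2) + c * (2 powr (?n + \<alpha>) * V * 3 ^ DIM('a)) + 1"
  have Cpos: "0 < C" unfolding C_def using c C12 L V by (intro add_nonneg_pos add_nonneg_nonneg mult_nonneg_nonneg) auto
  have "\<bar>frac_div \<alpha> \<phi> x\<bar> \<le> C * r powr (-\<alpha>) * decay_weight \<alpha> r (x - x0)"
    if r: "0 < r" and sf: "scaled_field L x0 r \<phi>" for \<phi> x0 r and x :: 'a
  proof -
    have \<phi>: "test_field \<phi>" "\<And>y. norm (\<phi> y) \<le> 1" "\<And>y z. norm (\<phi> y - \<phi> z) \<le> L / r * norm (y - z)"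
      "\<And>y. 3 * r < norm (y - x0) \<Longrightarrow> \<phi> y = 0" using sf by (auto simp: scaled_field_def)
    have fd: "\<bar>frac_div \<alpha> \<phi> x\<bar> \<le> c * (LINT y|lborel. \<bar>frac_kernel \<alpha> \<phi> x y\<bar>)"
      unfolding frac_div_lborel[OF test_field_continuous[OF \<phi>(1)]] abs_mult c_def[symmetric]
      by (intro mult_left_mono integral_abs_bound c)
    show ?thesis
    proof (cases "norm (x - x0) < 6 * r")
      case True
      have "(LINT y|lborel. \<bar>frac_kernel \<alpha> \<phi> x y\<bar>) \<le> (LINT y|lborel. frac_majorant \<alpha> (L / r) 2 r (- x + y))"
      proof (rule integral_mono')
        show "integrable lborel (\<lambda>y. frac_majorant \<alpha> (L / r) 2 r (- x + y))"
          by (rule lborel_integrable_translate[OF mi[OF r]])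
        fix y
        have "norm (\<phi> y - \<phi> x) \<le> 2" using norm_triangle_ineq4[of "\<phi> y" "\<phi> x"] \<phi>(2)[of x] \<phi>(2)[of y] by linarith
        from order_trans[OF frac_kernel_abs_le frac_kernel_le_majorant[OF \<phi>(3) this]]
        have "\<bar>frac_kernel \<alpha> \<phi> x y\<bar> \<le> frac_majorant \<alpha> (L / r) 2 r (y - x)" .
        then show "\<bar>frac_kernel \<alpha> \<phi> x y\<bar> \<le> frac_majorant \<alpha> (L / r) 2 r (- x + y)" by simp
      next
        fix y show "0 \<le> frac_majorant \<alpha> (L / r) 2 r (- x + y)" using L r by (simp add: frac_majorant_def)
      qed
      also have "\<dots> = (LINT y|lborel. frac_majorant \<alpha> (L / r) 2 r (y::'a))"
        by (rule lborel_integral_translate) (use borel_measurable_integrable[OF mi[OF r]] in simp)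
      also have "\<dots> \<le> (L / r * r * C1 + 2 * C2) * r powr (-\<alpha>)" by (rule mb[OF r]) (use L r in auto)
      finally have "c * (LINT y|lborel. \<bar>frac_kernel \<alpha> \<phi> x y\<bar>) \<le> c * ((L * C1 + 2 * C2) * r powr (-\<alpha>))"
        using c r by (intro mult_left_mono) auto
      also have "\<dots> \<le> C * r powr (-\<alpha>)"
        unfolding mult.assoc[symmetric] C_def using c V by (intro mult_right_mono) auto
      finally show ?thesis using fd True by (simp add: decay_weight_def)
    next
      case False
      define D where "D = norm (x - x0)"
      have D: "6 * r \<le> D" "0 < D" using False r by (auto simp: D_def)
      \<comment> \<open>Far from the centre there is no singularity: \<open>\<phi> x = 0\<close>,
        and only \<open>y\<close> in the support, at distance at least D/2 from \<open>x\<close>,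
        contribute.\<close>
      have \<phi>x: "\<phi> x = 0" by (rule \<phi>(4)) (use D r in \<open>simp add: D_def\<close>)
      have "(LINT y|lborel. \<bar>frac_kernel \<alpha> \<phi> x y\<bar>) \<le> (LINT y|lborel. (D/2) powr (-(?n + \<alpha>)) * indicator (cball x0 (3 * r)) y)"
      proof (rule integral_mono')
        show "integrable lborel (\<lambda>y. (D/2) powr (-(?n + \<alpha>)) * indicator (cball x0 (3 * r)) y)"
          using emeasure_lborel_cball_finite by (intro integrable_mult_right integrable_real_indicator) auto
        fix y
        show "\<bar>frac_kernel \<alpha> \<phi> x y\<bar> \<le> (D/2) powr (-(?n + \<alpha>)) * indicator (cball x0 (3 * r)) y"
        proof (cases "3 * r < norm (y - x0)")
          case True
          then show ?thesis using \<phi>(4)[OF True] \<phi>x by simp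
        next
          case False
          have "D/2 \<le> norm (y - x)"
            using norm_triangle_ineq2[of "x - x0" "y - x0"] False D by (simp add: D_def norm_minus_commute)
          then have "norm (y - x) powr (-(?n + \<alpha>)) \<le> (D/2) powr (-(?n + \<alpha>))"
            using D \<alpha> by (intro powr_mono2') auto
          then have "norm (\<phi> y - \<phi> x) * norm (y - x) powr (-(?n + \<alpha>)) \<le> 1 * (D/2) powr (-(?n + \<alpha>))"
            using \<phi>(2)[of y] \<phi>x by (intro mult_mono) auto
          with order_trans[OF frac_kernel_abs_le this]
          show ?thesis using False by (simp add: dist_norm norm_minus_commute)
        qed
      qed auto
      also have "\<dots> = (D/2) powr (-(?n + \<alpha>)) * (V * (3 * r) ^ DIM('a))"
        using r by (simp add: content_cball V_def)
      also have "\<dots> = (2 powr (?n + \<alpha>) * V * 3 ^ DIM('a)) * (r powr (-\<alpha>) * (r / D) powr (?n + \<alpha>))"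
      proof -
        have "(D/2) powr (-b) = 2 powr b * D powr (-b)" for b
          using D by (simp add: powr_divide powr_minus field_simps)
        then have "(D/2) powr (-(?n + \<alpha>)) = 2 powr (?n + \<alpha>) * D powr (-(?n + \<alpha>))" .
        moreover have "r powr (-\<alpha>) * (r / D) powr (?n + \<alpha>) = r ^ DIM('a) * D powr (-(?n + \<alpha>))"
        proof -
          have "(r / D) powr b = r powr b * D powr (-b)" for b
            using D r by (simp add: powr_divide powr_minus_divide)
          then have "r powr (-\<alpha>) * (r / D) powr (?n + \<alpha>) = (r powr (-\<alpha>) * r powr (?n + \<alpha>)) * D powr (-(?n + \<alpha>))"
            by (simp only: mult.assoc)
          also have "r powr (-\<alpha>) * r powr (?n + \<alpha>) = r powr ?n" by (subst powr_add[symmetric]) simp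
          finally show ?thesis using r by (simp add: powr_realpow)
        qed
        ultimately show ?thesis by (simp add: power_mult_distrib)
      qed
      finally have "c * (LINT y|lborel. \<bar>frac_kernel \<alpha> \<phi> x y\<bar>) \<le>
        c * ((2 powr (?n + \<alpha>) * V * 3 ^ DIM('a)) * (r powr (-\<alpha>) * (r / D) powr (?n + \<alpha>)))"
        using c by (rule mult_left_mono)
      also have "\<dots> \<le> C * (r powr (-\<alpha>) * (r / D) powr (?n + \<alpha>))"
        unfolding mult.assoc[of c, symmetric] C_def using c V C12 L by (intro mult_right_mono) auto
      finally show ?thesis using fd False by (simp add: decay_weight_def D_def mult.assoc)
    qed
  qed
  then show ?thesis using that Cpos by blast
qed

text \<open>The tail exponent (n + \<alpha>) q exceeds n, and scaling gives the power n of
  \<open>r\<close> with one constant for all centres. Up to the factor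
  \<open>r powr (-\<alpha>)\<close> this controls the fractional divergence in the dual Lebesgue
  space.\<close>

lemma decay_weight_integral:
  assumes \<alpha>: "0 < \<alpha>" and q: "1 \<le> q"
  obtains C where "0 < C" "\<And>r (x0::'a::euclidean_space). 0 < r \<Longrightarrow> integrable lborel (\<lambda>x. decay_weight \<alpha> r (x - x0) powr q)"
    "\<And>r (x0::'a). 0 < r \<Longrightarrow> (LINT x|lborel. decay_weight \<alpha> r (x - x0) powr q) \<le> C * r powr real DIM('a)"
proof -
  let ?n = "real DIM('a)"
  define b where "b = (?n + \<alpha>) * q"
  have "?n < ?n + \<alpha>" using \<alpha> by simp
  also have "\<dots> \<le> b" unfolding b_def using q \<alpha> mult_left_mono[of 1 q "?n + \<alpha>"] by simp
  finally have b: "?n < b" .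
  obtain C2 where C2: "0 < C2" "\<And>r. 0 < r \<Longrightarrow> integrable lborel (\<lambda>z::'a. indicator {z. r \<le> norm z} z * norm z powr (-b))"
    "\<And>r. 0 < r \<Longrightarrow> (LINT z|lborel. indicator {z::'a. r \<le> norm z} z * norm z powr (-b)) \<le> C2 * r powr (?n - b)"
    by (rule powr_far_integral[where 'a='a, of b]) (rule b, rule that)
  define V where "V = unit_ball_vol ?n"
  have V: "0 \<le> V" by (simp add: V_def unit_ball_vol_nonneg)
  define C where "C = V * 6 powr ?n + C2 * 6 powr (?n - b)"
  have Cpos: "0 < C" unfolding C_def using V C2(1) by (intro add_nonneg_pos) auto
  have main: "integrable lborel (\<lambda>z::'a. decay_weight \<alpha> r z powr q) \<and> (LINT z|lborel. decay_weight \<alpha> r (z::'a) powr q) \<le> C * r powr ?n"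
    if r: "0 < r" for r
  proof -
    have eq: "decay_weight \<alpha> r z powr q = indicator (ball 0 (6*r)) z + r powr b * (indicator {z. 6*r \<le> norm z} z * norm z powr (-b))" for z :: 'a
    proof (cases "norm z < 6 * r")
      case False
      then have "0 < norm z" using r by linarith
      then have "(r / norm z) powr b = r powr b * norm z powr (-b)"
        using r by (simp add: powr_divide powr_minus_divide)
      then show ?thesis using False
        by (simp add: decay_weight_def powr_powr b_def)
    qed (simp add: decay_weight_def)
    have i1: "integrable lborel (\<lambda>z::'a. indicator (ball 0 (6*r)) z :: real)"
      using emeasure_lborel_ball_finite by (intro integrable_real_indicator) auto
    have i2: "integrable lborel (\<lambda>z::'a. r powr b * (indicator {z. 6*r \<le> norm z} z * norm z powr (-b)))"
      using r by (intro integrable_mult_right C2(2)) auto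
    have "(LINT z|lborel. decay_weight \<alpha> r (z::'a) powr q) = measure lborel (ball (0::'a) (6*r)) +
       r powr b * (LINT z|lborel. indicator {z::'a. 6*r \<le> norm z} z * norm z powr (-b))"
      unfolding eq using i1 i2 by (subst Bochner_Integration.integral_add) auto
    also have "\<dots> \<le> V * (6*r) powr ?n + r powr b * (C2 * (6*r) powr (?n - b))"
      using r C2(3)[of "6*r"] by (intro add_mono mult_left_mono) (auto simp: content_ball V_def powr_realpow)
    also have "\<dots> = C * r powr ?n"
    proof -
      have "r powr b * (6*r) powr (?n - b) = 6 powr (?n - b) * r powr ?n"
        using r by (simp add: powr_mult powr_diff)
      then show ?thesis using r by (simp add: C_def powr_mult algebra_simps)
    qed
    finally show ?thesis using i1 i2 unfolding eq by auto
  qed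
  show ?thesis
  proof (rule that[OF Cpos])
    fix r :: real and x0 :: 'a assume r: "0 < r"
    show "integrable lborel (\<lambda>x. decay_weight \<alpha> r (x - x0) powr q)"
      using lborel_integrable_translate[OF conjunct1[OF main[OF r]], of "- x0"] by simp
    have "(LINT x|lborel. decay_weight \<alpha> r (- x0 + x) powr q) = (LINT x|lborel. decay_weight \<alpha> r (x::'a) powr q)"
      by (rule lborel_integral_translate) measurable
    then show "(LINT x|lborel. decay_weight \<alpha> r (x - x0) powr q) \<le> C * r powr ?n" using main[OF r] by simp
  qed
qed

text \<open>Instead of Hoelder's inequality, Young's inequality with the weight \<open>r powr (n / (P * Q))\<close>,
  for which both terms scale alike.\<close>

lemma frac_pairing_decay:
  fixes f :: "'a::euclidean_space \<Rightarrow> real"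
  assumes \<alpha>: "0 < \<alpha>" "\<alpha> < 1" and L: "0 < L" and p: "1 < p" and f: "Lp p f"
  shows "\<exists>C. \<forall>\<phi> x r. 0 < r \<longrightarrow> r \<le> 1 \<longrightarrow> scaled_field L x r \<phi> \<longrightarrow>
    \<bar>LINT x|lebesgue. f x * frac_div \<alpha> \<phi> x\<bar> \<le> C * r powr (real DIM('a) - \<alpha> - (if p = \<infinity> then 0 else real DIM('a) / enn2real p))"
proof -
  let ?n = "real DIM('a)"
  obtain C where C: "0 < C" "\<And>\<phi> x0 r (x::'a). 0 < r \<Longrightarrow> scaled_field L x0 r \<phi> \<Longrightarrow>
    \<bar>frac_div \<alpha> \<phi> x\<bar> \<le> C * r powr (-\<alpha>) * decay_weight \<alpha> r (x - x0)"
    by (rule frac_div_decay[OF \<alpha> L, where 'a='a]) (rule that)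
  show ?thesis
  proof (cases "p = \<infinity>")
    case True
    then obtain M where M: "AE x in lebesgue. \<bar>f x\<bar> \<le> M" using f by (auto simp: Lp_def)
    define M' where "M' = max M 0"
    have M': "AE x in lebesgue. \<bar>f x\<bar> \<le> M'" "0 \<le> M'" using M by (auto simp: M'_def elim!: eventually_mono)
    obtain E where E: "0 < E" "\<And>r (x0::'a). 0 < r \<Longrightarrow> integrable lborel (\<lambda>x. decay_weight \<alpha> r (x - x0) powr 1)"
      "\<And>r (x0::'a). 0 < r \<Longrightarrow> (LINT x|lborel. decay_weight \<alpha> r (x - x0) powr 1) \<le> E * r powr real DIM('a)"
      by (rule decay_weight_integral[OF \<alpha>(1), of 1, where 'a='a]) (simp, rule that)
    have "\<bar>LINT x|lebesgue. f x * frac_div \<alpha> \<phi> x\<bar> \<le> M' * C * E * r powr (?n - \<alpha>)"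
      if r: "0 < r" and sf: "scaled_field L x0 r \<phi>" for \<phi> x0 r
    proof -
      have wi: "integrable lborel (\<lambda>x. decay_weight \<alpha> r (x - x0))" using E(2)[OF r, of x0] by (simp add: decay_weight_nonneg)
      have "\<bar>LINT x|lebesgue. f x * frac_div \<alpha> \<phi> x\<bar> \<le> (LINT x|lebesgue. \<bar>f x * frac_div \<alpha> \<phi> x\<bar>)"
        by (rule integral_abs_bound)
      also have "\<dots> \<le> (LINT x|lebesgue. (M' * C * r powr (-\<alpha>)) * decay_weight \<alpha> r (x - x0))"
      proof (rule integral_mono_AE')
        show "integrable lebesgue (\<lambda>x. (M' * C * r powr (-\<alpha>)) * decay_weight \<alpha> r (x - x0))"
          using wi by (intro integrable_mult_right) (simp add: integrable_completion)
        show "AE x in lebesgue. \<bar>f x * frac_div \<alpha> \<phi> x\<bar> \<le> (M' * C * r powr (-\<alpha>)) * decay_weight \<alpha> r (x - x0)"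
          using M'(1)
        proof eventually_elim
          case (elim x)
          have "\<bar>f x\<bar> * \<bar>frac_div \<alpha> \<phi> x\<bar> \<le> M' * (C * r powr (-\<alpha>) * decay_weight \<alpha> r (x - x0))"
            by (intro mult_mono elim C(2)[OF r sf] M'(2)) simp
          then show ?case by (simp add: abs_mult mult.assoc)
        qed
        show "AE x in lebesgue. 0 \<le> (M' * C * r powr (-\<alpha>)) * decay_weight \<alpha> r (x - x0)"
          using M'(2) C(1) by (intro always_eventually allI mult_nonneg_nonneg decay_weight_nonneg) auto
      qed
      also have "\<dots> = (M' * C * r powr (-\<alpha>)) * (LINT x|lborel. decay_weight \<alpha> r (x - x0))"
        using wi by (simp add: integral_completion)
      also have "\<dots> \<le> (M' * C * r powr (-\<alpha>)) * (E * r powr ?n)"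
        using E(3)[OF r, of x0] M'(2) C(1) by (intro mult_left_mono) (auto simp: decay_weight_nonneg)
      also have "\<dots> = M' * C * E * r powr (?n - \<alpha>)" using r by (simp add: powr_diff powr_minus field_simps)
      finally show ?thesis .
    qed
    then show ?thesis using True by auto
  next
    case False
    define P where "P = enn2real p"
    \<comment> \<open>Strictness makes the conjugate exponent \<open>Q\<close> finite.\<close>
    have P: "1 < P"
    proof -
      have "ennreal P = p" using False unfolding P_def by (simp add: ennreal_enn2real_if less_top top.not_eq_extremum)
      then show ?thesis using p by (metis ennreal_1 ennreal_less_iff zero_le_one)
    qed
    define Q where "Q = P / (P - 1)"
    have Q: "1 < Q" "1/P + 1/Q = 1" using P by (auto simp: Q_def field_simps)
    have fi: "integrable lebesgue (\<lambda>x. \<bar>f x\<bar> powr P)" using f False by (simp add: Lp_def P_def)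
    define N where "N = (LINT x|lebesgue. \<bar>f x\<bar> powr P)"
    obtain E where E: "0 < E" "\<And>r (x0::'a). 0 < r \<Longrightarrow> integrable lborel (\<lambda>x. decay_weight \<alpha> r (x - x0) powr Q)"
      "\<And>r (x0::'a). 0 < r \<Longrightarrow> (LINT x|lborel. decay_weight \<alpha> r (x - x0) powr Q) \<le> E * r powr real DIM('a)"
      by (rule decay_weight_integral[OF \<alpha>(1), of Q, where 'a='a]) (use Q in simp, rule that)
    have "\<bar>LINT x|lebesgue. f x * frac_div \<alpha> \<phi> x\<bar> \<le> C * (N + E) * r powr (?n - \<alpha> - ?n / P)"
      if r: "0 < r" and sf: "scaled_field L x0 r \<phi>" for \<phi> x0 r
    proof -
      define l where "l = r powr (?n / (P * Q))"
      have l: "0 < l" using r by (simp add: l_def)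
      have lP: "l powr P = r powr (?n / Q)" and lQ: "(1/l) powr Q = r powr (- (?n / P))"
      proof -
        have "?n / (P * Q) * P = ?n / Q" "?n / (P * Q) * Q = ?n / P" using P Q(1) by auto
        then show "l powr P = r powr (?n / Q)" "(1/l) powr Q = r powr (- (?n / P))"
          using l by (simp_all add: l_def powr_powr powr_divide powr_minus_divide)
      qed
      have wi: "integrable lborel (\<lambda>x. decay_weight \<alpha> r (x - x0) powr Q)" by (rule E(2)[OF r])
      have wiL: "integrable lebesgue (\<lambda>x. decay_weight \<alpha> r (x - x0) powr Q)" using wi by (simp add: integrable_completion)
      have young: "\<bar>f x\<bar> * decay_weight \<alpha> r (x - x0) \<le> r powr (?n / Q) * \<bar>f x\<bar> powr P + r powr (- (?n / P)) * decay_weight \<alpha> r (x - x0) powr Q" for x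
      proof -
        have "\<bar>f x\<bar> * decay_weight \<alpha> r (x - x0) = (l * \<bar>f x\<bar>) * ((1/l) * decay_weight \<alpha> r (x - x0))" using l by simp
        also have "\<dots> \<le> (l * \<bar>f x\<bar>) powr P / P + ((1/l) * decay_weight \<alpha> r (x - x0)) powr Q / Q"
          by (rule Youngs_inequality) (use P Q l decay_weight_nonneg[of \<alpha> r "x - x0"] in auto)
        also have "\<dots> \<le> (l * \<bar>f x\<bar>) powr P + ((1/l) * decay_weight \<alpha> r (x - x0)) powr Q"
        proof -
          have d: "t / u \<le> t" if "1 < u" "0 \<le> t" for t u :: real using that by (simp add: divide_le_eq mult_le_cancel_left1)
          show ?thesis by (intro add_mono d P Q) auto
        qed
        also have "\<dots> = r powr (?n / Q) * \<bar>f x\<bar> powr P + r powr (- (?n / P)) * decay_weight \<alpha> r (x - x0) powr Q"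
        proof -
          have "((1/l) * decay_weight \<alpha> r (x - x0)) powr Q = (1/l) powr Q * decay_weight \<alpha> r (x - x0) powr Q"
            "(l * \<bar>f x\<bar>) powr P = l powr P * \<bar>f x\<bar> powr P"
            using l decay_weight_nonneg[of \<alpha> r "x - x0"] by (intro powr_mult; simp)+
          then show ?thesis unfolding lP lQ by simp
        qed
        finally show ?thesis .
      qed
      have "\<bar>LINT x|lebesgue. f x * frac_div \<alpha> \<phi> x\<bar> \<le> (LINT x|lebesgue. \<bar>f x * frac_div \<alpha> \<phi> x\<bar>)"
        by (rule integral_abs_bound)
      also have "\<dots> \<le> (LINT x|lebesgue. (C * r powr (-\<alpha>)) * (r powr (?n / Q) * \<bar>f x\<bar> powr P + r powr (- (?n / P)) * decay_weight \<alpha> r (x - x0) powr Q))"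
      proof (rule integral_mono')
        show "integrable lebesgue (\<lambda>x. (C * r powr (-\<alpha>)) * (r powr (?n / Q) * \<bar>f x\<bar> powr P + r powr (- (?n / P)) * decay_weight \<alpha> r (x - x0) powr Q))"
          by (intro integrable_mult_right Bochner_Integration.integrable_add fi wiL)
        fix x
        have "\<bar>f x\<bar> * \<bar>frac_div \<alpha> \<phi> x\<bar> \<le> \<bar>f x\<bar> * (C * r powr (-\<alpha>) * decay_weight \<alpha> r (x - x0))"
          by (intro mult_left_mono C(2)[OF r sf]) simp
        also have "\<dots> = (C * r powr (-\<alpha>)) * (\<bar>f x\<bar> * decay_weight \<alpha> r (x - x0))" by simp
        also have "\<dots> \<le> (C * r powr (-\<alpha>)) * (r powr (?n / Q) * \<bar>f x\<bar> powr P + r powr (- (?n / P)) * decay_weight \<alpha> r (x - x0) powr Q)"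
          using C(1) by (intro mult_left_mono young) auto
        finally show "\<bar>f x * frac_div \<alpha> \<phi> x\<bar> \<le> (C * r powr (-\<alpha>)) * (r powr (?n / Q) * \<bar>f x\<bar> powr P + r powr (- (?n / P)) * decay_weight \<alpha> r (x - x0) powr Q)"
          by (simp add: abs_mult)
      qed (use C(1) in auto)
      also have "\<dots> = (C * r powr (-\<alpha>)) * (r powr (?n / Q) * N + r powr (- (?n / P)) * (LINT x|lebesgue. decay_weight \<alpha> r (x - x0) powr Q))"
        using fi wiL unfolding N_def by (subst integral_mult_right_zero, subst Bochner_Integration.integral_add) auto
      also have "(LINT x|lebesgue. decay_weight \<alpha> r (x - x0) powr Q) = (LINT x|lborel. decay_weight \<alpha> r (x - x0) powr Q)"
        by (rule integral_completion) simp
      also have "(C * r powr (-\<alpha>)) * (r powr (?n / Q) * N + r powr (- (?n / P)) * (LINT x|lborel. decay_weight \<alpha> r (x - x0) powr Q))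
         \<le> (C * r powr (-\<alpha>)) * (r powr (?n / Q) * N + r powr (- (?n / P)) * (E * r powr ?n))"
        using C(1) E(3)[OF r, of x0] by (intro mult_left_mono add_left_mono) auto
      \<comment> \<open>Since n/Q = n - n/P, both Young terms are of order r^(n - n/P); the
        remaining r^(-\<alpha>) comes from the fractional divergence.\<close>
      also have "\<dots> = C * (N + E) * r powr (?n - \<alpha> - ?n / P)"
      proof -
        have nq: "?n / Q = ?n - ?n / P" using P by (simp add: Q_def field_simps)
        have "r powr (- (?n / P)) * r powr ?n = r powr (?n - ?n / P)" using r by (simp add: powr_add[symmetric])
        moreover have "r powr (-\<alpha>) * r powr (?n - ?n / P) = r powr (?n - \<alpha> - ?n / P)"
          using r by (simp add: powr_add[symmetric] algebra_simps)
        ultimately show ?thesis unfolding nq by (simp add: algebra_simps)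
      qed
      finally show ?thesis .
    qed
    then show ?thesis using False unfolding P_def by auto
  qed
qed

section \<open>The divergence of a test field\<close>

text \<open>The trace of the derivative. \<open>frechet_derivative\<close> makes it a function of
  the field alone, and \<open>div_field_eq\<close> evaluates it from any known derivative.\<close>

definition div_field :: "('a::euclidean_space \<Rightarrow> 'a) \<Rightarrow> 'a \<Rightarrow> real" where
  "div_field \<phi> x = (\<Sum>b\<in>Basis. frechet_derivative \<phi> (at x) b \<bullet> b)"

lemma div_field_eq: "(\<phi> has_derivative D) (at x) \<Longrightarrow> div_field \<phi> x = (\<Sum>b\<in>Basis. D b \<bullet> b)"
  unfolding div_field_def using frechet_derivative_at by fastforce

lemma test_field_derivative:
  assumes "test_field \<phi>"
  shows "\<exists>D. (\<forall>x. (\<phi> has_derivative D x) (at x)) \<and> (\<forall>v. continuous_on UNIV (\<lambda>x. D x v))"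
  using smooth_fun_derivative[OF test_field_smooth[OF assms]] smooth_fun_continuous by blast

lemma div_field_continuous:
  assumes "test_field \<phi>"
  shows "continuous_on UNIV (div_field \<phi>)"
proof -
  obtain D where D: "\<forall>x. (\<phi> has_derivative D x) (at x)" "\<forall>v. continuous_on UNIV (\<lambda>x. D x v)"
    using test_field_derivative[OF assms] by blast
  have "div_field \<phi> = (\<lambda>x. \<Sum>b\<in>Basis. D x b \<bullet> b)" using D(1) div_field_eq by blast
  then show ?thesis using D(2) by (auto intro!: continuous_intros)
qed

lemma div_field_measurable: "test_field \<phi> \<Longrightarrow> div_field \<phi> \<in> borel_measurable borel"
  by (intro borel_measurable_continuous_onI div_field_continuous)

lemma div_field_zero:
  assumes "test_field \<phi>" "\<And>y. y \<notin> S \<Longrightarrow> \<phi> y = 0" "closed S" "x \<notin> S"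
  shows "div_field \<phi> x = 0"
proof -
  obtain D where D: "\<forall>x. (\<phi> has_derivative D x) (at x)"
    using test_field_derivative[OF assms(1)] by blast
  have "D x v = 0" for v using deriv_zero_outside_support[OF D[rule_format]] assms by blast
  then show ?thesis using div_field_eq[OF D[rule_format, of x]] by simp
qed

lemma div_field_add:
  assumes "test_field \<phi>" "test_field \<psi>"
  shows "div_field (\<lambda>x. \<phi> x + \<psi> x) x = div_field \<phi> x + div_field \<psi> x"
proof -
  obtain D where D: "\<forall>x. (\<phi> has_derivative D x) (at x)"
    using test_field_derivative[OF assms(1)] by blast
  obtain E where E: "\<forall>x. (\<psi> has_derivative E x) (at x)"
    using test_field_derivative[OF assms(2)] by blast
  have "((\<lambda>x. \<phi> x + \<psi> x) has_derivative (\<lambda>v. D x v + E x v)) (at x)" using D E by (intro has_derivative_add) auto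
  from div_field_eq[OF this] div_field_eq[OF D[rule_format, of x]] div_field_eq[OF E[rule_format, of x]]
  show ?thesis by (simp add: inner_add_left sum.distrib)
qed

lemma div_field_bound:
  fixes \<phi> :: "'a::euclidean_space \<Rightarrow> 'a"
  assumes "test_field \<phi>" "\<And>y z. norm (\<phi> y - \<phi> z) \<le> L * norm (y - z)"
  shows "\<bar>div_field \<phi> x\<bar> \<le> real DIM('a) * L"
proof -
  obtain D where D: "\<forall>x. (\<phi> has_derivative D x) (at x)"
    using test_field_derivative[OF assms(1)] by blast
  have "\<bar>D x b \<bullet> b\<bar> \<le> L" if b: "b \<in> Basis" for b
  proof -
    have "((\<lambda>t. x + t *\<^sub>R b) has_derivative (\<lambda>t. t *\<^sub>R b)) (at 0)" by (auto intro!: derivative_eq_intros)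
    moreover have "(\<phi> has_derivative D x) (at (x + 0 *\<^sub>R b))" using D by simp
    ultimately have "((\<lambda>t. \<phi> (x + t *\<^sub>R b)) has_derivative (\<lambda>t. D x (t *\<^sub>R b))) (at 0)"
      by (rule has_derivative_compose)
    then have "((\<lambda>t. \<phi> (x + t *\<^sub>R b) \<bullet> b) has_derivative (\<lambda>t. D x (t *\<^sub>R b) \<bullet> b)) (at 0)"
      by (rule has_derivative_inner_left)
    moreover have "D x (t *\<^sub>R b) \<bullet> b = (D x b \<bullet> b) * t" for t
      using linear_scale[OF bounded_linear.linear[OF has_derivative_bounded_linear[OF D[rule_format, of x]]]] by simp
    ultimately have "((\<lambda>t. \<phi> (x + t *\<^sub>R b) \<bullet> b) has_real_derivative D x b \<bullet> b) (at 0)"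
      by (simp add: has_field_derivative_def)
    then have "((\<lambda>t. (\<phi> (x + t *\<^sub>R b) \<bullet> b - \<phi> x \<bullet> b) / t) \<longlongrightarrow> D x b \<bullet> b) (at 0)"
      by (simp add: has_field_derivative_iff)
    then have "norm (D x b \<bullet> b) \<le> L"
    proof (rule Lim_norm_ubound[rotated])
      show "\<forall>\<^sub>F t in at 0. norm ((\<phi> (x + t *\<^sub>R b) \<bullet> b - \<phi> x \<bullet> b) / t) \<le> L"
        unfolding eventually_at_filter
      proof (intro always_eventually allI impI)
        fix t :: real assume "t \<noteq> 0"
        have "\<bar>(\<phi> (x + t *\<^sub>R b) - \<phi> x) \<bullet> b\<bar> \<le> L * \<bar>t\<bar>"
          using order_trans[OF Basis_le_norm[OF b] assms(2)[of "x + t *\<^sub>R b" x]] b by simp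
        then show "norm ((\<phi> (x + t *\<^sub>R b) \<bullet> b - \<phi> x \<bullet> b) / t) \<le> L"
          using \<open>t \<noteq> 0\<close> by (simp add: inner_diff_left divide_le_eq)
      qed
    qed simp
    then show ?thesis by simp
  qed
  then have "\<bar>\<Sum>b\<in>Basis. D x b \<bullet> b\<bar> \<le> (\<Sum>b\<in>(Basis::'a set). L)"
    by (intro order_trans[OF sum_abs] sum_mono)
  then show ?thesis using div_field_eq[OF D[rule_format, of x]] by simp
qed

text \<open>Compact support comes from the field, while \<open>k\<close> may be any C1 function.
  Each coordinate contributes a directional derivative of the compactly supported
  \<open>k y * (\<phi> y \<bullet> b)\<close>, whose integral vanishes.\<close>

lemma integration_by_parts:
  fixes k :: "'a::euclidean_space \<Rightarrow> real"
  assumes \<phi>: "test_field \<phi>" and k: "\<And>y. (k has_derivative K y) (at y)" "\<And>v. continuous_on UNIV (\<lambda>y. K y v)"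
  shows "(LINT y|lborel. k y * div_field \<phi> y) = - (LINT y|lborel. K y (\<phi> y))"
    "integrable lborel (\<lambda>y. k y * div_field \<phi> y)" "integrable lborel (\<lambda>y. K y (\<phi> y))"
proof -
  obtain D where D: "\<forall>x. (\<phi> has_derivative D x) (at x)" "\<forall>v. continuous_on UNIV (\<lambda>x. D x v)"
    using test_field_derivative[OF \<phi>] by blast
  obtain R where R: "\<forall>x. R < norm x \<longrightarrow> \<phi> x = 0" using test_field_bounds[OF \<phi>] by blast
  have kc: "continuous_on UNIV k" by (rule continuous_if_has_derivative[OF k(1)])
  have \<phi>c: "continuous_on UNIV \<phi>" by (rule test_field_continuous[OF \<phi>])
  have Klin: "linear (K y)" for y using k(1) has_derivative_bounded_linear bounded_linear.linear by blast
  have K\<phi>: "K y (\<phi> y) = (\<Sum>b\<in>Basis. K y b * (\<phi> y \<bullet> b))" for y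
    using linear_sum[OF Klin[of y], of "\<lambda>b. (\<phi> y \<bullet> b) *\<^sub>R b" Basis] linear_scale[OF Klin[of y]]
    by (simp add: euclidean_representation mult.commute)
  have Dsupp: "D y v = 0" if "R < norm y" for y v
    by (rule deriv_zero_outside_support[OF D(1)[rule_format], of "cball 0 R"]) (use R that in auto)
  have div: "div_field \<phi> = (\<lambda>x. \<Sum>b\<in>Basis. D x b \<bullet> b)" using D(1) div_field_eq by blast
  show i1: "integrable lborel (\<lambda>y. k y * div_field \<phi> y)"
    by (rule integrable_continuous_compact_support[where R=R])
      (use kc div_field_continuous[OF \<phi>] in \<open>auto intro!: continuous_intros simp: div Dsupp\<close>)
  show i2: "integrable lborel (\<lambda>y. K y (\<phi> y))"
    unfolding K\<phi> by (rule integrable_continuous_compact_support[where R=R])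
      (use k(2) \<phi>c R in \<open>auto intro!: continuous_intros\<close>)
  have z: "(LINT y|lborel. k y * (D y b \<bullet> b) + K y b * (\<phi> y \<bullet> b)) = 0" for b
  proof (rule integral_directional_derivative_zero[where F="\<lambda>y. k y * (\<phi> y \<bullet> b)" and
      D="\<lambda>y v. k y * (D y v \<bullet> b) + K y v * (\<phi> y \<bullet> b)" and v=b and R=R])
    show "((\<lambda>y. k y * (\<phi> y \<bullet> b)) has_derivative (\<lambda>v. k y * (D y v \<bullet> b) + K y v * (\<phi> y \<bullet> b))) (at y)" for y
      using D(1) by (intro has_derivative_mult k(1) has_derivative_inner_left) auto
    show "continuous_on UNIV (\<lambda>y. k y * (D y b \<bullet> b) + K y b * (\<phi> y \<bullet> b))"
      using D(2) k(2) kc \<phi>c by (intro continuous_intros) auto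
  qed (use R in auto)
  have zi: "integrable lborel (\<lambda>y. k y * (D y b \<bullet> b) + K y b * (\<phi> y \<bullet> b))" for b
    by (rule integrable_continuous_compact_support[where R=R])
      (use D(2) k(2) kc \<phi>c R in \<open>auto intro!: continuous_intros simp: Dsupp\<close>)
  have "0 = (LINT y|lborel. (\<Sum>b\<in>Basis. k y * (D y b \<bullet> b) + K y b * (\<phi> y \<bullet> b)))"
    using zi z by (subst Bochner_Integration.integral_sum) auto
  also have "\<dots> = (LINT y|lborel. k y * div_field \<phi> y + K y (\<phi> y))"
    by (simp add: div K\<phi> sum.distrib sum_distrib_left)
  also have "\<dots> = (LINT y|lborel. k y * div_field \<phi> y) + (LINT y|lborel. K y (\<phi> y))"
    using i1 i2 by (rule Bochner_Integration.integral_add)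
  finally show "(LINT y|lborel. k y * div_field \<phi> y) = - (LINT y|lborel. K y (\<phi> y))" by simp
qed

section \<open>The fractional divergence as a Riesz potential of the divergence\<close>

lemma powr_sq_norm: "(z \<bullet> z) powr s = norm z powr (2 * s)" for z :: "'a::real_inner"
proof (cases "z = 0")
  case False
  then have "(z \<bullet> z) = norm z powr 2" by (simp add: dot_square_norm powr_numeral)
  then show ?thesis by (simp only: powr_powr)
qed simp

text \<open>Reflection shows that the integral equals its own negative, which covers the default
  value 0 as well.\<close>

lemma odd_integral_zero:
  fixes h :: "'a::euclidean_space \<Rightarrow> real"
  assumes "h \<in> borel_measurable borel" "\<And>z. h (- z) = - h z"
  shows "(LINT y|lborel. h (y - x)) = 0"
proof -
  have "(LINT y|lborel. h (- x + y)) = (LINT y|lborel. h y)"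
    by (rule lborel_integral_translate[OF assms(1)])
  moreover have "(LINT y|lborel. h (0 - y)) = (LINT y|lborel. h y)" by (rule lborel_integral_reflect)
  ultimately show ?thesis using assms(2) by simp
qed

lemma riesz_kernel_local_integrable:
  fixes g :: "'a::euclidean_space \<Rightarrow> real"
  assumes \<alpha>: "0 < \<alpha>" "\<alpha> < 1" and g: "continuous_on UNIV g" "\<And>y. R < norm y \<Longrightarrow> g y = 0"
  shows "integrable lborel (\<lambda>y. norm (y - x) powr (-(real DIM('a) + \<alpha> - 1)) * \<bar>g y\<bar>)"
proof -
  let ?a = "real DIM('a) + \<alpha> - 1"
  have n: "1 \<le> real DIM('a)" using DIM_positive[where 'a='a] by linarith
  obtain B where B: "0 < B" "\<And>y. norm (g y) \<le> B" using continuous_compact_support_bounded[OF g] by blast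
  have [measurable]: "g \<in> borel_measurable borel" using g(1) by (rule borel_measurable_continuous_onI)
  define \<rho> where "\<rho> = \<bar>R\<bar> + norm x + 1"
  have \<rho>: "0 < \<rho>" by (simp add: \<rho>_def add_nonneg_pos)
  have a: "0 \<le> ?a" "?a < real DIM('a)" using \<alpha> n by linarith+
  obtain C where "\<And>r. 0 < r \<Longrightarrow> integrable lborel (\<lambda>z::'a. indicator (ball 0 r) z * norm z powr (-?a))"
    using powr_near_integral[OF a] by metis
  then have i: "integrable lborel (\<lambda>y. B * (indicator (ball 0 \<rho>) (- x + y) * norm (- x + y) powr (-?a)))"
    using \<rho> by (intro integrable_mult_right lborel_integrable_translate) auto
  show ?thesis
  proof (rule Bochner_Integration.integrable_bound[OF i])
    show "AE y in lborel. norm (norm (y - x) powr (-?a) * \<bar>g y\<bar>) \<le> norm (B * (indicator (ball 0 \<rho>) (- x + y) * norm (- x + y) powr (-?a)))"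
    proof (intro always_eventually allI)
      fix y
      show "norm (norm (y - x) powr (-?a) * \<bar>g y\<bar>) \<le> norm (B * (indicator (ball 0 \<rho>) (- x + y) * norm (- x + y) powr (-?a)))"
      proof (cases "R < norm y")
        case False
        have "norm (y - x) < \<rho>" using False norm_triangle_ineq4[of y x] by (simp add: \<rho>_def)
        then show ?thesis using B by (simp add: abs_mult mult.commute mult_right_mono)
      qed (simp add: g)
    qed
  qed measurable
qed

text \<open>The kernel is regularised to \<open>(|z|\<^sup>2 + e) powr (-a/2)\<close>, for which integration by parts is classical.
  The term with \<open>\<phi> x\<close> in the fractional divergence is invisible there, by oddness.\<close>

lemma riesz_identity:
  fixes \<phi> :: "'a::euclidean_space \<Rightarrow> 'a"
  assumes \<alpha>: "0 < \<alpha>" "\<alpha> < 1" and \<phi>: "test_field \<phi>"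
  shows "(real DIM('a) + \<alpha> - 1) * (LINT y|lborel. frac_kernel \<alpha> \<phi> x y) =
    (LINT y|lborel. norm (y - x) powr (-(real DIM('a) + \<alpha> - 1)) * div_field \<phi> y)"
proof -
  let ?n = "real DIM('a)"
  \<comment> \<open>With this exponent the derivative of the regularised kernel is -a z times a
    power that tends to \<open>norm z powr (-(n + \<alpha> + 1))\<close>, the kernel of the
    fractional divergence. As a = n - (1 - \<alpha>), the limit kernel is that of the Riesz
    potential of order 1 - \<alpha>.\<close>
  define a where "a = ?n + \<alpha> - 1"
  have n: "1 \<le> ?n" using DIM_positive[where 'a='a] by linarith
  have a: "0 < a" unfolding a_def using \<alpha> n by linarith
  obtain R L where R: "\<forall>x. R < norm x \<longrightarrow> \<phi> x = 0" and L: "0 < L" "\<forall>x y. norm (\<phi> x - \<phi> y) \<le> L * norm (x - y)"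
    using test_field_bounds[OF \<phi>] by blast
  have \<phi>c: "continuous_on UNIV \<phi>" by (rule test_field_continuous[OF \<phi>])
  have [measurable]: "\<phi> \<in> borel_measurable borel" using \<phi>c by (rule borel_measurable_continuous_onI)
  have [measurable]: "div_field \<phi> \<in> borel_measurable borel" by (rule div_field_measurable[OF \<phi>])
  obtain B where B: "0 < B" "\<And>y. norm (\<phi> y) \<le> B"
    using continuous_compact_support_bounded[OF \<phi>c] R by metis
  have dsupp: "div_field \<phi> y = 0" if "R < norm y" for y
    by (rule div_field_zero[OF \<phi>, of "cball 0 R"]) (use R that in auto)
  define e where "e k = 1 / real (Suc k)" for k
  have e: "0 < e k" for k by (simp add: e_def)
  have e0: "e \<longlonglongrightarrow> 0" unfolding e_def using LIMSEQ_inverse_real_of_nat by (simp add: inverse_eq_divide)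
  define q where "q k y = (y - x) \<bullet> (y - x) + e k" for k y
  have q: "0 < q k y" "(y - x) \<bullet> (y - x) \<le> q k y" for k y
    using e[of k] inner_ge_zero[of "y - x"] unfolding q_def by linarith+
  have qc: "continuous_on UNIV (q k)" for k unfolding q_def by (intro continuous_intros)
  have [measurable]: "q k \<in> borel_measurable borel" for k using qc by (rule borel_measurable_continuous_onI)
  define K where "K k y = q k y powr (-a/2)" for k y
  define G where "G k y = q k y powr (-a/2 - 1)" for k y
  have Gc: "continuous_on UNIV (G k)" for k unfolding G_def using qc q(1)
    by (intro continuous_on_powr continuous_on_const) (auto simp: less_imp_neq[symmetric])
  have Kd: "(K k has_derivative (\<lambda>v. - a * ((y - x) \<bullet> v) * G k y)) (at y)" for k y
  proof -
    have 1: "(q k has_derivative (\<lambda>v. 2 * ((y - x) \<bullet> v))) (at y)"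
      unfolding q_def by (auto intro!: derivative_eq_intros simp: inner_commute)
    have 2: "((\<lambda>t. t powr (-a/2)) has_real_derivative (-a/2) * q k y powr (-a/2 - 1)) (at (q k y))"
      by (rule has_real_derivative_powr[OF q(1)])
    have "(\<lambda>v. (-a/2) * q k y powr (-a/2 - 1) * (2 * ((y - x) \<bullet> v))) = (\<lambda>v. - a * ((y - x) \<bullet> v) * G k y)"
      by (simp add: G_def fun_eq_iff)
    with has_derivative_compose[OF 1 2[unfolded has_field_derivative_def]]
    show ?thesis unfolding K_def by simp
  qed
  have parts: "(LINT y|lborel. K k y * div_field \<phi> y) = a * (LINT y|lborel. ((y - x) \<bullet> (\<phi> y - \<phi> x)) * G k y)"
    and dom1: "norm (((y - x) \<bullet> (\<phi> y - \<phi> x)) * G k y) \<le> frac_majorant \<alpha> L (2 * B) 1 (y - x)" for k y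
  proof -
    have cK: "continuous_on UNIV (\<lambda>y. - a * ((y - x) \<bullet> v) * G k y)" for v
      using Gc[of k] by (intro continuous_intros)
    have ibp: "(LINT y|lborel. K k y * div_field \<phi> y) = - (LINT y|lborel. - a * ((y - x) \<bullet> \<phi> y) * G k y)"
      and ii: "integrable lborel (\<lambda>y. - a * ((y - x) \<bullet> \<phi> y) * G k y)"
      using integration_by_parts[OF \<phi> Kd[of k] cK] by blast+
    have "integrable lborel (\<lambda>y. (-1/a) * (- a * ((y - x) \<bullet> \<phi> y) * G k y))" using ii by (rule integrable_mult_right)
    then have i1: "integrable lborel (\<lambda>y. ((y - x) \<bullet> \<phi> y) * G k y)" using a by simp
    \<comment> \<open>Regularisation only decreases the kernel, so one integrable majorant serves
      all \<open>k\<close>.\<close>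
    have dom: "norm (((y - x) \<bullet> (\<phi> y - \<phi> x)) * G k y) \<le> frac_majorant \<alpha> L (2 * B) 1 (y - x)" for y
    proof (cases "y = x")
      case False
      have le2: "norm (\<phi> y - \<phi> x) \<le> 2 * B" using norm_triangle_ineq4[of "\<phi> y" "\<phi> x"] B(2)[of x] B(2)[of y] by linarith
      have "G k y \<le> ((y - x) \<bullet> (y - x)) powr (-a/2 - 1)"
        unfolding G_def using q(2)[where k=k and y=y] a False by (intro powr_mono2') auto
      also have "\<dots> = norm (y - x) powr (-(?n + \<alpha> + 1))"
      proof -
        have "2 * (-a/2 - 1) = -(?n + \<alpha> + 1)" by (simp add: a_def)
        then show ?thesis unfolding powr_sq_norm by (simp only:)
      qed
      finally have G: "G k y \<le> norm (y - x) powr (-(?n + \<alpha> + 1))" .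
      have "norm (((y - x) \<bullet> (\<phi> y - \<phi> x)) * G k y) \<le> (norm (y - x) * norm (\<phi> y - \<phi> x)) * norm (y - x) powr (-(?n + \<alpha> + 1))"
        using Cauchy_Schwarz_ineq2[of "y - x" "\<phi> y - \<phi> x"] G by (auto simp: abs_mult G_def intro!: mult_mono)
      also have "\<dots> = norm (\<phi> y - \<phi> x) * (norm (y - x) * norm (y - x) powr (-(?n + \<alpha> + 1)))" by simp
      also have "norm (y - x) * norm (y - x) powr (-(?n + \<alpha> + 1)) = norm (y - x) powr (-(?n + \<alpha>))"
        using powr_mult_base[of "norm (y - x)" "-(?n + \<alpha> + 1)"] by simp
      also have "norm (\<phi> y - \<phi> x) * norm (y - x) powr (-(?n + \<alpha>)) \<le> frac_majorant \<alpha> L (2 * B) 1 (y - x)"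
        by (rule frac_kernel_le_majorant) (use L le2 in auto)
      finally show ?thesis .
    qed (use L B in \<open>simp add: frac_majorant_def\<close>)
    then show "norm (((y - x) \<bullet> (\<phi> y - \<phi> x)) * G k y) \<le> frac_majorant \<alpha> L (2 * B) 1 (y - x)" .
    obtain C1 C2 where mi: "\<And>A B r. 0 < r \<Longrightarrow> integrable lborel (frac_majorant \<alpha> A B r :: 'a \<Rightarrow> real)"
      by (rule frac_majorant_integral[OF \<alpha>, where 'a='a]) (rule that)
    have "integrable lborel (\<lambda>y. frac_majorant \<alpha> L (2 * B) 1 (- x + y))"
      by (rule lborel_integrable_translate[OF mi]) simp
    then have i2: "integrable lborel (\<lambda>y. ((y - x) \<bullet> (\<phi> y - \<phi> x)) * G k y)"
    proof (rule Bochner_Integration.integrable_bound)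
      show "(\<lambda>y. ((y - x) \<bullet> (\<phi> y - \<phi> x)) * G k y) \<in> borel_measurable lborel" unfolding G_def by measurable
      show "AE y in lborel. norm (((y - x) \<bullet> (\<phi> y - \<phi> x)) * G k y) \<le> norm (frac_majorant \<alpha> L (2 * B) 1 (- x + y))"
        using dom by (intro always_eventually allI) (auto intro: order_trans[OF _ abs_ge_self])
    qed
    have odd: "(LINT y|lborel. ((y - x) \<bullet> \<phi> x) * G k y) = 0"
      using odd_integral_zero[of "\<lambda>z. (z \<bullet> \<phi> x) * (z \<bullet> z + e k) powr (-a/2 - 1)" x] by (simp add: G_def q_def)
    have "(LINT y|lborel. ((y - x) \<bullet> \<phi> y) * G k y) - (LINT y|lborel. ((y - x) \<bullet> (\<phi> y - \<phi> x)) * G k y)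
       = (LINT y|lborel. ((y - x) \<bullet> \<phi> y) * G k y - ((y - x) \<bullet> (\<phi> y - \<phi> x)) * G k y)"
      using i1 i2 by (rule Bochner_Integration.integral_diff[symmetric])
    also have "\<dots> = (LINT y|lborel. ((y - x) \<bullet> \<phi> x) * G k y)"
      by (intro Bochner_Integration.integral_cong) (auto simp: inner_diff_right algebra_simps)
    also note odd
    finally have "(LINT y|lborel. ((y - x) \<bullet> \<phi> y) * G k y) = (LINT y|lborel. ((y - x) \<bullet> (\<phi> y - \<phi> x)) * G k y)" by simp
    then show "(LINT y|lborel. K k y * div_field \<phi> y) = a * (LINT y|lborel. ((y - x) \<bullet> (\<phi> y - \<phi> x)) * G k y)"
      unfolding ibp by (simp add: mult.assoc)
  qed
  have qlim: "(\<lambda>k. q k y powr s) \<longlonglongrightarrow> norm (y - x) powr (2 * s)" if "y \<noteq> x" for y s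
  proof -
    have "(\<lambda>k. q k y powr s) \<longlonglongrightarrow> ((y - x) \<bullet> (y - x) + 0) powr s"
      unfolding q_def using that by (intro tendsto_intros e0) auto
    then show ?thesis by (simp add: powr_sq_norm)
  qed
  have 1: "(\<lambda>k. LINT y|lborel. K k y * div_field \<phi> y) \<longlonglongrightarrow> (LINT y|lborel. norm (y - x) powr (-a) * div_field \<phi> y)"
  proof (rule integral_dominated_convergence[where w="\<lambda>y. norm (y - x) powr (-a) * \<bar>div_field \<phi> y\<bar>"])
    show "integrable lborel (\<lambda>y. norm (y - x) powr (-a) * \<bar>div_field \<phi> y\<bar>)"
      unfolding a_def by (rule riesz_kernel_local_integrable[OF \<alpha> div_field_continuous[OF \<phi>] dsupp])
    \<comment> \<open>At \<open>y = x\<close> the regularised kernels blow up while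
      \<open>0 powr (-a)\<close> is 0 by convention, hence the exclusion of one point.\<close>
    show "AE y in lborel. (\<lambda>k. K k y * div_field \<phi> y) \<longlonglongrightarrow> norm (y - x) powr (-a) * div_field \<phi> y"
      using AE_lborel_singleton[of x]
    proof eventually_elim
      case (elim y)
      then show ?case unfolding K_def using qlim[of y "-a/2"] by (intro tendsto_mult tendsto_const) auto
    qed
    show "AE y in lborel. norm (K k y * div_field \<phi> y) \<le> norm (y - x) powr (-a) * \<bar>div_field \<phi> y\<bar>" for k
      using AE_lborel_singleton[of x]
    proof eventually_elim
      case (elim y)
      have "K k y \<le> ((y - x) \<bullet> (y - x)) powr (-a/2)"
        unfolding K_def using q(2)[where k=k and y=y] a elim by (intro powr_mono2') auto
      also have "\<dots> = norm (y - x) powr (-a)" unfolding powr_sq_norm by simp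
      finally show ?case by (simp add: abs_mult K_def mult_right_mono)
    qed
  qed (auto simp: K_def)
  have 2: "(\<lambda>k. LINT y|lborel. ((y - x) \<bullet> (\<phi> y - \<phi> x)) * G k y) \<longlonglongrightarrow> (LINT y|lborel. frac_kernel \<alpha> \<phi> x y)"
  proof (rule integral_dominated_convergence[where w="\<lambda>y. frac_majorant \<alpha> L (2 * B) 1 (- x + y)"])
    obtain C1 C2 where mi: "\<And>A B r. 0 < r \<Longrightarrow> integrable lborel (frac_majorant \<alpha> A B r :: 'a \<Rightarrow> real)"
      by (rule frac_majorant_integral[OF \<alpha>, where 'a='a]) (rule that)
    show "integrable lborel (\<lambda>y. frac_majorant \<alpha> L (2 * B) 1 (- x + y))"
      by (rule lborel_integrable_translate[OF mi]) simp
    show "AE y in lborel. norm (((y - x) \<bullet> (\<phi> y - \<phi> x)) * G k y) \<le> frac_majorant \<alpha> L (2 * B) 1 (- x + y)" for k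
      using dom1[where k=k] by (intro always_eventually) auto
    show "AE y in lborel. (\<lambda>k. ((y - x) \<bullet> (\<phi> y - \<phi> x)) * G k y) \<longlonglongrightarrow> frac_kernel \<alpha> \<phi> x y"
      using AE_lborel_singleton[of x]
    proof eventually_elim
      case (elim y)
      have "(\<lambda>k. ((y - x) \<bullet> (\<phi> y - \<phi> x)) * G k y) \<longlonglongrightarrow> ((y - x) \<bullet> (\<phi> y - \<phi> x)) * norm (y - x) powr (2 * (-a/2 - 1))"
        unfolding G_def by (intro tendsto_mult tendsto_const qlim elim)
      moreover have "2 * (-a/2 - 1) = -(?n + \<alpha> + 1)" by (simp add: a_def)
      ultimately show ?case by (simp only: powr_minus_divide times_divide_eq_right mult_1_right)
    qed
  qed (auto simp: G_def)
  have "(\<lambda>k. LINT y|lborel. K k y * div_field \<phi> y) \<longlonglongrightarrow> a * (LINT y|lborel. frac_kernel \<alpha> \<phi> x y)"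
    unfolding parts by (intro tendsto_intros 2)
  with 1 show ?thesis unfolding a_def[symmetric] using LIMSEQ_unique by blast
qed


text \<open>The condition on \<open>P\<close> says that the Riesz kernel is in the dual space \<open>L\<^sup>Q\<close> at infinity.\<close>

lemma riesz_potential_integrable:
  fixes f :: "'a::euclidean_space \<Rightarrow> real"
  assumes \<alpha>: "0 < \<alpha>" "\<alpha> < 1" and f[measurable]: "f \<in> borel_measurable borel"
    and P: "1 \<le> P" "P * (1 - \<alpha>) < real DIM('a)" and fP: "integrable lborel (\<lambda>x. \<bar>f x\<bar> powr P)" and R: "0 < R"
  shows "integrable (lborel \<Otimes>\<^sub>M lborel) (\<lambda>(x, y). f x * (norm (y - x) powr (-(real DIM('a) + \<alpha> - 1)) * indicator (ball 0 R) y))"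
proof -
  let ?n = "real DIM('a)"
  define a where "a = ?n + \<alpha> - 1"
  have n: "1 \<le> ?n" using DIM_positive[where 'a='a] by linarith
  have a: "0 < a" "0 \<le> a" "a < ?n" unfolding a_def using \<alpha> n by linarith+
  obtain C where C: "0 < C" "\<And>r. 0 < r \<Longrightarrow> integrable lborel (\<lambda>z::'a. indicator (ball 0 r) z * norm z powr (-a))"
    "\<And>r. 0 < r \<Longrightarrow> (LINT z|lborel. indicator (ball (0::'a) r) z * norm z powr (-a)) \<le> C * r powr (?n - a)"
    by (rule powr_near_integral[OF a(2,3)]) (rule that)
  have Bm[measurable]: "ball (0::'a) r \<in> sets borel" for r by simp
  have ki: "integrable lborel (\<lambda>y. norm (y - x) powr (-a) * indicator (ball 0 R) y)" for x :: 'a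
  proof -
    have "integrable lborel (\<lambda>y. indicator (ball 0 (R + norm x)) (- x + y) * norm (- x + y) powr (-a))"
      using R by (intro lborel_integrable_translate C(2)) (simp add: add_pos_nonneg)
    then show ?thesis
    proof (rule Bochner_Integration.integrable_bound)
      show "AE y in lborel. norm (norm (y - x) powr (-a) * indicator (ball 0 R) y) \<le> norm (indicator (ball 0 (R + norm x)) (- x + y) * norm (- x + y) powr (-a) :: real)"
      proof (intro always_eventually allI)
        fix y
        have "norm (y - x) < R + norm x" if "norm y < R" using that norm_triangle_ineq4[of y x] by simp
        then show "norm (norm (y - x) powr (-a) * indicator (ball 0 R) y) \<le> norm (indicator (ball 0 (R + norm x)) (- x + y) * norm (- x + y) powr (-a) :: real)"
          by (simp add: indicator_def)
      qed
    qed measurable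
  qed
  \<comment> \<open>The potential of the indicator of a ball: bounded near the ball and of order
    \<open>norm x powr (-a)\<close> far away, as \<open>H\<close> expresses. Integrating in
    \<open>y\<close> first thus reduces the claim to integrability of |f| times
    \<open>H\<close>.\<close>
  define g where "g x = (LINT y|lborel. norm (y - x) powr (-a) * indicator (ball 0 R) y)" for x :: 'a
  define A where "A = C * (3 * R) powr (?n - a)"
  define B where "B = 2 powr a * measure lborel (ball (0::'a) R)"
  have AB: "0 \<le> A" "0 \<le> B" using C(1) by (auto simp: A_def B_def)
  define H where "H x = A * indicator (ball 0 (2 * R)) x + B * (indicator {x. 2 * R \<le> norm x} x * norm x powr (-a))" for x :: 'a
  have H0: "0 \<le> H x" for x using AB by (simp add: H_def)
  have gH: "g x \<le> H x" for x
  proof (cases "norm x < 2 * R")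
    case True
    have "g x \<le> (LINT y|lborel. indicator (ball 0 (3 * R)) (- x + y) * norm (- x + y) powr (-a))"
      unfolding g_def
    proof (rule integral_mono')
      show "integrable lborel (\<lambda>y. indicator (ball 0 (3 * R)) (- x + y) * norm (- x + y) powr (-a))"
        using R by (intro lborel_integrable_translate C(2)) simp
      fix y
      have "norm (y - x) < 3 * R" if "norm y < R" using that True norm_triangle_ineq4[of y x] by simp
      then show "norm (y - x) powr (-a) * indicator (ball 0 R) y \<le> indicator (ball 0 (3 * R)) (- x + y) * norm (- x + y) powr (-a)"
        by (simp add: indicator_def)
    qed simp
    also have "\<dots> = (LINT z|lborel. indicator (ball (0::'a) (3 * R)) z * norm z powr (-a))"
      by (rule lborel_integral_translate) measurable
    also have "\<dots> \<le> A" unfolding A_def using R by (intro C(3)) simp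
    finally show ?thesis using True by (simp add: H_def)
  next
    case False
    have "g x \<le> (LINT y|lborel. (norm x / 2) powr (-a) * indicator (ball (0::'a) R) y)"
      unfolding g_def
    proof (rule integral_mono')
      show "integrable lborel (\<lambda>y::'a. (norm x / 2) powr (-a) * indicator (ball 0 R) y)"
        using emeasure_lborel_ball_finite by (intro integrable_mult_right integrable_real_indicator) auto
      fix y
      have "norm (y - x) powr (-a) \<le> (norm x / 2) powr (-a)" if "norm y < R"
      proof (rule powr_mono2')
        show "norm x / 2 \<le> norm (y - x)" using that False norm_triangle_ineq2[of x y] by (simp add: norm_minus_commute)
        show "0 < norm x / 2" using False R by linarith
      qed (use a in simp)
      then show "norm (y - x) powr (-a) * indicator (ball 0 R) y \<le> (norm x / 2) powr (-a) * indicator (ball 0 R) y"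
        by (simp add: indicator_def)
    qed simp
    also have "\<dots> = B * norm x powr (-a)"
      using emeasure_lborel_ball_finite by (simp add: B_def powr_divide powr_minus field_simps)
    finally show ?thesis using False by (simp add: H_def)
  qed
  have g0: "0 \<le> g x" for x unfolding g_def by (rule Bochner_Integration.integral_nonneg) simp
  have [measurable]: "H \<in> borel_measurable borel" unfolding H_def by measurable
  have fH: "integrable lborel (\<lambda>x. \<bar>f x\<bar> * H x)"
  proof (cases "P = 1")
    \<comment> \<open>The conjugate exponent would be infinite; boundedness of \<open>H\<close>
      takes the place of Young's inequality.\<close>
    case True
    have "H x \<le> A + B * (2 * R) powr (-a)" for x
    proof (cases "norm x < 2 * R")
      case False
      then have "norm x powr (-a) \<le> (2 * R) powr (-a)" using R a by (intro powr_mono2') auto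
      then have "B * norm x powr (-a) \<le> B * (2 * R) powr (-a)" using AB by (intro mult_left_mono)
      then show ?thesis using False AB by (simp add: H_def add_increasing)
    qed (use AB R in \<open>simp add: H_def\<close>)
    then have "\<bar>H x\<bar> \<le> A + B * (2 * R) powr (-a)" for x using H0[of x] by simp
    moreover have "integrable lborel (\<lambda>x. \<bar>f x\<bar>)" using fP True by simp
    ultimately have "integrable lborel (\<lambda>x. H x *\<^sub>R \<bar>f x\<bar>)"
      by (intro integrable_bounded_scaleR) auto
    then show ?thesis by (simp add: mult.commute)
  next
    case False
    then have P1: "1 < P" using P by simp
    define Q where "Q = P / (P - 1)"
    have Q: "1 < Q" "1/P + 1/Q = 1" using P1 by (auto simp: Q_def field_simps)
    \<comment> \<open>Multiplied out, this is P (1 - \<alpha>) < n, which is where the range p <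
      n/(1 - \<alpha>) enters.\<close>
    have aQ: "?n < a * Q"
    proof -
      have "?n * (P - 1) < a * P" using P(2) by (simp add: a_def algebra_simps)
      then show ?thesis using P1 by (simp add: Q_def field_simps)
    qed
    obtain E where E: "\<And>r. 0 < r \<Longrightarrow> integrable lborel (\<lambda>z::'a. indicator {z. r \<le> norm z} z * norm z powr (-(a * Q)))"
      by (rule powr_far_integral[OF aQ]) (rule that)
    have HQ: "H x powr Q = A powr Q * indicator (ball 0 (2 * R)) x + B powr Q * (indicator {x. 2 * R \<le> norm x} x * norm x powr (-(a * Q)))" for x
      using AB by (cases "norm x < 2 * R") (auto simp: H_def powr_mult powr_powr)
    have HQi: "integrable lborel (\<lambda>x. H x powr Q)"
      unfolding HQ using E[of "2 * R"] R emeasure_lborel_ball_finite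
      by (intro Bochner_Integration.integrable_add integrable_mult_right integrable_real_indicator) auto
    have "integrable lborel (\<lambda>x. \<bar>f x\<bar> powr P + H x powr Q)" using fP HQi by (rule Bochner_Integration.integrable_add)
    then show ?thesis
    proof (rule Bochner_Integration.integrable_bound)
      show "AE x in lborel. norm (\<bar>f x\<bar> * H x) \<le> norm (\<bar>f x\<bar> powr P + H x powr Q)"
      proof (intro always_eventually allI)
        fix x
        have d: "t / u \<le> t" if "1 < u" "0 \<le> t" for t u :: real using that by (simp add: divide_le_eq mult_le_cancel_left1)
        have "\<bar>f x\<bar> * H x \<le> \<bar>f x\<bar> powr P / P + H x powr Q / Q"
          by (rule Youngs_inequality) (use P1 Q H0 in auto)
        also have "\<dots> \<le> \<bar>f x\<bar> powr P + H x powr Q" by (intro add_mono d P1 Q) auto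
        finally show "norm (\<bar>f x\<bar> * H x) \<le> norm (\<bar>f x\<bar> powr P + H x powr Q)" using H0[of x] by (simp add: abs_mult)
      qed
    qed measurable
  qed
  have "integrable (lborel \<Otimes>\<^sub>M lborel) (\<lambda>(x, y). f x * (norm (y - x) powr (-a) * indicator (ball 0 R) y))"
  proof (rule lborel_pair.Fubini_integrable)
    show "(\<lambda>(x, y). f x * (norm (y - x) powr (-a) * indicator (ball 0 R) y)) \<in> borel_measurable (lborel \<Otimes>\<^sub>M lborel)"
      by measurable
    show "AE x in lborel. integrable lborel (\<lambda>y. case (x, y) of (x, y) \<Rightarrow> f x * (norm (y - x) powr (-a) * indicator (ball 0 R) y))"
      using ki by (intro always_eventually) auto
    have eq: "(LINT y|lborel. norm (case (x, y) of (x, y) \<Rightarrow> f x * (norm (y - x) powr (-a) * indicator (ball 0 R) y))) = \<bar>f x\<bar> * g x" for x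
      by (simp add: abs_mult g_def)
    have [measurable]: "g \<in> borel_measurable borel" unfolding g_def by measurable
    show "integrable lborel (\<lambda>x. LINT y|lborel. norm (case (x, y) of (x, y) \<Rightarrow> f x * (norm (y - x) powr (-a) * indicator (ball 0 R) y)))"
      unfolding eq
    proof (rule Bochner_Integration.integrable_bound[OF fH])
      show "AE x in lborel. norm (\<bar>f x\<bar> * g x) \<le> norm (\<bar>f x\<bar> * H x)"
        using gH g0 H0 by (intro always_eventually allI) (auto simp: abs_mult intro!: mult_left_mono)
    qed measurable
  qed
  then show ?thesis by (simp add: a_def)
qed

text \<open>Fubini moves the Riesz kernel from the divergence to \<open>f\<close> and so produces
  \<open>u\<close>, a multiple of the Riesz potential of order 1 - \<alpha>. A Borel version
  \<open>f'\<close> of \<open>f\<close> provides measurability on the product. Local integrability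
  of \<open>u\<close> is the form in which it can be paired with compactly supported
  divergences.\<close>

lemma riesz_potential:
  fixes f :: "'a::euclidean_space \<Rightarrow> real"
  assumes \<alpha>: "0 < \<alpha>" "\<alpha> < 1" and P: "1 \<le> P" "P * (1 - \<alpha>) < real DIM('a)"
    and f: "f \<in> borel_measurable lebesgue" "integrable lebesgue (\<lambda>x. \<bar>f x\<bar> powr P)"
  obtains u :: "'a \<Rightarrow> real" where "u \<in> borel_measurable borel" "\<And>R. 0 < R \<Longrightarrow> integrable lborel (\<lambda>y. indicator (ball 0 R) y * u y)"
    "\<And>\<phi>. test_field \<phi> \<Longrightarrow> (LINT x|lebesgue. f x * frac_div \<alpha> \<phi> x) = (LINT y|lborel. u y * div_field \<phi> y)"
proof -
  let ?n = "real DIM('a)"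
  define a where "a = ?n + \<alpha> - 1"
  have n: "1 \<le> ?n" using DIM_positive[where 'a='a] by linarith
  have a: "0 < a" unfolding a_def using \<alpha> n by linarith
  obtain f' where f'[measurable]: "f' \<in> borel_measurable lborel" and ff': "AE x in lborel. f x = f' x"
    using completion_ex_borel_measurable_real[OF f(1)] by blast
  have ffL: "AE x in lebesgue. f x = f' x" using ff' by (rule AE_completion)
  have f'P: "integrable lborel (\<lambda>x. \<bar>f' x\<bar> powr P)"
  proof -
    have "integrable lebesgue (\<lambda>x. \<bar>f' x\<bar> powr P)"
      by (rule integrable_cong_AE_imp[OF f(2)]) (use ffL in \<open>auto intro: measurable_completion elim!: eventually_mono\<close>)
    then show ?thesis by (simp add: integrable_completion)
  qed
  \<comment> \<open>\<open>riesz_identity\<close> carries the factor \<open>a\<close>, which is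
    divided out here.\<close>
  define c where "c = frac_const DIM('a) \<alpha> / a"
  define u where "u y = c * (LINT x|lborel. f' x * norm (y - x) powr (-a))" for y
  have um: "u \<in> borel_measurable borel" unfolding u_def by measurable
  have pi: "integrable (lborel \<Otimes>\<^sub>M lborel) (\<lambda>(x, y). f' x * (norm (y - x) powr (-a) * indicator (ball 0 R) y))" if "0 < R" for R
    unfolding a_def by (rule riesz_potential_integrable[OF \<alpha> _ P f'P that]) simp
  show ?thesis
  proof (rule that[of u, OF um])
    fix R :: real assume R: "0 < R"
    have "integrable lborel (\<lambda>y. LINT x|lborel. f' x * (norm (y - x) powr (-a) * indicator (ball 0 R) y))"
      by (rule lborel_pair.integrable_snd) (rule pi[OF R])
    then have "integrable lborel (\<lambda>y. c * (LINT x|lborel. f' x * (norm (y - x) powr (-a) * indicator (ball 0 R) y)))"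
      by (rule integrable_mult_right)
    moreover have "(\<lambda>y. c * (LINT x|lborel. f' x * (norm (y - x) powr (-a) * indicator (ball 0 R) y))) = (\<lambda>y. indicator (ball 0 R) y * u y)"
      by (simp add: u_def fun_eq_iff indicator_def)
    ultimately show "integrable lborel (\<lambda>y. indicator (ball 0 R) y * u y)" by simp
  next
    fix \<phi> :: "'a \<Rightarrow> 'a" assume \<phi>: "test_field \<phi>"
    obtain R0 where R0: "0 < R0" "\<forall>x. R0 < norm x \<longrightarrow> \<phi> x = 0" using test_field_bounds[OF \<phi>] by blast
    have dsupp: "div_field \<phi> y = 0" if "R0 < norm y" for y
      by (rule div_field_zero[OF \<phi>, of "cball 0 R0"]) (use R0 that in auto)
    have dm[measurable]: "div_field \<phi> \<in> borel_measurable borel" by (rule div_field_measurable[OF \<phi>])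
    obtain B where B: "\<And>y. norm (div_field \<phi> y) \<le> B"
      using continuous_compact_support_bounded[OF div_field_continuous[OF \<phi>] dsupp] by blast
    have fd: "frac_div \<alpha> \<phi> x = c * (LINT y|lborel. norm (y - x) powr (-a) * div_field \<phi> y)" for x
      unfolding frac_div_lborel[OF test_field_continuous[OF \<phi>]] riesz_identity[OF \<alpha> \<phi>, folded a_def, symmetric]
      using a by (simp add: c_def)
    have [measurable]: "frac_div \<alpha> \<phi> \<in> borel_measurable borel" unfolding fd[abs_def] by measurable
    \<comment> \<open>The open ball of radius \<open>R0 + 1\<close> contains the closed ball
      carrying the divergence; inserting its indicator brings in the joint integrability
      \<open>pi\<close>.\<close>
    have ind: "indicator (ball 0 (R0 + 1)) y * div_field \<phi> y = div_field \<phi> y" for y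
      using dsupp[of y] by (auto simp: indicator_def)
    have "integrable (lborel \<Otimes>\<^sub>M lborel) (\<lambda>z. div_field \<phi> (snd z) *\<^sub>R (case z of (x, y) \<Rightarrow> f' x * (norm (y - x) powr (-a) * indicator (ball 0 (R0 + 1)) y)))"
      by (rule integrable_bounded_scaleR[OF pi]) (use B R0 in auto)
    moreover have "(\<lambda>z. div_field \<phi> (snd z) *\<^sub>R (case z of (x, y) \<Rightarrow> f' x * (norm (y - x) powr (-a) * indicator (ball 0 (R0 + 1)) y)))
      = (\<lambda>(x, y). f' x * norm (y - x) powr (-a) * div_field \<phi> y)"
      using ind by (auto simp: fun_eq_iff mult_ac)
    ultimately have I: "integrable (lborel \<Otimes>\<^sub>M lborel) (\<lambda>(x, y). f' x * norm (y - x) powr (-a) * div_field \<phi> y)" by simp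
    have "(LINT x|lebesgue. f x * frac_div \<alpha> \<phi> x) = (LINT x|lebesgue. f' x * frac_div \<alpha> \<phi> x)"
    proof (rule integral_cong_AE)
      have "frac_div \<alpha> \<phi> \<in> borel_measurable lebesgue" "f' \<in> borel_measurable lebesgue"
        by (rule measurable_completion, simp)+
      then show "(\<lambda>x. f x * frac_div \<alpha> \<phi> x) \<in> borel_measurable lebesgue" "(\<lambda>x. f' x * frac_div \<alpha> \<phi> x) \<in> borel_measurable lebesgue"
        using f(1) by (auto intro: borel_measurable_times)
    qed (use ffL in \<open>auto elim!: eventually_mono\<close>)
    also have "\<dots> = (LINT x|lborel. f' x * frac_div \<alpha> \<phi> x)"
      by (rule integral_completion) measurable
    also have "\<dots> = (LINT x|lborel. c * (LINT y|lborel. f' x * norm (y - x) powr (-a) * div_field \<phi> y))"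
      unfolding fd by (simp add: mult.assoc mult.left_commute)
    also have "\<dots> = c * (LINT y|lborel. LINT x|lborel. f' x * norm (y - x) powr (-a) * div_field \<phi> y)"
      using lborel_pair.Fubini_integral[OF I] by simp
    also have "\<dots> = (LINT y|lborel. u y * div_field \<phi> y)"
      by (simp add: u_def mult.assoc[of c])
    finally show "(LINT x|lebesgue. f x * frac_div \<alpha> \<phi> x) = (LINT y|lborel. u y * div_field \<phi> y)" .
  qed
qed

section \<open>Truncation does not increase the variation\<close>

lemma Cdiff_translate: "Cdiff n f \<Longrightarrow> Cdiff n (\<lambda>y. f (y - x))"
proof (induction n arbitrary: f)
  case (Suc n)
  obtain D where D: "\<And>x. (f has_derivative D x) (at x)" "\<And>v. Cdiff n (\<lambda>x. D x v)"
    using Suc.prems by auto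
  have "((\<lambda>y. f (y - x)) has_derivative D (y - x)) (at y)" for y
  proof -
    have "((\<lambda>y. y - x) has_derivative (\<lambda>v. v)) (at y)" by (auto intro!: derivative_eq_intros)
    from has_derivative_compose[OF this D(1)] show ?thesis by simp
  qed
  then show ?case by (rule Cdiff_SucI) (rule Suc.IH[OF D(2)])
qed simp

lemma Cdiff_scaleR_left: "Cdiff n f \<Longrightarrow> Cdiff n (\<lambda>y. f y *\<^sub>R v)"
proof (induction n arbitrary: f)
  case (Suc n)
  obtain D where D: "\<And>x. (f has_derivative D x) (at x)" "\<And>v. Cdiff n (\<lambda>x. D x v)"
    using Suc.prems by auto
  show ?case
    by (rule Cdiff_SucI[where D="\<lambda>x w. D x w *\<^sub>R v"]) (auto intro: has_derivative_scaleR_left D Suc.IH)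
qed simp

text \<open>For the smooth \<open>W\<close> the chain rule gives the gradient as
  \<open>T' (W x)\<close> times that of \<open>W\<close>, and the latter is at most the mollified
  \<open>\<mu>\<close>. Fubini puts the mollifier on \<open>norm (\<phi> x)\<close> instead, at the
  cost \<open>L * \<epsilon> * m\<close>. Finally \<open>T\<close> is 1-Lipschitz, so L1 closeness
  of \<open>W\<close> to \<open>u\<close> on the support of \<open>\<phi>\<close> passes to the
  truncations.\<close>

lemma truncation_variation_bound:
  fixes \<mu> :: "'a::euclidean_space measure" and \<sigma> :: "'a \<Rightarrow> 'a" and u :: "'a \<Rightarrow> real"
  assumes \<mu>: "sets \<mu> = sets borel" "finite_measure \<mu>" and \<sigma>: "\<sigma> \<in> borel_measurable \<mu>" "\<And>x. norm (\<sigma> x) = 1"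
    and u[measurable]: "u \<in> borel_measurable borel" and uloc: "\<And>R. 0 < R \<Longrightarrow> integrable lborel (\<lambda>y. indicator (ball 0 R) y * u y)"
    and Du: "\<And>\<phi>. test_field \<phi> \<Longrightarrow> (LINT y|lborel. u y * div_field \<phi> y) = - (LINT x|\<mu>. \<phi> x \<bullet> \<sigma> x)"
    and T: "\<And>t. (T has_real_derivative T' t) (at t)" "continuous_on UNIV T'" "\<And>t. \<bar>T' t\<bar> \<le> 1"
    and \<phi>: "test_field \<phi>"
  shows "\<bar>LINT y|lborel. T (u y) * div_field \<phi> y\<bar> \<le> (LINT x|\<mu>. norm (\<phi> x))"
proof (rule field_le_epsilon)
  fix e :: real assume e: "0 < e"
  interpret finite_measure \<mu> by fact
  interpret P: pair_sigma_finite lborel \<mu> ..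
  have sp: "space \<mu> = UNIV" using sets_eq_imp_space_eq[OF \<mu>(1)] by simp
  have sP: "sets (lborel \<Otimes>\<^sub>M \<mu>) = sets (borel \<Otimes>\<^sub>M borel)" using \<mu>(1) by (intro sets_pair_measure_cong) auto
  obtain R L where R: "0 < R" "\<forall>x. R < norm x \<longrightarrow> \<phi> x = 0" and L: "0 < L" "\<forall>x y. norm (\<phi> x - \<phi> y) \<le> L * norm (x - y)"
    using test_field_bounds[OF \<phi>] by blast
  have \<phi>c: "continuous_on UNIV \<phi>" by (rule test_field_continuous[OF \<phi>])
  have [measurable]: "\<phi> \<in> borel_measurable borel" using \<phi>c by (rule borel_measurable_continuous_onI)
  have dm[measurable]: "div_field \<phi> \<in> borel_measurable borel" by (rule div_field_measurable[OF \<phi>])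
  have dsupp: "div_field \<phi> y = 0" if "R < norm y" for y
    by (rule div_field_zero[OF \<phi>, of "cball 0 R"]) (use R that in auto)
  obtain B where B: "0 < B" "\<And>y. norm (div_field \<phi> y) \<le> B"
    using continuous_compact_support_bounded[OF div_field_continuous[OF \<phi>] dsupp] by blast
  have Tc: "continuous_on UNIV T"
    using T(1) by (intro DERIV_continuous_on) (auto intro: has_field_derivative_at_within)
  have [measurable]: "T \<in> borel_measurable borel" using Tc by (rule borel_measurable_continuous_onI)
  have Tlip: "\<bar>T s - T t\<bar> \<le> \<bar>s - t\<bar>" for s t
    using field_differentiable_bound[of UNIV T T' 1 s t] T(1,3) by auto
  \<comment> \<open>The cutoff makes convolution available. Since \<open>\<epsilon> \<le> 1\<close>,
    averages at points of norm at most \<open>R\<close> only see norms at most R + 1, where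
    \<open>w\<close> equals \<open>u\<close>.\<close>
  define w where "w y = indicator (ball 0 (R + 2)) y * u y" for y
  have w: "integrable lborel w" unfolding w_def using R by (intro uloc) simp
  define m where "m = measure \<mu> UNIV"
  have m: "0 \<le> m" by (simp add: m_def)
  have Lm: "0 < L * m + 1" using L m by (simp add: add_nonneg_pos)
  obtain \<delta> where \<delta>: "0 < \<delta>" "\<And>\<epsilon> \<rho>. 0 < \<epsilon> \<Longrightarrow> \<epsilon> \<le> \<delta> \<Longrightarrow> mollifier \<epsilon> \<rho> \<Longrightarrow> (LINT x|lborel. norm (conv \<rho> w x - w x)) < e / (2 * B)"
    by (rule mollifier_L1_approx[OF w, of "e / (2 * B)"]) (use e B in simp, rule that)
  define \<epsilon> where "\<epsilon> = min 1 (min \<delta> (e / (2 * (L * m + 1))))"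
  have \<epsilon>: "0 < \<epsilon>" "\<epsilon> \<le> 1" "\<epsilon> \<le> \<delta>" "\<epsilon> \<le> e / (2 * (L * m + 1))" using \<delta> e Lm by (auto simp: \<epsilon>_def)
  have Lem: "L * \<epsilon> * m \<le> e/2"
  proof -
    have "\<epsilon> * (L * m + 1) \<le> e / (2 * (L * m + 1)) * (L * m + 1)" using \<epsilon> Lm by (intro mult_right_mono) auto
    also have "\<dots> = e/2" using Lm by (simp add: field_simps)
    finally show ?thesis using \<epsilon> by (simp add: algebra_simps)
  qed
  obtain \<rho> :: "'a \<Rightarrow> real" where \<rho>: "mollifier \<epsilon> \<rho>" using mollifier_exists[OF \<epsilon>(1)] by blast
  note rho = mollifierD[OF \<rho>]
  have [measurable]: "\<rho> \<in> borel_measurable borel" by (rule rho)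
  obtain D where D: "\<And>x. (\<rho> has_derivative D x) (at x)" "\<And>v. smooth_fun (\<lambda>x. D x v)"
    using smooth_fun_derivative[OF rho(1)] by auto
  have Dsupp: "D z v = 0" if "\<epsilon> < norm z" for z v
    by (rule deriv_zero_outside_support[OF D(1), of "cball 0 \<epsilon>"]) (use rho(3) that in auto)
  \<comment> \<open>Oddness trades the derivative of \<open>\<rho> (x - y)\<close> in
    \<open>x\<close> for that of \<open>\<rho> (y - x)\<close> in \<open>y\<close>, up to sign; this
    matches \<open>G\<close> with the divergence of \<open>\<psi>\<close> below.\<close>
  have Dodd: "D (- z) v = - D z v" for z v
  proof -
    have "((\<lambda>z. - z) has_derivative (\<lambda>v. - v)) (at z)" by (auto intro!: derivative_eq_intros)
    from has_derivative_compose[OF this D(1)]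
    have "(\<rho> has_derivative (\<lambda>v. D (- z) (- v))) (at z)" using rho(6) by simp
    then have "(\<lambda>v. D (- z) (- v)) = D z" using D(1) has_derivative_unique by blast
    then show ?thesis
      using linear_neg[OF bounded_linear.linear[OF has_derivative_bounded_linear[OF D(1)[of "- z"]]], of v] by (metis add.inverse_inverse)
  qed
  define W where "W = conv \<rho> w"
  define G where "G x v = conv (\<lambda>z. D z v) w x" for x v
  have Wd: "(W has_derivative G x) (at x)" for x
    unfolding W_def G_def by (rule conv_has_derivative[OF rho(1) rho(3) D(1) w])
  have Gc: "continuous_on UNIV (\<lambda>x. G x v)" for v
    unfolding G_def by (rule smooth_fun_continuous[OF smooth_conv[OF D(2) Dsupp w]])
  have Wc: "continuous_on UNIV W" by (rule continuous_if_has_derivative[OF Wd])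
  have [measurable]: "W \<in> borel_measurable borel" using Wc by (rule borel_measurable_continuous_onI)
  have \<rho>i\<mu>: "integrable \<mu> (\<lambda>y. \<rho> (y - x))" for x
  proof -
    obtain M where M: "\<And>z. norm (\<rho> z) \<le> M" using continuous_compact_support_bounded[OF rho(7) rho(3)] by blast
    have "(\<lambda>y. \<rho> (y - x)) \<in> borel_measurable \<mu>" unfolding measurable_cong_sets[OF \<mu>(1) refl] by measurable
    then show ?thesis by (rule integrable_const_bound[where B=M, rotated]) (use M in auto)
  qed
  have Gle: "\<bar>G x v\<bar> \<le> norm v * (LINT y|\<mu>. \<rho> (y - x))" if x: "norm x \<le> R" for x v
  proof -
    \<comment> \<open>The translated mollifier in direction \<open>v\<close> is itself a test field,
      with divergence \<open>D (y - x) v\<close>; so \<open>G x v\<close> is a value of the pairing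
      with \<open>\<mu>\<close> and \<open>\<sigma>\<close> given by \<open>Du\<close>.\<close>
    define \<psi> where "\<psi> y = \<rho> (y - x) *\<^sub>R v" for y
    have \<psi>: "test_field \<psi>"
    proof (rule test_fieldI[where R="norm x + \<epsilon>"])
      show "smooth_fun \<psi>" unfolding \<psi>_def
        by (rule smooth_fun_if_Cdiff, rule Cdiff_scaleR_left, rule Cdiff_translate, rule smooth_fun_Cdiff[OF rho(1)])
      fix y :: 'a assume "norm x + \<epsilon> < norm y"
      then have "\<epsilon> < norm (y - x)" using norm_triangle_ineq2[of y x] by simp
      then show "\<psi> y = 0" by (simp add: \<psi>_def rho(3))
    qed
    have div: "div_field \<psi> y = D (y - x) v" for y
    proof -
      have "((\<lambda>y. y - x) has_derivative (\<lambda>v. v)) (at y)" by (auto intro!: derivative_eq_intros)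
      from has_derivative_compose[OF this D(1)]
      have "(\<psi> has_derivative (\<lambda>w. D (y - x) w *\<^sub>R v)) (at y)"
        unfolding \<psi>_def by (intro has_derivative_scaleR_left) simp
      from div_field_eq[OF this] have "div_field \<psi> y = (\<Sum>b\<in>Basis. D (y - x) b * (v \<bullet> b))" by simp
      moreover have lin: "linear (D (y - x))" using D(1) has_derivative_bounded_linear bounded_linear.linear by blast
      have "D (y - x) v = (\<Sum>b\<in>Basis. D (y - x) b * (v \<bullet> b))"
        using linear_sum[OF lin, of "\<lambda>b. (v \<bullet> b) *\<^sub>R b" Basis] linear_scale[OF lin]
        by (simp add: euclidean_representation mult.commute)
      ultimately show ?thesis by simp
    qed
    have "G x v = (LINT y|lborel. - (u y * div_field \<psi> y))"
      unfolding G_def conv_def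
    proof (rule Bochner_Integration.integral_cong)
      fix y
      have eq: "D (x - y) v = - D (y - x) v" using Dodd[of "y - x" v] by simp
      show "D (x - y) v *\<^sub>R w y = - (u y * div_field \<psi> y)"
      proof (cases "norm (y - x) \<le> \<epsilon>")
        case True
        have "norm y \<le> norm (y - x) + norm x" using norm_triangle_ineq[of "y - x" x] by simp
        then have "norm y < R + 2" using True x \<epsilon> by linarith
        then show ?thesis unfolding eq div w_def by simp
      next
        case False
        then show ?thesis unfolding eq div using Dsupp[of "y - x"] by simp
      qed
    qed simp
    also have "\<dots> = (LINT y|\<mu>. \<psi> y \<bullet> \<sigma> y)" using Du[OF \<psi>] by simp
    finally have "\<bar>G x v\<bar> \<le> (LINT y|\<mu>. \<bar>\<psi> y \<bullet> \<sigma> y\<bar>)" using integral_abs_bound[of \<mu> "\<lambda>y. \<psi> y \<bullet> \<sigma> y"] by simp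
    also have "\<dots> \<le> (LINT y|\<mu>. norm v * \<rho> (y - x))"
    proof (rule integral_mono')
      show "integrable \<mu> (\<lambda>y. norm v * \<rho> (y - x))" using \<rho>i\<mu> by (rule integrable_mult_right)
      fix y show "\<bar>\<psi> y \<bullet> \<sigma> y\<bar> \<le> norm v * \<rho> (y - x)"
        using Cauchy_Schwarz_ineq2[of "\<psi> y" "\<sigma> y"] \<sigma>(2)[of y] rho(2)[of "y - x"] by (simp add: \<psi>_def mult.commute)
    qed (use rho(2) in auto)
    finally show ?thesis by simp
  qed
  have TW: "((\<lambda>x. T (W x)) has_derivative (\<lambda>v. T' (W x) * G x v)) (at x)" for x
    using has_derivative_compose[OF Wd T(1)[unfolded has_field_derivative_def]] by simp
  have TWc: "continuous_on UNIV (\<lambda>x. T' (W x) * G x v)" for v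
    using Gc Wc by (intro continuous_intros continuous_on_compose2[OF T(2)]) auto
  note parts = integration_by_parts[OF \<phi> TW TWc]
  define q where "q x = norm (\<phi> x) * (LINT y|\<mu>. \<rho> (y - x))" for x
  have J: "(\<integral>\<^sup>+x. ennreal (q x) \<partial>lborel) \<le> ennreal ((LINT x|\<mu>. norm (\<phi> x)) + L * \<epsilon> * m)"
  proof -
    have fm: "(\<lambda>(x, y). ennreal (norm (\<phi> x) * \<rho> (y - x))) \<in> borel_measurable (lborel \<Otimes>\<^sub>M \<mu>)"
      unfolding measurable_cong_sets[OF sP refl] by measurable
    have "(\<integral>\<^sup>+x. ennreal (q x) \<partial>lborel) = (\<integral>\<^sup>+x. \<integral>\<^sup>+y. ennreal (norm (\<phi> x) * \<rho> (y - x)) \<partial>\<mu> \<partial>lborel)"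
    proof (rule nn_integral_cong)
      fix x
      have "ennreal (q x) = ennreal (LINT y|\<mu>. norm (\<phi> x) * \<rho> (y - x))" by (simp add: q_def)
      also have "\<dots> = (\<integral>\<^sup>+y. ennreal (norm (\<phi> x) * \<rho> (y - x)) \<partial>\<mu>)"
        using \<rho>i\<mu>[of x] rho(2) by (intro nn_integral_eq_integral[symmetric]) auto
      finally show "ennreal (q x) = (\<integral>\<^sup>+y. ennreal (norm (\<phi> x) * \<rho> (y - x)) \<partial>\<mu>)" .
    qed
    also have "\<dots> = (\<integral>\<^sup>+y. \<integral>\<^sup>+x. ennreal (norm (\<phi> x) * \<rho> (y - x)) \<partial>lborel \<partial>\<mu>)"
      by (rule P.Fubini'[symmetric]) (rule fm)
    also have "\<dots> \<le> (\<integral>\<^sup>+y. ennreal (norm (\<phi> y) + L * \<epsilon>) \<partial>\<mu>)"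
    proof (rule nn_integral_mono)
      fix y
      have ni: "integrable lborel (\<lambda>x. norm (\<phi> x))"
        using integrable_continuous_compact_support[OF \<phi>c] R by (intro integrable_norm) blast
      have "(\<integral>\<^sup>+x. ennreal (norm (\<phi> x) * \<rho> (y - x)) \<partial>lborel) = ennreal (conv \<rho> (\<lambda>x. norm (\<phi> x)) y)"
        unfolding conv_def using mollifier_conv_integrable(1)[OF \<rho> ni, of y] rho(2)
        by (subst nn_integral_eq_integral) (auto simp: mult.commute)
      also have "norm (conv \<rho> (\<lambda>x. norm (\<phi> x)) y - norm (\<phi> y)) \<le> L * \<epsilon>"
      proof (rule mollifier_conv_near[OF \<rho> ni])
        fix z :: 'a assume "norm z \<le> \<epsilon>"
        then have "L * norm z \<le> L * \<epsilon>" using L by (intro mult_left_mono) auto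
        then show "norm (norm (\<phi> (y - z)) - norm (\<phi> y)) \<le> L * \<epsilon>"
          using L(2)[rule_format, of "y - z" y] norm_triangle_ineq3[of "\<phi> (y - z)" "\<phi> y"] by simp
      qed (use L \<epsilon> in auto)
      then have "ennreal (conv \<rho> (\<lambda>x. norm (\<phi> x)) y) \<le> ennreal (norm (\<phi> y) + L * \<epsilon>)" by (intro ennreal_leI) simp
      finally show "(\<integral>\<^sup>+x. ennreal (norm (\<phi> x) * \<rho> (y - x)) \<partial>lborel) \<le> ennreal (norm (\<phi> y) + L * \<epsilon>)" .
    qed
    also have "\<dots> = ennreal (LINT y|\<mu>. norm (\<phi> y) + L * \<epsilon>)"
      using test_field_integrable_finite[OF \<phi> \<mu>] L \<epsilon> by (intro nn_integral_eq_integral) auto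
    also have "(LINT y|\<mu>. norm (\<phi> y) + L * \<epsilon>) = (LINT x|\<mu>. norm (\<phi> x)) + L * \<epsilon> * m"
      using test_field_integrable_finite[OF \<phi> \<mu>] by (simp add: m_def sp)
    finally show ?thesis .
  qed
  have "\<bar>LINT y|lborel. T (W y) * div_field \<phi> y\<bar> \<le> (LINT x|\<mu>. norm (\<phi> x)) + L * \<epsilon> * m"
  proof -
    have "ennreal \<bar>LINT y|lborel. T (W y) * div_field \<phi> y\<bar> = ennreal (norm (LINT x|lborel. T' (W x) * G x (\<phi> x)))"
      unfolding parts(1) by simp
    also have "\<dots> \<le> (\<integral>\<^sup>+x. ennreal (norm (T' (W x) * G x (\<phi> x))) \<partial>lborel)"
      by (rule integral_norm_bound_ennreal[OF parts(3)])
    also have "\<dots> \<le> (\<integral>\<^sup>+x. ennreal (q x) \<partial>lborel)"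
    proof (intro nn_integral_mono ennreal_leI)
      fix x
      have lin: "linear (G x)" using Wd has_derivative_bounded_linear bounded_linear.linear by blast
      have "\<bar>G x (\<phi> x)\<bar> \<le> q x"
      proof (cases "norm x \<le> R")
        case True then show ?thesis unfolding q_def by (rule Gle)
      next
        case False then show ?thesis using R(2) linear_0[OF lin] by (simp add: q_def)
      qed
      then show "norm (T' (W x) * G x (\<phi> x)) \<le> q x"
        using T(3)[of "W x"] mult_mono[of "\<bar>T' (W x)\<bar>" 1 "\<bar>G x (\<phi> x)\<bar>" "q x"] by (simp add: abs_mult)
    qed
    also note J
    finally show ?thesis using L \<epsilon> m by (subst (asm) ennreal_le_iff) auto
  qed
  moreover have "\<bar>(LINT y|lborel. T (u y) * div_field \<phi> y) - (LINT y|lborel. T (W y) * div_field \<phi> y)\<bar> \<le> e/2"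
  proof -
    have Wi: "integrable lborel (\<lambda>x. norm (W x - w x))"
      unfolding W_def using mollifier_conv_L1(1)[OF \<rho> w] w by auto
    have pw: "\<bar>T (u y) * div_field \<phi> y - T (W y) * div_field \<phi> y\<bar> \<le> B * norm (W y - w y)" for y
    proof (cases "R < norm y")
      case False
      then have "w y = u y" by (simp add: w_def)
      then have "\<bar>T (u y) - T (W y)\<bar> \<le> norm (W y - w y)" using Tlip[of "u y" "W y"] by simp
      then have "\<bar>T (u y) - T (W y)\<bar> * \<bar>div_field \<phi> y\<bar> \<le> norm (W y - w y) * B" using B(2)[of y] by (intro mult_mono) auto
      then show ?thesis by (simp only: left_diff_distrib[symmetric] abs_mult mult.commute[of B])
    qed (use B in \<open>simp add: dsupp\<close>)
    have di: "integrable lborel (\<lambda>y. T (u y) * div_field \<phi> y - T (W y) * div_field \<phi> y)"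
    proof (rule Bochner_Integration.integrable_bound[where f="\<lambda>y. B * norm (W y - w y)"])
      show "integrable lborel (\<lambda>y. B * norm (W y - w y))" using Wi by (rule integrable_mult_right)
      show "AE y in lborel. norm (T (u y) * div_field \<phi> y - T (W y) * div_field \<phi> y) \<le> norm (B * norm (W y - w y))"
        using pw B(1) by (intro always_eventually) (simp add: abs_mult)
    qed measurable
    have Tui: "integrable lborel (\<lambda>y. T (u y) * div_field \<phi> y)"
      using Bochner_Integration.integrable_add[OF di parts(2)] by simp
    have "(LINT y|lborel. T (u y) * div_field \<phi> y) - (LINT y|lborel. T (W y) * div_field \<phi> y) =
      (LINT y|lborel. T (u y) * div_field \<phi> y - T (W y) * div_field \<phi> y)"
      by (rule Bochner_Integration.integral_diff[symmetric, OF Tui parts(2)])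
    also have "\<bar>\<dots>\<bar> \<le> (LINT y|lborel. \<bar>T (u y) * div_field \<phi> y - T (W y) * div_field \<phi> y\<bar>)" by (rule integral_abs_bound)
    also have "\<dots> \<le> (LINT y|lborel. B * norm (W y - w y))"
      by (rule integral_mono') (use Wi pw B in auto)
    also have "\<dots> = B * (LINT y|lborel. norm (W y - w y))" by simp
    also have "\<dots> \<le> B * (e / (2 * B))" unfolding W_def using \<delta>(2)[OF \<epsilon>(1,3) \<rho>] B by (intro mult_left_mono) auto
    also have "\<dots> = e/2" using B by simp
    finally show ?thesis .
  qed
  ultimately show "\<bar>LINT y|lborel. T (u y) * div_field \<phi> y\<bar> \<le> (LINT x|\<mu>. norm (\<phi> x)) + e" using Lem by linarith
qed

section \<open>Absolute continuity\<close>

text \<open>Bounded by \<open>1 / sqrt \<delta>\<close>, with derivative (1 + \<delta> t^2)^(-3/2)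
  between 0 and 1, and tending to the identity as \<delta> tends to 0. Unlike a cutoff by minimum
  and maximum it is C1, as the chain rule requires.\<close>

definition soft_trunc :: "real \<Rightarrow> real \<Rightarrow> real" where
  "soft_trunc \<delta> t = t / sqrt (1 + \<delta> * t\<^sup>2)"

lemma soft_trunc_deriv:
  assumes "0 < \<delta>"
  shows "(soft_trunc \<delta> has_real_derivative 1 / ((1 + \<delta> * t\<^sup>2) * sqrt (1 + \<delta> * t\<^sup>2))) (at t)"
proof -
  define q where "q = 1 + \<delta> * t\<^sup>2"
  have q: "0 < q" using assms by (simp add: q_def add_pos_nonneg)
  have "((\<lambda>t. sqrt (1 + \<delta> * t\<^sup>2)) has_real_derivative \<delta> * t / sqrt q) (at t)"
    using q unfolding q_def by (auto intro!: derivative_eq_intros simp: field_simps)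
  then have "((\<lambda>t. t / sqrt (1 + \<delta> * t\<^sup>2)) has_real_derivative (1 * sqrt q - t * (\<delta> * t / sqrt q)) / (sqrt q * sqrt q)) (at t)"
    using q unfolding q_def by (intro DERIV_divide DERIV_ident) auto
  moreover have "(1 * sqrt q - t * (\<delta> * t / sqrt q)) / (sqrt q * sqrt q) = 1 / (q * sqrt q)"
  proof -
    have "1 * sqrt q - t * (\<delta> * t / sqrt q) = (q - \<delta> * t\<^sup>2) / sqrt q"
      using q by (simp add: field_simps power2_eq_square)
    also have "q - \<delta> * t\<^sup>2 = 1" by (simp add: q_def)
    finally show ?thesis using q by simp
  qed
  ultimately show ?thesis by (simp add: soft_trunc_def[abs_def] q_def)
qed

lemma soft_trunc_bounds:
  assumes "0 < \<delta>"
  shows "\<bar>soft_trunc \<delta> t\<bar> \<le> 1 / sqrt \<delta>" "\<bar>soft_trunc \<delta> t\<bar> \<le> \<bar>t\<bar>"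
proof -
  have 1: "1 \<le> sqrt (1 + \<delta> * t\<^sup>2)" using assms by simp
  have "sqrt \<delta> * \<bar>t\<bar> = sqrt (\<delta> * t\<^sup>2)" by (simp add: real_sqrt_mult)
  also have "\<dots> \<le> sqrt (1 + \<delta> * t\<^sup>2)" by simp
  finally have "\<bar>t\<bar> \<le> sqrt (1 + \<delta> * t\<^sup>2) / sqrt \<delta>" using assms by (simp add: pos_le_divide_eq mult.commute)
  moreover have "0 < sqrt (1 + \<delta> * t\<^sup>2)" using 1 by linarith
  ultimately have "\<bar>t\<bar> / sqrt (1 + \<delta> * t\<^sup>2) \<le> 1 / sqrt \<delta>" by (simp add: pos_divide_le_eq)
  then show "\<bar>soft_trunc \<delta> t\<bar> \<le> 1 / sqrt \<delta>" using 1 by (simp add: soft_trunc_def abs_divide)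
  have "\<bar>t\<bar> * 1 \<le> \<bar>t\<bar> * sqrt (1 + \<delta> * t\<^sup>2)" using 1 by (intro mult_left_mono) auto
  then show "\<bar>soft_trunc \<delta> t\<bar> \<le> \<bar>t\<bar>" using 1 by (simp add: soft_trunc_def abs_divide divide_le_eq)
qed

text \<open>A divergence of size L/r on a ball of volume of order r^n gives r^(n - 1). Boundedness
  of \<open>h\<close> is what the truncations are made for.\<close>

lemma div_field_compact_integral:
  fixes \<phi> :: "'a::euclidean_space \<Rightarrow> 'a" and h :: "'a \<Rightarrow> real"
  assumes \<phi>: "scaled_field L x r \<phi>" and r: "0 < r" and L: "0 < L"
    and h: "\<And>y. \<bar>h y\<bar> \<le> M" "0 \<le> M"
  shows "\<bar>LINT y|lborel. h y * div_field \<phi> y\<bar> \<le>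
    M * (real DIM('a) * L * unit_ball_vol (real DIM('a)) * 3 ^ DIM('a)) * r powr (real DIM('a) - 1)"
proof -
  let ?n = "real DIM('a)"
  have t: "test_field \<phi>" and lip: "\<And>y z. norm (\<phi> y - \<phi> z) \<le> L / r * norm (y - z)"
    and supp: "\<And>y. 3 * r < norm (y - x) \<Longrightarrow> \<phi> y = 0" using \<phi> by (auto simp: scaled_field_def)
  have "\<bar>LINT y|lborel. h y * div_field \<phi> y\<bar> \<le> (LINT y|lborel. \<bar>h y * div_field \<phi> y\<bar>)" by (rule integral_abs_bound)
  also have "\<dots> \<le> (LINT y|lborel. M * (?n * (L / r)) * indicator (cball x (3 * r)) y)"
  proof (rule integral_mono')
    show "integrable lborel (\<lambda>y. M * (?n * (L / r)) * indicator (cball x (3 * r)) y)"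
      using emeasure_lborel_cball_finite by (intro integrable_mult_right integrable_real_indicator) auto
    fix y
    show "\<bar>h y * div_field \<phi> y\<bar> \<le> M * (?n * (L / r)) * indicator (cball x (3 * r)) y"
    proof (cases "y \<in> cball x (3 * r)")
      case True
      then show ?thesis using mult_mono[OF h(1) div_field_bound[OF t lip] h(2)] by (simp add: abs_mult)
    next
      case False
      have "div_field \<phi> y = 0"
        by (rule div_field_zero[OF t _ closed_cball False]) (use supp in \<open>simp add: dist_norm norm_minus_commute\<close>)
      then show ?thesis using False by simp
    qed
  qed (use h(2) L r in auto)
  also have "\<dots> = M * (?n * (L / r)) * (unit_ball_vol ?n * (3 * r) ^ DIM('a))"
    using r by (simp add: content_cball)
  also have "\<dots> = M * (?n * L * unit_ball_vol ?n * 3 ^ DIM('a)) * (r ^ DIM('a) / r)"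
    by (simp add: power_mult_distrib)
  also have "r ^ DIM('a) / r = r powr (?n - 1)" using r by (simp add: powr_diff powr_realpow)
  finally show ?thesis .
qed

text \<open>The decay constant of the truncation at level \<open>k\<close> grows like sqrt (k + 1),
  but it does not occur in the bound by \<open>\<mu> (-K)\<close>. That bound is therefore uniform
  in \<open>k\<close> and passes to the untruncated pairing by dominated convergence.\<close>

lemma abs_cont_if_potential:
  fixes \<mu> :: "'a::euclidean_space measure" and \<sigma> :: "'a \<Rightarrow> 'a" and u :: "'a \<Rightarrow> real"
  assumes \<mu>: "sets \<mu> = sets borel" "finite_measure \<mu>" and \<sigma>: "\<sigma> \<in> borel_measurable \<mu>" "\<And>x. norm (\<sigma> x) = 1"
    and u[measurable]: "u \<in> borel_measurable borel" and uloc: "\<And>R. 0 < R \<Longrightarrow> integrable lborel (\<lambda>y. indicator (ball 0 R) y * u y)"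
    and Du: "\<And>\<phi>. test_field \<phi> \<Longrightarrow> (LINT y|lborel. u y * div_field \<phi> y) = - (LINT x|\<mu>. \<phi> x \<bullet> \<sigma> x)"
  shows "abs_cont_hausdorff \<mu> (real DIM('a) - 1)"
proof (rule abs_cont_hausdorffI[OF \<mu> \<sigma>])
  have "1 \<le> real DIM('a)" using DIM_positive[where 'a='a] by linarith
  then show "0 \<le> real DIM('a) - 1" by simp
next
  fix K :: "'a set" and \<Psi> :: "'a \<Rightarrow> 'a"
  assume s: "0 < real DIM('a) - 1" and K: "compact K" "hausdorff (real DIM('a) - 1) K = 0"
    and \<Psi>: "test_field \<Psi>" "\<And>x. norm (\<Psi> x) \<le> 1"
  define T where "T k = soft_trunc (1 / real (Suc k))" for k
  define T' where "T' k t = 1 / ((1 + 1 / real (Suc k) * t\<^sup>2) * sqrt (1 + 1 / real (Suc k) * t\<^sup>2))" for k t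
  have T: "(T k has_real_derivative T' k t) (at t)" for k t
    unfolding T_def T'_def by (rule soft_trunc_deriv) simp
  have pos: "1 \<le> 1 + 1 / real (Suc k) * t\<^sup>2" for k t by simp
  have T'c: "continuous_on UNIV (T' k)" for k
  proof -
    have "(1 + 1 / real (Suc k) * t\<^sup>2) * sqrt (1 + 1 / real (Suc k) * t\<^sup>2) \<noteq> 0" for t
    proof -
      have "0 < 1 + 1 / real (Suc k) * t\<^sup>2" using pos[of k t] by linarith
      then show ?thesis by simp
    qed
    then show ?thesis unfolding T'_def by (intro continuous_intros) auto
  qed
  have T'1: "\<bar>T' k t\<bar> \<le> 1" for k t
  proof -
    have "1 * 1 \<le> (1 + 1 / real (Suc k) * t\<^sup>2) * sqrt (1 + 1 / real (Suc k) * t\<^sup>2)"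
      using pos[of k t] by (intro mult_mono) auto
    then show ?thesis unfolding T'_def by (simp add: abs_divide divide_le_eq del: of_nat_Suc)
  qed
  have Tb: "\<bar>T k t\<bar> \<le> 1 / sqrt (1 / real (Suc k))" "\<bar>T k t\<bar> \<le> \<bar>t\<bar>" for k t
    unfolding T_def by (rule soft_trunc_bounds; simp)+
  have [measurable]: "T k \<in> borel_measurable borel" for k
    unfolding T_def soft_trunc_def[abs_def] by measurable
  define \<Lambda> where "\<Lambda> k \<phi> = (LINT y|lborel. T k (u y) * div_field \<phi> y)" for k \<phi>
  have Ti: "integrable lborel (\<lambda>y. T k (u y) * div_field \<phi> y)" if \<phi>: "test_field \<phi>" for k \<phi>
  proof -
    obtain R where R: "\<forall>x. R < norm x \<longrightarrow> \<phi> x = 0" using test_field_bounds[OF \<phi>] by blast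
    have "div_field \<phi> y = 0" if "R < norm y" for y
      by (rule div_field_zero[OF \<phi>, of "cball 0 R"]) (use R that in auto)
    then have "integrable lborel (div_field \<phi>)"
      by (rule integrable_continuous_compact_support[OF div_field_continuous[OF \<phi>]])
    then have "integrable lborel (\<lambda>y. T k (u y) *\<^sub>R div_field \<phi> y)"
      by (rule integrable_bounded_scaleR) (use Tb(1) in auto)
    then show ?thesis by simp
  qed
  have "\<bar>\<Lambda> k \<Psi>\<bar> \<le> measure \<mu> (- K)" for k
  proof (rule functional_bound_off_null_set[OF \<mu> s K _ _ _ \<Psi>])
    show "\<Lambda> k (\<lambda>x. \<phi> x + \<psi> x) = \<Lambda> k \<phi> + \<Lambda> k \<psi>" if "test_field \<phi>" "test_field \<psi>" for \<phi> \<psi>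
      unfolding \<Lambda>_def using Ti[OF that(1)] Ti[OF that(2)] by (simp add: div_field_add[OF that] distrib_left)
    show "\<bar>\<Lambda> k \<phi>\<bar> \<le> (LINT x|\<mu>. norm (\<phi> x))" if "test_field \<phi>" for \<phi>
      unfolding \<Lambda>_def by (rule truncation_variation_bound[OF \<mu> \<sigma> u uloc Du T T'c T'1 that])
    fix L :: real assume L: "0 < L"
    show "\<exists>C. \<forall>\<phi> x r. 0 < r \<longrightarrow> r \<le> 1 \<longrightarrow> scaled_field L x r \<phi> \<longrightarrow> \<bar>\<Lambda> k \<phi>\<bar> \<le> C * r powr (real DIM('a) - 1)"
      unfolding \<Lambda>_def
    proof (intro exI[of _ "1 / sqrt (1 / real (Suc k)) * (real DIM('a) * L * unit_ball_vol (real DIM('a)) * 3 ^ DIM('a))"] allI impI)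
      fix \<phi> :: "'a \<Rightarrow> 'a" and x r assume "0 < r" "scaled_field L x r \<phi>"
      then show "\<bar>LINT y|lborel. T k (u y) * div_field \<phi> y\<bar> \<le>
        1 / sqrt (1 / real (Suc k)) * (real DIM('a) * L * unit_ball_vol (real DIM('a)) * 3 ^ DIM('a)) * r powr (real DIM('a) - 1)"
        by (intro div_field_compact_integral L Tb(1)) auto
    qed
  qed
  moreover have "(\<lambda>k. \<Lambda> k \<Psi>) \<longlonglongrightarrow> (LINT y|lborel. u y * div_field \<Psi> y)"
    unfolding \<Lambda>_def
  proof (rule integral_dominated_convergence[where w="\<lambda>y. \<bar>u y * div_field \<Psi> y\<bar>"])
    have [measurable]: "div_field \<Psi> \<in> borel_measurable borel" by (rule div_field_measurable[OF \<Psi>(1)])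
    obtain R where R: "0 < R" "\<forall>x. R < norm x \<longrightarrow> \<Psi> x = 0" using test_field_bounds[OF \<Psi>(1)] by blast
    have ds: "div_field \<Psi> y = 0" if "R < norm y" for y
      by (rule div_field_zero[OF \<Psi>(1), of "cball 0 R"]) (use R that in auto)
    obtain B where B: "\<And>y. norm (div_field \<Psi> y) \<le> B"
      using continuous_compact_support_bounded[OF div_field_continuous[OF \<Psi>(1)] ds] by blast
    have "integrable lborel (\<lambda>y. div_field \<Psi> y *\<^sub>R (indicator (ball 0 (R + 1)) y * u y))"
      using R B by (intro integrable_bounded_scaleR uloc) auto
    moreover have "(\<lambda>y. div_field \<Psi> y *\<^sub>R (indicator (ball 0 (R + 1)) y * u y)) = (\<lambda>y. u y * div_field \<Psi> y)"
      using ds by (force simp: indicator_def)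
    ultimately have "integrable lborel (\<lambda>y. u y * div_field \<Psi> y)" by (simp only:)
    then show "integrable lborel (\<lambda>y. \<bar>u y * div_field \<Psi> y\<bar>)" by (rule integrable_abs)
    show "(\<lambda>y. u y * div_field \<Psi> y) \<in> borel_measurable lborel" by measurable
    show "(\<lambda>y. T k (u y) * div_field \<Psi> y) \<in> borel_measurable lborel" for k by measurable
    show "AE y in lborel. norm (T k (u y) * div_field \<Psi> y) \<le> \<bar>u y * div_field \<Psi> y\<bar>" for k
      using Tb(2) by (intro always_eventually allI) (auto simp: abs_mult intro!: mult_right_mono)
    show "AE y in lborel. (\<lambda>k. T k (u y) * div_field \<Psi> y) \<longlonglongrightarrow> u y * div_field \<Psi> y"
    proof (intro always_eventually allI)
      fix y
      have "(\<lambda>k. 1 / real (Suc k)) \<longlonglongrightarrow> 0" using LIMSEQ_inverse_real_of_nat by (simp add: inverse_eq_divide)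
      then have "(\<lambda>k. u y / sqrt (1 + 1 / real (Suc k) * (u y)\<^sup>2)) \<longlonglongrightarrow> u y / sqrt (1 + 0 * (u y)\<^sup>2)"
        by (intro tendsto_divide tendsto_const tendsto_real_sqrt tendsto_add tendsto_mult) auto
      then have "(\<lambda>k. T k (u y)) \<longlonglongrightarrow> u y" by (simp add: T_def soft_trunc_def)
      then show "(\<lambda>k. T k (u y) * div_field \<Psi> y) \<longlonglongrightarrow> u y * div_field \<Psi> y" by (intro tendsto_mult tendsto_const)
    qed
  qed
  ultimately have "\<bar>LINT y|lborel. u y * div_field \<Psi> y\<bar> \<le> measure \<mu> (- K)"
    by (intro Lim_bounded[OF tendsto_rabs]) auto
  then show "(LINT x|\<mu>. \<Psi> x \<bullet> \<sigma> x) \<le> measure \<mu> (- K)" using Du[OF \<Psi>(1)] by linarith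
qed

text \<open>Here the functional is the pairing with \<open>\<sigma>\<close> itself: domination by
  \<open>\<mu>\<close> is Cauchy-Schwarz with |\<sigma>| = 1, and decay is the only substantial
  input.\<close>

lemma abs_cont_if_decay:
  fixes \<mu> :: "'a::euclidean_space measure" and \<sigma> :: "'a \<Rightarrow> 'a"
  assumes \<mu>: "sets \<mu> = sets borel" "finite_measure \<mu>" and \<sigma>: "\<sigma> \<in> borel_measurable \<mu>" "\<And>x. norm (\<sigma> x) = 1"
    and s: "0 \<le> s"
    and decay: "\<And>L. 0 < L \<Longrightarrow> \<exists>C. \<forall>\<phi> x r. 0 < r \<longrightarrow> r \<le> 1 \<longrightarrow> scaled_field L x r \<phi> \<longrightarrow> \<bar>LINT x|\<mu>. \<phi> x \<bullet> \<sigma> x\<bar> \<le> C * r powr s"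
  shows "abs_cont_hausdorff \<mu> s"
proof (rule abs_cont_hausdorffI[OF \<mu> \<sigma> s])
  fix K :: "'a set" and \<Psi> :: "'a \<Rightarrow> 'a"
  assume s0: "0 < s" and K: "compact K" "hausdorff s K = 0" and \<Psi>: "test_field \<Psi>" "\<And>x. norm (\<Psi> x) \<le> 1"
  have i: "integrable \<mu> (\<lambda>x. \<phi> x \<bullet> \<sigma> x)" and le: "\<bar>\<phi> x \<bullet> \<sigma> x\<bar> \<le> norm (\<phi> x)" if "test_field \<phi>" for \<phi> x
  proof -
    have le: "\<bar>\<phi> x \<bullet> \<sigma> x\<bar> \<le> norm (\<phi> x)" for x using Cauchy_Schwarz_ineq2[of "\<phi> x" "\<sigma> x"] \<sigma>(2)[of x] by simp
    then show "\<bar>\<phi> x \<bullet> \<sigma> x\<bar> \<le> norm (\<phi> x)" .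
    have \<phi>i: "integrable \<mu> \<phi>" by (rule test_field_integrable_finite[OF that \<mu>])
    then show "integrable \<mu> (\<lambda>x. \<phi> x \<bullet> \<sigma> x)"
      by (rule Bochner_Integration.integrable_bound) (use \<phi>i \<sigma>(1) le in auto)
  qed
  have "\<bar>LINT x|\<mu>. \<Psi> x \<bullet> \<sigma> x\<bar> \<le> measure \<mu> (- K)"
  proof (rule functional_bound_off_null_set[OF \<mu> s0 K _ _ decay \<Psi>])
    show "(LINT x|\<mu>. (\<phi> x + \<psi> x) \<bullet> \<sigma> x) = (LINT x|\<mu>. \<phi> x \<bullet> \<sigma> x) + (LINT x|\<mu>. \<psi> x \<bullet> \<sigma> x)"
      if "test_field \<phi>" "test_field \<psi>" for \<phi> \<psi>
      using i[OF that(1)] i[OF that(2)] by (simp add: inner_add_left)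
    show "\<bar>LINT x|\<mu>. \<phi> x \<bullet> \<sigma> x\<bar> \<le> (LINT x|\<mu>. norm (\<phi> x))" if "test_field \<phi>" for \<phi>
      using le[OF that] test_field_integrable_finite[OF that \<mu>]
      by (intro order_trans[OF integral_abs_bound] integral_mono') auto
  qed
  then show "(LINT x|\<mu>. \<Psi> x \<bullet> \<sigma> x) \<le> measure \<mu> (- K)" by linarith
qed

theorem theorem1p1:
  fixes f :: "'a::euclidean_space \<Rightarrow> real" and \<alpha> :: real and p :: ennreal
    and \<mu> :: "'a measure" and \<sigma> :: "'a \<Rightarrow> 'a"
  assumes "0 < \<alpha>" "\<alpha> < 1" "1 \<le> p"
    and "BV_frac \<alpha> p f"
    and "frac_grad_polar \<alpha> f \<mu> \<sigma>"
  shows "(p < ennreal (real DIM('a) / (1 - \<alpha>)) \<longrightarrow>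
            abs_cont_hausdorff \<mu> (real DIM('a) - 1))
       \<and> (ennreal (real DIM('a) / (1 - \<alpha>)) \<le> p \<longrightarrow>
            abs_cont_hausdorff \<mu>
              (real DIM('a) - \<alpha> - (if p = \<infinity> then 0 else real DIM('a) / enn2real p)))"
proof -
  let ?n = "real DIM('a)"
  have n: "1 \<le> ?n" using DIM_positive[where 'a='a] by linarith
  have f: "Lp p f" using assms(4) by (simp add: BV_frac_def)
  have \<mu>: "sets \<mu> = sets borel" "finite_measure \<mu>" and \<sigma>: "\<sigma> \<in> borel_measurable \<mu>" "\<And>x. norm (\<sigma> x) = 1"
    and Df: "\<And>\<phi>. test_field \<phi> \<Longrightarrow> (LINT x|lebesgue. f x * frac_div \<alpha> \<phi> x) = - (LINT x|\<mu>. \<phi> x \<bullet> \<sigma> x)"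
    using assms(5) by (auto simp: frac_grad_polar_def)
  define P where "P = enn2real p"
  \<comment> \<open>\<open>enn2real\<close> sends \<infinity> to 0, so \<open>P\<close> represents
    \<open>p\<close> only when \<open>p\<close> is finite.\<close>
  have pP: "p = ennreal P" if "p \<noteq> \<infinity>" using that by (simp add: P_def less_top[symmetric])
  have "abs_cont_hausdorff \<mu> (?n - 1)" if p: "p < ennreal (?n / (1 - \<alpha>))"
  proof -
    have fin: "p \<noteq> \<infinity>" using p by auto
    have P0: "0 \<le> P" by (simp add: P_def)
    have P1: "1 \<le> P" using assms(3) pP[OF fin] P0 by (metis ennreal_1 ennreal_le_iff)
    have "P < ?n / (1 - \<alpha>)" using p pP[OF fin] P0 by (simp add: ennreal_less_iff)
    then have P2: "P * (1 - \<alpha>) < ?n" using assms(2) by (simp add: field_simps)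
    have f': "f \<in> borel_measurable lebesgue" "integrable lebesgue (\<lambda>x. \<bar>f x\<bar> powr P)"
      using f fin by (auto simp: Lp_def P_def)
    obtain u :: "'a \<Rightarrow> real" where u: "u \<in> borel_measurable borel" "\<And>R. 0 < R \<Longrightarrow> integrable lborel (\<lambda>y. indicator (ball 0 R) y * u y)"
      "\<And>\<phi>. test_field \<phi> \<Longrightarrow> (LINT x|lebesgue. f x * frac_div \<alpha> \<phi> x) = (LINT y|lborel. u y * div_field \<phi> y)"
      by (rule riesz_potential[OF assms(1,2) P1 P2 f']) (rule that)
    show ?thesis
      by (rule abs_cont_if_potential[OF \<mu> \<sigma> u(1,2)]) (simp_all add: u(3)[symmetric] Df)
  qed
  moreover have "abs_cont_hausdorff \<mu> (?n - \<alpha> - (if p = \<infinity> then 0 else ?n / enn2real p))"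
    if p: "ennreal (?n / (1 - \<alpha>)) \<le> p"
  proof (rule abs_cont_if_decay[OF \<mu> \<sigma>])
    \<comment> \<open>Strict because \<alpha> > 0; this gives p > 1, as the duality estimate
      demands.\<close>
    have "1 - \<alpha> < ?n" using n assms(1) by linarith
    then have "1 < ?n / (1 - \<alpha>)" using assms(2) by (simp add: less_divide_eq)
    then have "ennreal 1 < ennreal (?n / (1 - \<alpha>))" by (intro ennreal_lessI) auto
    from less_le_trans[OF this p] have p1: "1 < p" by simp
    have "?n / P \<le> 1 - \<alpha>" if "p \<noteq> \<infinity>"
    proof -
      have "ennreal (?n / (1 - \<alpha>)) \<le> ennreal P" using p pP[OF that] by (rule ord_le_eq_trans)
      moreover have "0 \<le> P" by (simp add: P_def)
      ultimately have "?n / (1 - \<alpha>) \<le> P" by (subst (asm) ennreal_le_iff)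
      then have nP: "?n \<le> P * (1 - \<alpha>)" using assms(2) by (subst (asm) pos_divide_le_eq) auto
      have "0 < P"
      proof (rule ccontr)
        assume "\<not> 0 < P"
        then have "P * (1 - \<alpha>) \<le> 0" using assms(2) by (intro mult_nonpos_nonneg) auto
        then show False using nP n by linarith
      qed
      then show ?thesis using nP by (subst pos_divide_le_eq) (auto simp: mult.commute)
    qed
    \<comment> \<open>So the exponent is at least n - 1 and in particular nonnegative.\<close>
    then have "(if p = \<infinity> then 0 else ?n / enn2real p) \<le> 1 - \<alpha>" using assms(2) by (simp add: P_def)
    then show "0 \<le> ?n - \<alpha> - (if p = \<infinity> then 0 else ?n / enn2real p)" using n by linarith
    fix L :: real assume L: "0 < L"
    obtain C where C: "\<forall>\<phi> x r. 0 < r \<longrightarrow> r \<le> 1 \<longrightarrow> scaled_field L x r \<phi> \<longrightarrow>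
      \<bar>LINT x|lebesgue. f x * frac_div \<alpha> \<phi> x\<bar> \<le> C * r powr (?n - \<alpha> - (if p = \<infinity> then 0 else ?n / enn2real p))"
      using frac_pairing_decay[OF assms(1,2) L p1 f] by blast
    have "\<bar>LINT x|\<mu>. \<phi> x \<bullet> \<sigma> x\<bar> \<le> C * r powr (?n - \<alpha> - (if p = \<infinity> then 0 else ?n / enn2real p))"
      if r: "0 < r" "r \<le> 1" and sf: "scaled_field L x r \<phi>" for \<phi> x r
    proof -
      have "\<bar>LINT x|\<mu>. \<phi> x \<bullet> \<sigma> x\<bar> = \<bar>LINT x|lebesgue. f x * frac_div \<alpha> \<phi> x\<bar>"
        using Df[of \<phi>] sf by (simp add: scaled_field_def)
      then show ?thesis using C[rule_format, OF r sf] by simp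
    qed
    then show "\<exists>C. \<forall>\<phi> x r. 0 < r \<longrightarrow> r \<le> 1 \<longrightarrow> scaled_field L x r \<phi> \<longrightarrow>
      \<bar>LINT x|\<mu>. \<phi> x \<bullet> \<sigma> x\<bar> \<le> C * r powr (?n - \<alpha> - (if p = \<infinity> then 0 else ?n / enn2real p))" by blast
  qed
  ultimately show ?thesis by blast
qed

end
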